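(* Let $\gamma:\mathbb T\to[0,1]$ be continuous at every $x\in\mathbb T\setminus\{0\}$ and satisfy $\inf_{x\in\mathbb T}\gamma(x)>0$. For each $n\in\mathbb N$ let $\mu_n$ be the Bernoulli product measure on $\{0,1\}^{\mathbb T_n}$ with marginals $\mu_n\{\eta:\eta(x)=1\}=\gamma(\tfrac{x}{n})$, $x\in\mathbb T_n$. Let $\{\eta_t:t\ge0\}$ be the symmetric simple exclusion process with a slow site at the origin of rate $g(n)$, speeded up by $n^2$ (generator $n^2\mathfrak L_n$), started from $\mu_n$. Then, for any $T>0$, any $t\in(0,T]$, every $\delta>0$ and every $H\in C(\mathbb T)$, $$\lim_{n\to\infty}\mathbb P_{\mu_n}\Big\{\Big|\frac1n\sum_{x\in\mathbb T_n}H(\tfrac{x}{n})\,\eta_t(x)-\int_{\mathbb T}H(u)\,\rho(t,u)\,du\Big|>\delta\Big\}=0,$$ where - if $g(n)=1+o(1)$ as $n\to\infty$, $\rho$ is the unique weak solution of the heat equation with periodic boundary conditions with initial condition $\rho_0=\gamma$; - if $g(n)=\alpha n^{-\beta}$ with $\alpha>0$ and $\beta>1$, $\rho$ is the unique weak solution of the heat equation with Neumann boundary conditions with initial condition $\rho_0=\gamma$.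
   Context: $\mathbb T_n=\mathbb Z/n\mathbb Z=\{0,1,\dots,n-1\}$ is the discrete torus, $\mathbb T=\mathbb R/\mathbb Z=[0,1)$ the continuous torus, and $\langle\cdot,\cdot\rangle$ is the inner product of $L^2[0,1]$. **The process.** Given $g(n)>0$, set $\xi^n_0=g(n)$ and $\xi^n_x=1$ for $x\in\mathbb T_n\setminus\{0\}$. The SSEP with a slow site is the Markov process on $\{0,1\}^{\mathbb T_n}$ with generator $$\mathfrak L_nf(\eta)=\sum_{x,y\in\mathbb T_n,\ |x-y|=1}\xi^n_x\,\eta(x)(1-\eta(y))\,[f(\eta^{x,y})-f(\eta)],$$ where $|x-y|=1$ means nearest neighbors on the torus (the sum is over ordered pairs) and $\eta^{x,y}$ is $\eta$ with the values at $x$ and $y$ exchanged. $\{\eta_t:t\ge0\}$ denotes the Markov process with generator $n^2\mathfrak L_n$, and $\mathbb P_{\mu_n}$ its law on càdlàg paths when started from $\mu_n$. **Periodic heat equation.** A bounded measurable $\rho$ on $[0,T]\times\mathbb T$ is a weak solution of $\partial_t\rho=\partial_u^2\rho$ on $\mathbb T$, $\rho(0,\cdot)=\rho_0$, if for all $t\in[0,T]$ and all $H\in C^2(\mathbb T)$, $$\langle\rho_t,H\rangle-\langle\rho_0,H\rangle-\int_0^t\langle\rho_s,\partial_u^2H\rangle\,ds=0.$$ **Sobolev spaces.** $\mathcal H^1$ is the set of $\zeta\in L^1[0,1]$ having a weak derivative $\partial_u\zeta\in L^2[0,1]$ (i.e. $\langle\partial_uG,\zeta\rangle=-\langle G,\partial_u\zeta\rangle$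 for all $G\in C^\infty$ compactly supported in $(0,1)$), with norm $\|\zeta\|_{\mathcal H^1}=(\|\zeta\|_{L^2}^2+\|\partial_u\zeta\|_{L^2}^2)^{1/2}$. $L^2(0,T;\mathcal H^1)$ is the space of measurable $\xi:[0,T]\to\mathcal H^1$ with $\int_0^T\|\xi_t\|_{\mathcal H^1}^2dt<\infty$. **Neumann heat equation.** $\rho$ is a weak solution of $\partial_t\rho=\partial_u^2\rho$ on $(0,1)$, $\partial_u\rho(t,0^+)=\partial_u\rho(t,0^-)=0$, $\rho(0,\cdot)=\rho_0$, if $\rho\in L^2(0,T;\mathcal H^1)$ and for all $t\in[0,T]$ and all $H\in C^2[0,1]$, $$\langle\rho_t,H\rangle-\langle\rho_0,H\rangle-\int_0^t\langle\rho_s,\partial_u^2H\rangle ds-\int_0^t\big(\rho_s(0^+)\partial_uH(0^+)-\rho_s(0^-)\partial_uH(0^-)\big)ds=0,$$ where $0^+$ denotes the boundary value at $0$ and $0^-$ the boundary value at $1$ (since $0\equiv1$ on the torus); $H\in C^2[0,1]$ need not be continuous on the torus at $0$. *)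

theory Defs
  imports
    "HOL-Probability.Probability"
    "HOL-Number_Theory.Cong"
    "HOL-Library.Landau_Symbols"
    "HOL-Library.Periodic_Fun"
begin

section \<open>Continuous-time Markov processes on a finite state space\<close>

text \<open>The semigroup \<open>e\<^sup>t\<^sup>G\<close> of a (bounded) generator \<open>G\<close> acting on observables.\<close>

definition generator_semigroup ::
    "(('s \<Rightarrow> real) \<Rightarrow> 's \<Rightarrow> real) \<Rightarrow> real \<Rightarrow> ('s \<Rightarrow> real) \<Rightarrow> 's \<Rightarrow> real" where
  "generator_semigroup G t f \<eta> = (\<Sum>k. t ^ k / fact k * (G ^^ k) f \<eta>)"

definition natural_filtration ::
    "'w measure \<Rightarrow> (real \<Rightarrow> 'w \<Rightarrow> 's) \<Rightarrow> real \<Rightarrow> 'w measure" where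
  "natural_filtration M X s = sigma (space M) {X u -` A \<inter> space M | u A. 0 \<le> u \<and> u \<le> s}"

definition cadlag :: "(real \<Rightarrow> 's::topological_space) \<Rightarrow> bool" where
  "cadlag \<omega> \<longleftrightarrow>
     (\<forall>t\<ge>0. (\<omega> \<longlongrightarrow> \<omega> t) (at_right t)) \<and>
     (\<forall>t>0. \<exists>l. (\<omega> \<longlongrightarrow> l) (at_left t))"

text \<open>\<open>X\<close>, defined on the probability space \<open>M\<close> and considered at times \<open>t \<ge> 0\<close> only, is a Markov
  process with cadlag paths, finite state space \<open>S\<close> and generator \<open>G\<close>.\<close>

definition markov_process_with_generator ::
    "'w measure \<Rightarrow> (real \<Rightarrow> 'w \<Rightarrow> 's::topological_space) \<Rightarrow> 's set
      \<Rightarrow> (('s \<Rightarrow> real) \<Rightarrow> 's \<Rightarrow> real) \<Rightarrow> bool" where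
  "markov_process_with_generator M X S G \<longleftrightarrow>
     prob_space M \<and>
     (\<forall>t\<ge>0. X t \<in> M \<rightarrow>\<^sub>M count_space S) \<and>
     (\<forall>\<omega>\<in>space M. cadlag (\<lambda>t. X t \<omega>)) \<and>
     (\<forall>s\<ge>0. \<forall>t\<ge>0. \<forall>f. AE \<omega> in M.
        real_cond_exp M (natural_filtration M X s) (\<lambda>\<omega>. f (X (s + t) \<omega>)) \<omega>
          = generator_semigroup G t f (X s \<omega>))"


section \<open>The exclusion process with a slow site\<close>

text \<open>The discrete torus with \<open>n\<close> sites is \<open>{..<n}\<close>. A configuration is a predicate on \<open>nat\<close>
  (\<open>True\<close> = occupied) that is \<open>False\<close> outside \<open>{..<n}\<close>; the product topology on \<open>nat \<Rightarrow> bool\<close>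
  restricts to the discrete topology on this finite set.\<close>

definition configs :: "nat \<Rightarrow> (nat \<Rightarrow> bool) set" where
  "configs n = PiE_dflt {..<n} False (\<lambda>_. UNIV)"

definition torus_neighbours :: "nat \<Rightarrow> nat \<Rightarrow> nat \<Rightarrow> bool" where
  "torus_neighbours n x y \<longleftrightarrow>
     [int x - int y = 1] (mod int n) \<or> [int x - int y = - 1] (mod int n)"

definition site_rate :: "real \<Rightarrow> nat \<Rightarrow> real" where
  "site_rate g x = (if x = 0 then g else 1)"

definition ssep_generator ::
    "nat \<Rightarrow> real \<Rightarrow> ((nat \<Rightarrow> bool) \<Rightarrow> real) \<Rightarrow> (nat \<Rightarrow> bool) \<Rightarrow> real" where
  "ssep_generator n g f \<eta> =
     (\<Sum>(x, y) \<in> {(x, y). x < n \<and> y < n \<and> torus_neighbours n x y}.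
        site_rate g x * of_bool (\<eta> x) * (1 - of_bool (\<eta> y)) * (f (\<eta>(x := \<eta> y, y := \<eta> x)) - f \<eta>))"

definition bernoulli_product :: "(real \<Rightarrow> real) \<Rightarrow> nat \<Rightarrow> (nat \<Rightarrow> bool) pmf" where
  "bernoulli_product \<gamma> n = Pi_pmf {..<n} False (\<lambda>x. bernoulli_pmf (\<gamma> (real x / real n)))"

definition slow_site_ssep ::
    "nat \<Rightarrow> real \<Rightarrow> (nat \<Rightarrow> bool) pmf \<Rightarrow> 'w measure \<Rightarrow> (real \<Rightarrow> 'w \<Rightarrow> nat \<Rightarrow> bool) \<Rightarrow> bool" where
  "slow_site_ssep n g \<mu> M X \<longleftrightarrow>
     markov_process_with_generator M X (configs n) (\<lambda>f \<eta>. (real n)\<^sup>2 * ssep_generator n g f \<eta>) \<and>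
     distr M (count_space UNIV) (X 0) = measure_pmf \<mu>"


section \<open>Function spaces\<close>

text \<open>Functions on the continuous torus are the functions on \<open>real\<close> of period \<open>1\<close>. Time-dependent
  densities \<open>\<rho> t u\<close> are only looked at for \<open>u\<close> in the unit interval.\<close>

definition continuous_on_torus :: "(real \<Rightarrow> real) \<Rightarrow> bool" where
  "continuous_on_torus H \<longleftrightarrow> periodic_fun_simple' H \<and> continuous_on UNIV H"

text \<open>\<open>H\<close> is of class \<open>C\<^sup>2\<close> on \<open>S\<close> with first and second derivatives \<open>H'\<close> and \<open>H''\<close>
  (one-sided at the end points if \<open>S\<close> is a compact interval).\<close>

definition C2_on :: "real set \<Rightarrow> (real \<Rightarrow> real) \<Rightarrow> (real \<Rightarrow> real) \<Rightarrow> (real \<Rightarrow> real) \<Rightarrow> bool" where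
  "C2_on S H H' H'' \<longleftrightarrow>
     (\<forall>u\<in>S. (H has_real_derivative H' u) (at u within S)) \<and>
     (\<forall>u\<in>S. (H' has_real_derivative H'' u) (at u within S)) \<and>
     continuous_on S H''"

definition L2_inner :: "(real \<Rightarrow> real) \<Rightarrow> (real \<Rightarrow> real) \<Rightarrow> real" where
  "L2_inner f h = (LINT u:{0..1}|lebesgue. f u * h u)"

definition L1_01 :: "(real \<Rightarrow> real) \<Rightarrow> bool" where
  "L1_01 f \<longleftrightarrow> set_integrable lebesgue {0..1} f"

definition L2_01 :: "(real \<Rightarrow> real) \<Rightarrow> bool" where
  "L2_01 f \<longleftrightarrow>
     set_borel_measurable lebesgue {0..1} f \<and> set_integrable lebesgue {0..1} (\<lambda>u. (f u)\<^sup>2)"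

definition test_function :: "(real \<Rightarrow> real) \<Rightarrow> bool" where
  "test_function G \<longleftrightarrow>
     (\<forall>k x. (deriv ^^ k) G differentiable (at x)) \<and> closure {x. G x \<noteq> 0} \<subseteq> {0<..<1}"

definition is_weak_deriv :: "(real \<Rightarrow> real) \<Rightarrow> (real \<Rightarrow> real) \<Rightarrow> bool" where
  "is_weak_deriv \<zeta> v \<longleftrightarrow>
     L2_01 v \<and> (\<forall>G. test_function G \<longrightarrow> L2_inner (deriv G) \<zeta> = - L2_inner G v)"

definition H1 :: "(real \<Rightarrow> real) set" where
  "H1 = {\<zeta>. L1_01 \<zeta> \<and> (\<exists>v. is_weak_deriv \<zeta> v)}"

definition weak_deriv :: "(real \<Rightarrow> real) \<Rightarrow> real \<Rightarrow> real" where
  "weak_deriv \<zeta> = (SOME v. is_weak_deriv \<zeta> v)"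

definition H1_norm :: "(real \<Rightarrow> real) \<Rightarrow> real" where
  "H1_norm \<zeta> = sqrt (L2_inner \<zeta> \<zeta> + L2_inner (weak_deriv \<zeta>) (weak_deriv \<zeta>))"

text \<open>Every \<open>\<zeta> \<in> H1\<close> agrees almost everywhere with a continuous function on \<open>[0,1]\<close>, unique
  there. The boundary values of \<open>\<zeta>\<close> at \<open>0\<^sup>+\<close> and \<open>0\<^sup>-\<close> are the values of that function at \<open>0\<close>
  and at \<open>1\<close> respectively.\<close>

definition continuous_version :: "(real \<Rightarrow> real) \<Rightarrow> real \<Rightarrow> real" where
  "continuous_version \<zeta> =
     (SOME z. continuous_on {0..1} z \<and> (AE u in lebesgue. u \<in> {0..1} \<longrightarrow> z u = \<zeta> u))"

text \<open>Membership in \<open>L\<^sup>2(0,T;H1)\<close>. As usual for Bochner spaces the function need only be in \<open>H1\<close>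
  for almost every time; in particular the value at time \<open>0\<close> may be a discontinuous profile.
  Since \<open>H1\<close> is separable, measurability as an \<open>H1\<close>-valued map amounts to joint measurability.\<close>

definition L2_time_H1 :: "real \<Rightarrow> (real \<Rightarrow> real \<Rightarrow> real) \<Rightarrow> bool" where
  "L2_time_H1 T \<rho> \<longleftrightarrow>
     set_borel_measurable lebesgue ({0..T} \<times> {0..1}) (\<lambda>(t, u). \<rho> t u) \<and>
     (AE t in lebesgue. t \<in> {0..T} \<longrightarrow> \<rho> t \<in> H1) \<and>
     set_integrable lebesgue {0..T} (\<lambda>t. (H1_norm (\<rho> t))\<^sup>2)"


section \<open>Weak solutions of the heat equation\<close>

text \<open>In both notions the requirement \<open>L1_01 (\<rho> t)\<close> for every \<open>t\<close> makes the pairing of \<open>\<rho> t\<close> with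
  continuous functions meaningful at every time.\<close>

definition weak_solution_periodic ::
    "real \<Rightarrow> (real \<Rightarrow> real) \<Rightarrow> (real \<Rightarrow> real \<Rightarrow> real) \<Rightarrow> bool" where
  "weak_solution_periodic T \<rho>0 \<rho> \<longleftrightarrow>
     (\<exists>B. \<forall>t\<in>{0..T}. \<forall>u\<in>{0..<1}. \<bar>\<rho> t u\<bar> \<le> B) \<and>
     set_borel_measurable lebesgue ({0..T} \<times> {0..<1}) (\<lambda>(t, u). \<rho> t u) \<and>
     (\<forall>t\<in>{0..T}. L1_01 (\<rho> t)) \<and>
     (\<forall>t\<in>{0..T}. \<forall>H H' H''. periodic_fun_simple' H \<and> C2_on UNIV H H' H'' \<longrightarrow>
        L2_inner (\<rho> t) H - L2_inner \<rho>0 H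
          - (LINT s:{0..t}|lebesgue. L2_inner (\<rho> s) H'') = 0)"

definition weak_solution_neumann ::
    "real \<Rightarrow> (real \<Rightarrow> real) \<Rightarrow> (real \<Rightarrow> real \<Rightarrow> real) \<Rightarrow> bool" where
  "weak_solution_neumann T \<rho>0 \<rho> \<longleftrightarrow>
     L2_time_H1 T \<rho> \<and>
     (\<forall>t\<in>{0..T}. L1_01 (\<rho> t)) \<and>
     (\<forall>t\<in>{0..T}. \<forall>H H' H''. C2_on {0..1} H H' H'' \<longrightarrow>
        L2_inner (\<rho> t) H - L2_inner \<rho>0 H
          - (LINT s:{0..t}|lebesgue. L2_inner (\<rho> s) H'')
          - (LINT s:{0..t}|lebesgue.
               continuous_version (\<rho> s) 0 * H' 0 - continuous_version (\<rho> s) 1 * H' 1) = 0)"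

text \<open>Solutions are identified when, at every time, they agree almost everywhere in space.\<close>

definition is_the_solution ::
    "real \<Rightarrow> ((real \<Rightarrow> real \<Rightarrow> real) \<Rightarrow> bool) \<Rightarrow> (real \<Rightarrow> real \<Rightarrow> real) \<Rightarrow> bool" where
  "is_the_solution T sol \<rho> \<longleftrightarrow>
     sol \<rho> \<and>
     (\<forall>\<rho>'. sol \<rho>' \<longrightarrow>
        (\<forall>t\<in>{0..T}. AE u in lebesgue. u \<in> {0..1} \<longrightarrow> \<rho>' t u = \<rho> t u))"


section \<open>Hydrodynamic limit\<close>

definition hydrodynamic_limit ::
    "real \<Rightarrow> (nat \<Rightarrow> 'w measure) \<Rightarrow> (nat \<Rightarrow> real \<Rightarrow> 'w \<Rightarrow> nat \<Rightarrow> bool)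
      \<Rightarrow> (real \<Rightarrow> real \<Rightarrow> real) \<Rightarrow> bool" where
  "hydrodynamic_limit T M X \<rho> \<longleftrightarrow>
     (\<forall>t\<in>{0<..T}. \<forall>\<delta>>0. \<forall>H. continuous_on_torus H \<longrightarrow>
        (\<lambda>n. measure (M n) {\<omega> \<in> space (M n).
           \<bar>(1 / real n) * (\<Sum>x<n. H (real x / real n) * of_bool (X n t \<omega> x))
              - (LINT u:{0..1}|lebesgue. H u * \<rho> t u)\<bar> > \<delta>}) \<longlonglongrightarrow> 0)"

end

theory Submission
  imports Defs
begin

text \<open>
  Let \<open>\<phi>\<close> be an eigenfunction of the Laplacian with eigenvalue \<open>-\<lambda>\<close> for the boundary conditions at hand
  (trigonometric functions of frequency \<open>2 \<pi> k\<close> on the torus, \<open>cos (\<pi> k u)\<close> for Neumann conditions), and let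
  \<open>Y\<close> be the empirical measure integrated against an exact eigenvector of the discrete Laplacian that
  approximates \<open>\<phi>\<close>. Up to errors the generator \<open>G\<close> satisfies \<open>G Y = - l Y\<close> and \<open>G (Y\<^sup>2) = - 2 l Y\<^sup>2\<close> with
  \<open>l \<longlonglongrightarrow> \<lambda>\<close>, because particles on ordinary sites interact only through a linear term and \<open>Y\<close> moves by \<open>O(1/n\<^sup>2)\<close>
  in one jump. Two Gronwall estimates then give \<open>Y \<longlonglongrightarrow> exp (- \<lambda> t) \<langle>\<gamma>, \<phi>\<rangle>\<close> in mean square.
  For a rate \<open>\<alpha> n\<^sup>-\<^sup>\<beta>\<close> with \<open>\<beta> > 1\<close> the exchange with the slow site is negligible: only \<open>O(1 + n\<^sup>2\<^sup>-\<^sup>\<beta>)\<close> particles leave it and it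
  can hold only one, so at most \<open>O(1 + n\<^sup>2\<^sup>-\<^sup>\<beta>) = o(n)\<close> particles enter it; the other sites form a reflecting segment.

  On the analytic side the coefficients \<open>\<langle>\<rho> t, \<phi>\<rangle>\<close> of any weak solution solve the same linear differential equation, which yields
  uniqueness, and the eigenfunction series is a solution. Its boundedness in the periodic case is read off
  from the hydrodynamic limit, since the empirical density lies between 0 and 1.
\<close>

section \<open>Moments of finite-state Markov processes\<close>

text \<open>The claim concerns one fixed time, so neither tightness nor a replacement lemma enters:
  mean-square convergence of each mode, uniform density of the modes and Markov's inequality
  suffice. At rate 1 the exclusion factors cancel in the net flux across a bond and leave a discrete
  gradient; the difficulty sits on the two bonds at the origin. If g tends to 1, the gradient
  structure fails there only by |g - 1|. If g is small, the drift caused by particles entering the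
  origin is of order n pointwise and is small only after integration in time. Hence the Gronwall
  estimate admits an error C * G q, with q the mass at the origin: it lies between 0 and 1/n, and
  its generator equals n times (inflow minus g times outflow). What remains is of order n * g, so
  the Neumann argument needs n * g -> 0; this is the role of \<beta> > 1. Since \<gamma> may jump at
  0, its coefficients are only known to be bounded and square summable: the series is used at
  positive times, and time 0 needs separate care throughout.\<close>

locale finite_markov =
  fixes M :: "'w measure" and X :: "real \<Rightarrow> 'w \<Rightarrow> 's::topological_space" and S :: "'s set"
    and G :: "('s \<Rightarrow> real) \<Rightarrow> 's \<Rightarrow> real" and L :: real
  assumes markov: "markov_process_with_generator M X S G"
    and finite_S: "finite S"
    and L_nonneg: "0 \<le> L"
    and G_bound: "\<And>f B \<eta>. (\<forall>\<zeta>\<in>S. \<bar>f \<zeta>\<bar> \<le> B) \<Longrightarrow> \<eta> \<in> S \<Longrightarrow> \<bar>G f \<eta>\<bar> \<le> L * B"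
begin

sublocale prob_space M
  using markov by (simp add: markov_process_with_generator_def)

lemma X_measurable: "0 \<le> t \<Longrightarrow> X t \<in> M \<rightarrow>\<^sub>M count_space S"
  using markov by (simp add: markov_process_with_generator_def)

lemma X_in_S: "0 \<le> t \<Longrightarrow> \<omega> \<in> space M \<Longrightarrow> X t \<omega> \<in> S"
  using measurable_space[OF X_measurable] by simp

lemma f_X_measurable [measurable]: "0 \<le> t \<Longrightarrow> (\<lambda>\<omega>. f (X t \<omega>) :: real) \<in> borel_measurable M"
  by (rule measurable_compose[OF X_measurable]) auto

lemma finite_bound: "\<exists>B\<ge>0. \<forall>\<eta>\<in>S. \<bar>f \<eta> :: real\<bar> \<le> B"
  using finite_S by (intro exI[of _ "\<Sum>\<eta>\<in>S. \<bar>f \<eta>\<bar>"]) (auto intro: member_le_sum sum_nonneg)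

lemma f_X_integrable: "0 \<le> t \<Longrightarrow> integrable M (\<lambda>\<omega>. f (X t \<omega>) :: real)"
proof -
  assume t: "0 \<le> t"
  obtain B where B: "\<forall>\<eta>\<in>S. \<bar>f \<eta>\<bar> \<le> B" using finite_bound by blast
  show ?thesis
    by (rule integrable_const_bound[of _ B]) (use B X_in_S t in auto)
qed

lemma expectation_mono:
  assumes "0 \<le> t" "\<And>\<eta>. \<eta> \<in> S \<Longrightarrow> f \<eta> \<le> (h \<eta> :: real)"
  shows "expectation (\<lambda>\<omega>. f (X t \<omega>)) \<le> expectation (\<lambda>\<omega>. h (X t \<omega>))"
  using assms X_in_S by (intro integral_mono f_X_integrable) auto

lemma power_bound:
  assumes "\<forall>\<zeta>\<in>S. \<bar>f \<zeta>\<bar> \<le> B"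
  shows "\<forall>\<eta>\<in>S. \<bar>(G ^^ k) f \<eta>\<bar> \<le> L ^ k * B"
proof (induction k)
  case (Suc k)
  show ?case using G_bound[OF Suc] by (simp add: mult.assoc)
qed (use assms in simp)

lemma semigroup_summable:
  assumes "\<eta> \<in> S"
  shows "summable (\<lambda>k. (G ^^ k) f \<eta> / fact k * t ^ k)"
proof -
  obtain B where B: "B \<ge> 0" "\<forall>\<eta>\<in>S. \<bar>f \<eta>\<bar> \<le> B" using finite_bound by blast
  have "summable (\<lambda>k. B * (inverse (fact k) * (L * \<bar>t\<bar>) ^ k))"
    by (intro summable_mult summable_exp)
  then show ?thesis
  proof (rule summable_comparison_test')
    fix k :: nat assume "0 \<le> k"
    have "\<bar>(G ^^ k) f \<eta>\<bar> * \<bar>t\<bar>^k \<le> L ^ k * B * \<bar>t\<bar>^k"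
      using power_bound[OF B(2)] assms by (intro mult_right_mono) auto
    then show "norm ((G ^^ k) f \<eta> / fact k * t ^ k) \<le> B * (inverse (fact k) * (L * \<bar>t\<bar>) ^ k)"
      by (simp add: abs_mult power_abs divide_simps power_mult_distrib mult_ac)
  qed
qed

lemma semigroup_has_derivative:
  assumes "\<eta> \<in> S"
  shows "((\<lambda>t. generator_semigroup G t f \<eta>) has_real_derivative
            generator_semigroup G t (G f) \<eta>) (at t)"
proof -
  have eq: "generator_semigroup G t h \<eta> = (\<Sum>k. (G ^^ k) h \<eta> / fact k * t ^ k)" for h t
    by (simp add: generator_semigroup_def mult_ac)
  have d: "diffs (\<lambda>k. (G ^^ k) f \<eta> / fact k) = (\<lambda>k. (G ^^ k) (G f) \<eta> / fact k)"
  proof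
    fix k
    \<comment> \<open>Peeling off the innermost factor puts \<open>G\<close> on the observable, so
      moments of \<open>f\<close> differentiate into moments of \<open>G f\<close>.\<close>
    have "(G ^^ Suc k) f = (G ^^ k) (G f)" by (simp only: funpow_Suc_right o_apply)
    then show "diffs (\<lambda>k. (G ^^ k) f \<eta> / fact k) k = (G ^^ k) (G f) \<eta> / fact k"
      unfolding diffs_def by (simp add: divide_simps del: funpow.simps)
  qed
  show ?thesis
    unfolding eq
    using termdiffs_strong_converges_everywhere[OF semigroup_summable[OF assms, of f], of t]
    by (simp add: d)
qed

text \<open>The formula makes sense for every real time, unlike the expectation of
  \<open>f (X t)\<close>; two-sided derivatives are therefore available at time 0 as well.\<close>

definition "mean f t = (\<Sum>\<eta>\<in>S. measure M (X 0 -` {\<eta>} \<inter> space M) * generator_semigroup G t f \<eta>)"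

lemma mean_has_derivative: "(mean f has_real_derivative mean (G f) t) (at t)"
  unfolding mean_def [abs_def] by (intro DERIV_sum DERIV_cmult semigroup_has_derivative)

lemma expectation_X0: "expectation (\<lambda>\<omega>. f (X 0 \<omega>)) = (\<Sum>\<eta>\<in>S. measure M (X 0 -` {\<eta>} \<inter> space M) * f \<eta>)"
proof -
  have m: "X 0 -` {\<eta>} \<inter> space M \<in> sets M" if "\<eta> \<in> S" for \<eta>
    using measurable_sets[OF X_measurable[of 0], of "{\<eta>}"] that by simp
  have "expectation (\<lambda>\<omega>. f (X 0 \<omega>))
      = expectation (\<lambda>\<omega>. \<Sum>\<eta>\<in>S. f \<eta> * indicator (X 0 -` {\<eta>} \<inter> space M) \<omega>)"
  proof (rule Bochner_Integration.integral_cong[OF refl])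
    fix \<omega> assume w: "\<omega> \<in> space M"
    have "(\<Sum>\<eta>\<in>S. f \<eta> * indicator (X 0 -` {\<eta>} \<inter> space M) \<omega>)
        = (\<Sum>\<eta>\<in>S. if \<eta> = X 0 \<omega> then f (X 0 \<omega>) else 0)"
      using w by (intro sum.cong) (auto simp: indicator_def)
    then show "f (X 0 \<omega>) = (\<Sum>\<eta>\<in>S. f \<eta> * indicator (X 0 -` {\<eta>} \<inter> space M) \<omega>)"
      using X_in_S[OF _ w, of 0] finite_S by simp
  qed
  also have "\<dots> = (\<Sum>\<eta>\<in>S. f \<eta> * measure M (X 0 -` {\<eta>} \<inter> space M))"
    using m by (subst Bochner_Integration.integral_sum) (auto simp: less_top[symmetric])
  finally show ?thesis by (simp add: mult_ac)
qed

lemma filtration_subalgebra: "subalgebra M (natural_filtration M X 0)"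
proof -
  have m: "X u -` A \<inter> space M \<in> sets M" if "0 \<le> u" for u A
  proof -
    have "X u -` A \<inter> space M = X u -` (A \<inter> S) \<inter> space M" using X_in_S[OF that] by auto
    then show ?thesis using measurable_sets[OF X_measurable[OF that], of "A \<inter> S"] by simp
  qed
  show ?thesis
    unfolding subalgebra_def natural_filtration_def
  proof (intro conjI)
    let ?A = "{X u -` A \<inter> space M |u A. 0 \<le> u \<and> u \<le> 0}"
    have sub: "?A \<subseteq> Pow (space M)" by auto
    show "space (sigma (space M) ?A) = space M" by (rule space_measure_of[OF sub])
    have "?A \<subseteq> sets M" using m by auto
    then show "sets (sigma (space M) ?A) \<subseteq> sets M"
      unfolding sets_measure_of[OF sub] by (rule sets.sigma_sets_subset)
  qed
qed

text \<open>The Markov property is used at conditioning time 0, and taking expectations removes the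
  conditional expectation.\<close>

lemma expectation_eq_mean:
  assumes "0 \<le> t"
  shows "expectation (\<lambda>\<omega>. f (X t \<omega>)) = mean f t"
proof -
  interpret F: finite_measure_subalgebra M "natural_filtration M X 0"
    by unfold_locales (rule filtration_subalgebra)
  have ae: "AE \<omega> in M. real_cond_exp M (natural_filtration M X 0) (\<lambda>\<omega>. f (X t \<omega>)) \<omega>
          = generator_semigroup G t f (X 0 \<omega>)"
    using markov assms unfolding markov_process_with_generator_def
    by (metis add_0 order_refl)
  have "expectation (\<lambda>\<omega>. f (X t \<omega>))
      = expectation (real_cond_exp M (natural_filtration M X 0) (\<lambda>\<omega>. f (X t \<omega>)))"
    using F.real_cond_exp_int(2)[OF f_X_integrable[OF assms]] by simp
  also have "\<dots> = expectation (\<lambda>\<omega>. generator_semigroup G t f (X 0 \<omega>))"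
    using ae by (intro integral_cong_AE) auto
  also have "\<dots> = mean f t"
    by (simp add: expectation_X0 mean_def)
  finally show ?thesis .
qed

text \<open>The term \<open>C * G q\<close> allows errors that are small only after integration in time,
  because the bounded function \<open>q\<close> can increase by at most \<open>\<kappa>\<close>.\<close>

lemma approximate_eigenfunction:
  assumes l: "0 \<le> l" and C: "0 \<le> C" and t: "0 \<le> t"
    and G: "\<And>\<eta>. \<eta> \<in> S \<Longrightarrow> \<bar>G f \<eta> + l * f \<eta>\<bar> \<le> \<epsilon> + C * G q \<eta>"
    and q: "\<And>\<eta>. \<eta> \<in> S \<Longrightarrow> 0 \<le> q \<eta> \<and> q \<eta> \<le> \<kappa>"
  shows "\<bar>expectation (\<lambda>\<omega>. f (X t \<omega>)) - exp (- l * t) * expectation (\<lambda>\<omega>. f (X 0 \<omega>))\<bar> \<le> \<epsilon> * t + C * \<kappa>"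
proof -
  have der: "\<bar>mean (G f) s + l * mean f s\<bar> \<le> \<epsilon> + C * mean (G q) s" if "0 \<le> s" for s
  proof -
    have 1: "expectation (\<lambda>\<omega>. G f (X s \<omega>) + l * f (X s \<omega>)) = mean (G f) s + l * mean f s"
      using that f_X_integrable by (subst Bochner_Integration.integral_add) (auto simp: expectation_eq_mean)
    have 2: "expectation (\<lambda>\<omega>. \<epsilon> + C * G q (X s \<omega>)) = \<epsilon> + C * mean (G q) s"
      using that f_X_integrable by (subst Bochner_Integration.integral_add) (auto simp: expectation_eq_mean prob_space)
    have "expectation (\<lambda>\<omega>. G f (X s \<omega>) + l * f (X s \<omega>)) \<le> expectation (\<lambda>\<omega>. \<epsilon> + C * G q (X s \<omega>))"
      using G by (intro expectation_mono[where f = "\<lambda>\<eta>. G f \<eta> + l * f \<eta>" and h = "\<lambda>\<eta>. \<epsilon> + C * G q \<eta>"] that)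
        (simp add: abs_le_iff)
    moreover have "expectation (\<lambda>\<omega>. - (G f (X s \<omega>) + l * f (X s \<omega>))) \<le> expectation (\<lambda>\<omega>. \<epsilon> + C * G q (X s \<omega>))"
      using G by (intro expectation_mono[where f = "\<lambda>\<eta>. - (G f \<eta> + l * f \<eta>)" and h = "\<lambda>\<eta>. \<epsilon> + C * G q \<eta>"] that)
        (simp add: abs_le_iff)
    moreover have "expectation (\<lambda>\<omega>. - (G f (X s \<omega>) + l * f (X s \<omega>)))
        = - expectation (\<lambda>\<omega>. G f (X s \<omega>) + l * f (X s \<omega>))"
      by (rule Bochner_Integration.integral_minus)
    ultimately show ?thesis unfolding 1 2 by linarith
  qed
  have mono: "exp (l * t) * (C * mean q 0) + c * mean f 0
       \<le> exp (l * t) * (\<epsilon> * t + C * mean q t) + c * (exp (l * t) * mean f t)"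
    if c: "\<bar>c\<bar> = 1" for c
  proof -
    \<comment> \<open>Integrating factor with the weight of the error frozen at its largest value
      \<open>exp (l * t)\<close>: the bound on the drift is nonnegative because it dominates an
      absolute value, so \<open>?h\<close> is nondecreasing. The signs c = 1 and c = -1 give the two
      one-sided estimates.\<close>
    let ?h = "\<lambda>s. exp (l * t) * (\<epsilon> * s + C * mean q s) + c * (exp (l * s) * mean f s)"
    have "?h 0 \<le> ?h t"
    proof (rule DERIV_nonneg_imp_nondecreasing[OF t])
      fix s assume s: "0 \<le> s" "s \<le> t"
      let ?d = "exp (l * t) * (\<epsilon> + C * mean (G q) s) + c * (exp (l * s) * (mean (G f) s + l * mean f s))"
      have D: "(?h has_real_derivative ?d) (at s)"
        by (auto intro!: derivative_eq_intros mean_has_derivative simp: algebra_simps)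
      have "\<bar>c * (exp (l * s) * (mean (G f) s + l * mean f s))\<bar> = exp (l * s) * \<bar>mean (G f) s + l * mean f s\<bar>"
        using c by (simp add: abs_mult)
      also have "\<dots> \<le> exp (l * t) * (\<epsilon> + C * mean (G q) s)"
        using der[OF s(1)] s l by (intro mult_mono) (auto intro: mult_left_mono)
      finally have "0 \<le> ?d" by linarith
      with D show "\<exists>y. (?h has_real_derivative y) (at s) \<and> 0 \<le> y" by blast
    qed
    then show ?thesis by simp
  qed
  have q0: "0 \<le> mean q 0" and qt: "mean q t \<le> \<kappa>"
  proof -
    have "expectation (\<lambda>\<omega>. 0) \<le> expectation (\<lambda>\<omega>. q (X 0 \<omega>))"
      using q by (intro expectation_mono[where f = "\<lambda>_. 0"]) auto
    then show "0 \<le> mean q 0" by (simp add: expectation_eq_mean)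
    have "expectation (\<lambda>\<omega>. q (X t \<omega>)) \<le> expectation (\<lambda>\<omega>. \<kappa>)"
      using q t by (intro expectation_mono[where h = "\<lambda>_. \<kappa>"]) auto
    then show "mean q t \<le> \<kappa>" using t by (simp add: expectation_eq_mean prob_space)
  qed
  have e: "exp (l * t) * exp (- l * t) = 1" by (simp flip: exp_add)
  have "exp (l * t) * \<bar>mean f t - exp (- l * t) * mean f 0\<bar> = \<bar>exp (l * t) * mean f t - mean f 0\<bar>"
    using e by (simp add: abs_mult_pos' algebra_simps flip: abs_mult)
       (simp add: mult.assoc[symmetric] e)
  also have "\<dots> \<le> exp (l * t) * (\<epsilon> * t + C * mean q t) - exp (l * t) * (C * mean q 0)"
    using mono[of 1] mono[of "-1"] by (simp add: abs_le_iff)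
  also have "\<dots> \<le> exp (l * t) * (\<epsilon> * t + C * \<kappa>)"
  proof -
    have "\<epsilon> * t + C * mean q t - C * mean q 0 \<le> \<epsilon> * t + C * \<kappa>"
      using mult_left_mono[OF qt C] mult_nonneg_nonneg[OF C q0] by linarith
    then show ?thesis
      unfolding right_diff_distrib[symmetric] by (intro mult_left_mono) auto
  qed
  finally show ?thesis
    using t by (simp add: expectation_eq_mean)
qed

end

section \<open>Integration on the unit interval\<close>

abbreviation unit_measure :: "real measure" where "unit_measure \<equiv> lebesgue_on {0..1}"

lemma L2_inner_eq: "L2_inner f h = (\<integral>u. f u * h u \<partial>unit_measure)"
  unfolding L2_inner_def set_lebesgue_integral_def by (simp add: integral_restrict_space)

lemma set_integral_eq_lebesgue_on:
  "S \<in> sets lebesgue \<Longrightarrow> (LINT u:S|lebesgue. f u :: real) = (\<integral>u. f u \<partial>lebesgue_on S)"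
  unfolding set_lebesgue_integral_def by (simp add: integral_restrict_space)

lemma set_integrable_eq_lebesgue_on:
  "S \<in> sets lebesgue \<Longrightarrow> set_integrable lebesgue S (f :: real \<Rightarrow> real) \<longleftrightarrow> integrable (lebesgue_on S) f"
  unfolding set_integrable_def by (simp add: integrable_restrict_space)

lemma L1_01_eq: "L1_01 f \<longleftrightarrow> integrable unit_measure f"
  by (simp add: L1_01_def set_integrable_eq_lebesgue_on)

lemma L2_inner_commute: "L2_inner f h = L2_inner h f"
  by (simp add: L2_inner_def mult.commute)

text \<open>The eigenfunction series represents the flow at positive times only; statements
  integrated in time discard the null set containing time 0.\<close>

lemma AE_time_pos: "AE s in lebesgue_on {0..t::real}. 0 < s"
proof -
  have "AE s in lebesgue. s \<notin> {0::real}"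
    using negligible_sing[of "0::real"] by (intro AE_not_in) (simp add: negligible_iff_null_sets)
  then have "AE s in lebesgue_on {0..t}. s \<notin> {0}" by (subst AE_restrict_space_iff) auto
  then show ?thesis using AE_space by eventually_elim auto
qed

lemma continuous_borel_lebesgue_on:
  "continuous_on {a..b} (h :: real \<Rightarrow> real) \<Longrightarrow> h \<in> borel_measurable (lebesgue_on {a..b})"
  by (rule continuous_imp_measurable_on_sets_lebesgue) auto

lemma integrable_mult_bounded:
  fixes f h :: "real \<Rightarrow> real"
  assumes "integrable M f" "h \<in> borel_measurable M" "\<And>u. u \<in> space M \<Longrightarrow> \<bar>h u\<bar> \<le> B"
  shows "integrable M (\<lambda>u. f u * h u)"
    and "\<bar>\<integral>u. f u * h u \<partial>M\<bar> \<le> B * (\<integral>u. \<bar>f u\<bar> \<partial>M)"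
proof -
  show i: "integrable M (\<lambda>u. f u * h u)"
  proof (rule Bochner_Integration.integrable_bound)
    show "integrable M (\<lambda>u. B * f u)" using assms by simp
    show "(\<lambda>u. f u * h u) \<in> borel_measurable M" using assms by measurable
    show "AE u in M. norm (f u * h u) \<le> norm (B * f u)"
    proof (rule AE_I2)
      fix u assume "u \<in> space M"
      then have "\<bar>h u\<bar> \<le> \<bar>B\<bar>" using assms(3) by fastforce
      then have "\<bar>h u\<bar> * \<bar>f u\<bar> \<le> \<bar>B\<bar> * \<bar>f u\<bar>" by (intro mult_right_mono) auto
      then show "norm (f u * h u) \<le> norm (B * f u)" by (simp add: abs_mult mult_ac)
    qed
  qed
  have "\<bar>\<integral>u. f u * h u \<partial>M\<bar> \<le> (\<integral>u. \<bar>f u * h u\<bar> \<partial>M)"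
    by (rule integral_abs_bound)
  also have "\<dots> \<le> (\<integral>u. B * \<bar>f u\<bar> \<partial>M)"
  proof (rule integral_mono)
    fix u assume "u \<in> space M"
    then have "\<bar>h u\<bar> * \<bar>f u\<bar> \<le> B * \<bar>f u\<bar>" using assms(3) by (intro mult_right_mono) auto
    then show "\<bar>f u * h u\<bar> \<le> B * \<bar>f u\<bar>" by (simp add: abs_mult mult_ac)
  qed (use i assms in auto)
  finally show "\<bar>\<integral>u. f u * h u \<partial>M\<bar> \<le> B * (\<integral>u. \<bar>f u\<bar> \<partial>M)" by simp
qed

lemma integrable_mult_continuous:
  assumes "L1_01 f" "continuous_on {0..1} h"
  shows "integrable unit_measure (\<lambda>u. f u * h u)"
proof -
  have "bounded (h ` {0..1})"
    using assms(2) by (intro compact_imp_bounded compact_continuous_image) auto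
  then obtain B where "\<forall>u\<in>{0..1}. \<bar>h u\<bar> \<le> B" by (auto simp: bounded_iff)
  then show ?thesis
    using assms by (intro integrable_mult_bounded(1)[where B = B])
      (auto simp: L1_01_eq continuous_borel_lebesgue_on)
qed

lemma continuous_L1_01: "continuous_on {0..1} f \<Longrightarrow> L1_01 f"
  unfolding L1_01_def by (intro absolutely_integrable_continuous_real)

lemma L2_inner_bound:
  assumes "L1_01 f" "continuous_on {0..1} h" "\<And>u. u \<in> {0..1} \<Longrightarrow> \<bar>h u\<bar> \<le> B"
  shows "\<bar>L2_inner f h\<bar> \<le> B * (\<integral>u. \<bar>f u\<bar> \<partial>unit_measure)"
  unfolding L2_inner_eq
  using assms by (intro integrable_mult_bounded(2)) (auto simp: L1_01_eq continuous_borel_lebesgue_on)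

lemma L2_inner_diff_right:
  assumes "L1_01 f" "continuous_on {0..1} h" "continuous_on {0..1} k"
  shows "L2_inner f (\<lambda>u. h u - k u) = L2_inner f h - L2_inner f k"
  using assms by (simp add: L2_inner_eq right_diff_distrib Bochner_Integration.integral_diff integrable_mult_continuous)

lemma L2_inner_diff_left:
  assumes "L1_01 f" "L1_01 h" "continuous_on {0..1} k"
  shows "L2_inner (\<lambda>u. f u - h u) k = L2_inner f k - L2_inner h k"
  using assms by (simp add: L2_inner_eq left_diff_distrib Bochner_Integration.integral_diff integrable_mult_continuous)

lemma L2_inner_scale_right: "L2_inner f (\<lambda>u. a * h u) = a * L2_inner f h"
  by (simp add: L2_inner_eq mult.left_commute)

lemma L2_inner_sum_right:
  assumes "L1_01 f" "\<And>k. k < N \<Longrightarrow> continuous_on {0..1} (h k)"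
  shows "L2_inner f (\<lambda>u. \<Sum>k<N. a k * h k u) = (\<Sum>k<N. a k * L2_inner f (h k))"
proof -
  have i: "integrable unit_measure (\<lambda>u. f u * (a k * h k u))" if "k < N" for k
    using assms that by (intro integrable_mult_continuous continuous_intros) auto
  show ?thesis
    using i unfolding L2_inner_eq sum_distrib_left
    by (subst Bochner_Integration.integral_sum) (auto simp: mult.left_commute)
qed

lemma continuous_on_series:
  fixes h :: "nat \<Rightarrow> real \<Rightarrow> real"
  assumes "\<And>k. continuous_on S (h k)" "\<And>k u. u \<in> S \<Longrightarrow> \<bar>h k u\<bar> \<le> B"
    and "summable (\<lambda>k. \<bar>a k\<bar>)"
  shows "continuous_on S (\<lambda>u. \<Sum>k. a k * h k u)"
proof (rule uniform_limit_theorem[OF _ Weierstrass_m_test[where M = "\<lambda>k. B * \<bar>a k\<bar>"]])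
  show "\<forall>\<^sub>F n in sequentially. continuous_on S (\<lambda>u. \<Sum>k<n. a k * h k u)"
    using assms by (intro always_eventually allI continuous_intros)
  show "summable (\<lambda>k. B * \<bar>a k\<bar>)" using assms by (intro summable_mult)
  show "norm (a k * h k u) \<le> B * \<bar>a k\<bar>" if "u \<in> S" for k u
    using mult_right_mono[OF assms(2)[OF that], of "\<bar>a k\<bar>"] by (simp add: abs_mult mult_ac)
qed auto

text \<open>Absolute summability of \<open>a\<close> and the uniform bound on \<open>h\<close>
  dominate the series, so it may be integrated term by term against any function that is merely
  integrable.\<close>

lemma L2_inner_series:
  fixes h :: "nat \<Rightarrow> real \<Rightarrow> real"
  assumes f: "L1_01 f" and h: "\<And>k. continuous_on {0..1} (h k)" "\<And>k u. u \<in> {0..1} \<Longrightarrow> \<bar>h k u\<bar> \<le> B"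
    and a: "summable (\<lambda>k. \<bar>a k\<bar>)"
  shows "(\<lambda>k. a k * L2_inner f (h k)) sums L2_inner f (\<lambda>u. \<Sum>k. a k * h k u)"
proof -
  have B: "\<bar>a k * h k u\<bar> \<le> B * \<bar>a k\<bar>" if "u \<in> {0..1}" for k u
    using mult_right_mono[OF h(2)[OF that], of "\<bar>a k\<bar>"] by (simp add: abs_mult mult_ac)
  have sB: "summable (\<lambda>k. B * \<bar>a k\<bar>)" using a by (intro summable_mult)
  have i: "integrable unit_measure (\<lambda>u. f u * (a k * h k u))" for k
    using f h by (intro integrable_mult_continuous continuous_intros) auto
  have sm: "summable (\<lambda>k. a k * h k u)" if "u \<in> {0..1}" for u
    by (rule summable_comparison_test[OF _ sB]) (use B that in auto)
  have "(\<lambda>k. \<integral>u. f u * (a k * h k u) \<partial>unit_measure) sums (\<integral>u. (\<Sum>k. f u * (a k * h k u)) \<partial>unit_measure)"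
  proof (rule sums_integral[OF i])
    show "AE u in unit_measure. summable (\<lambda>k. norm (f u * (a k * h k u)))"
    proof (rule AE_I2)
      fix u :: real assume "u \<in> space unit_measure"
      then have u: "u \<in> {0..1}" by simp
      have "summable (\<lambda>k. \<bar>f u\<bar> * (B * \<bar>a k\<bar>))" using sB by (rule summable_mult)
      then show "summable (\<lambda>k. norm (f u * (a k * h k u)))"
        by (rule summable_comparison_test'[where N = 0])
          (use B[OF u] in \<open>auto simp: abs_mult intro!: mult_left_mono\<close>)
    qed
    have "summable (\<lambda>k. B * \<bar>a k\<bar> * (\<integral>u. \<bar>f u\<bar> \<partial>unit_measure))" using sB by (rule summable_mult2)
    then show "summable (\<lambda>k. \<integral>u. norm (f u * (a k * h k u)) \<partial>unit_measure)"
    proof (rule summable_comparison_test'[where N = 0])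
      fix k :: nat
      have "(\<integral>u. norm (f u * (a k * h k u)) \<partial>unit_measure) \<le> (\<integral>u. B * \<bar>a k\<bar> * \<bar>f u\<bar> \<partial>unit_measure)"
        using B[of _ k] f i[of k] unfolding L1_01_eq
        by (intro integral_mono integrable_norm[OF i]) (auto simp: abs_mult mult.commute intro!: mult_left_mono)
      then show "norm (\<integral>u. norm (f u * (a k * h k u)) \<partial>unit_measure) \<le> B * \<bar>a k\<bar> * (\<integral>u. \<bar>f u\<bar> \<partial>unit_measure)"
        by simp
    qed
  qed
  moreover have "(\<integral>u. (\<Sum>k. f u * (a k * h k u)) \<partial>unit_measure) = L2_inner f (\<lambda>u. \<Sum>k. a k * h k u)"
    unfolding L2_inner_eq using sm
    by (intro Bochner_Integration.integral_cong) (auto simp: suminf_mult)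
  moreover have "(\<integral>u. f u * (a k * h k u) \<partial>unit_measure) = a k * L2_inner f (h k)" for k
    by (simp add: L2_inner_eq mult.left_commute)
  ultimately show ?thesis by simp
qed

text \<open>Continuous approximations of the sign of \<open>d\<close>, cut off at the end points,
  turn the pairing into the integral of |d| in the limit. Test functions vanishing at 0 and 1 are
  chosen because they are continuous on the torus too.\<close>

lemma AE_zero_if_orthogonal_to_continuous:
  assumes d: "L1_01 d"
    and orth: "\<And>f. continuous_on {0..1} f \<Longrightarrow> f 0 = 0 \<Longrightarrow> f 1 = 0 \<Longrightarrow> L2_inner d f = 0"
  shows "AE u in unit_measure. d u = 0"
proof -
  let ?s = "\<lambda>u. if u \<in> {0..1} then sgn (d u) else 0"
  have dm: "d \<in> borel_measurable unit_measure" using d by (auto simp: L1_01_eq)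
  have "(\<lambda>u. sgn (d u)) \<in> borel_measurable unit_measure"
    using dm by (intro measurable_compose[OF dm]) auto
  then have "?s \<in> borel_measurable lebesgue"
    by (subst borel_measurable_if) auto
  then have "?s measurable_on UNIV"
    by (rule lebesgue_measurable_imp_measurable_on_real) auto
  then obtain N g where N: "negligible N" and g: "\<And>n. continuous_on UNIV (g n)"
    and lim: "\<And>x. x \<notin> N \<Longrightarrow> (\<lambda>n. g n x) \<longlonglongrightarrow> ?s x"
    unfolding measurable_on_def by auto
  \<comment> \<open>Clamping to [-1, 1] makes |d| a dominating function; the second factor is a
    trapezoid that vanishes at 0 and 1 and is eventually 1 at each interior point.\<close>
  define f where "f n u = max (-1) (min 1 (g n u)) * min 1 (min (real n * u) (real n * (1 - u)))" for n u
  have fc: "continuous_on {0..1} (f n)" for n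
    unfolding f_def by (intro continuous_intros continuous_on_max continuous_on_min continuous_on_subset[OF g]) auto
  have fb: "\<bar>f n u\<bar> \<le> 1" if "u \<in> {0..1}" for n u
  proof -
    have "\<bar>max (-1) (min 1 (g n u))\<bar> \<le> 1" by auto
    moreover have "\<bar>min 1 (min (real n * u) (real n * (1 - u)))\<bar> \<le> 1" using that by (auto simp: min_def)
    ultimately have "\<bar>max (-1) (min 1 (g n u))\<bar> * \<bar>min 1 (min (real n * u) (real n * (1 - u)))\<bar> \<le> 1 * 1"
      by (intro mult_mono) auto
    then show ?thesis by (simp add: f_def abs_mult)
  qed
  have z: "L2_inner d (f n) = 0" for n
    by (rule orth[OF fc]) (auto simp: f_def)
  have "AE u in lebesgue. u \<notin> N \<union> {0, 1}"
    using N negligible_Un[OF N, of "{0,1}"] by (intro AE_not_in) (simp add: negligible_iff_null_sets)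
  then have ae: "AE u in unit_measure. u \<notin> N \<union> {0, 1}"
    by (subst AE_restrict_space_iff) auto
  have "(\<lambda>n. \<integral>u. d u * f n u \<partial>unit_measure) \<longlonglongrightarrow> (\<integral>u. \<bar>d u\<bar> \<partial>unit_measure)"
  proof (rule integral_dominated_convergence[where w = "\<lambda>u. \<bar>d u\<bar>"])
    show "(\<lambda>u. \<bar>d u\<bar>) \<in> borel_measurable unit_measure" using dm by measurable
    show "(\<lambda>u. d u * f n u) \<in> borel_measurable unit_measure" for n
      using dm continuous_borel_lebesgue_on[OF fc[of n]] by measurable
    show "integrable unit_measure (\<lambda>u. \<bar>d u\<bar>)" using d by (simp add: L1_01_eq)
    show "AE u in unit_measure. norm (d u * f n u) \<le> \<bar>d u\<bar>" for n
      using fb mult_left_mono[of "\<bar>f n _\<bar>" 1 "\<bar>d _\<bar>"] by (intro AE_I2) (auto simp: abs_mult)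
    show "AE u in unit_measure. (\<lambda>n. d u * f n u) \<longlonglongrightarrow> \<bar>d u\<bar>"
      using ae AE_space
    proof eventually_elim
      case (elim u)
      then have u: "0 < u" "u < 1" "u \<notin> N" by auto
      have 1: "(\<lambda>n. max (-1) (min 1 (g n u))) \<longlonglongrightarrow> max (-1) (min 1 (sgn (d u)))"
        using lim[OF u(3)] u by (intro tendsto_intros) auto
      have 2: "\<forall>\<^sub>F n in sequentially. min 1 (min (real n * u) (real n * (1 - u))) = 1"
      proof -
        obtain m where m: "1 / u + 1 / (1 - u) \<le> real m" using real_arch_simple by blast
        have "min 1 (min (real n * u) (real n * (1 - u))) = 1" if "m \<le> n" for n
        proof -
          have "1 / u + 1 / (1 - u) \<le> real n" using m that by (meson of_nat_le_iff order_trans)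
          moreover have "0 < 1 / u" "0 < 1 / (1 - u)" using u by auto
          ultimately have "1 / u \<le> real n" "1 / (1 - u) \<le> real n" by linarith+
          then show ?thesis using u by (auto simp: min_def field_simps)
        qed
        then show ?thesis by (auto simp: eventually_sequentially)
      qed
      have "(\<lambda>n. f n u) \<longlonglongrightarrow> max (-1) (min 1 (sgn (d u))) * 1"
        unfolding f_def by (rule tendsto_mult[OF 1 tendsto_eventually[OF 2]])
      then have "(\<lambda>n. d u * f n u) \<longlonglongrightarrow> d u * (max (-1) (min 1 (sgn (d u))) * 1)"
        by (intro tendsto_intros)
      moreover have "d u * (max (-1) (min 1 (sgn (d u))) * 1) = \<bar>d u\<bar>"
        by (auto simp: sgn_if)
      ultimately show ?case by simp
    qed
  qed
  then have "(\<integral>u. \<bar>d u\<bar> \<partial>unit_measure) = 0"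
    using z by (simp add: L2_inner_eq LIMSEQ_const_iff)
  then show ?thesis
    using d by (subst (asm) integral_nonneg_eq_0_iff_AE) (auto simp: L1_01_eq)
qed

text \<open>No integrability of \<open>y\<close> is assumed. At times up to which \<open>y\<close> is not integrable the integral is 0
  by convention, so there \<open>y\<close> would be constant; hence \<open>y\<close> is bounded and integrable after all.\<close>

lemma integral_equation_exponential_decay:
  fixes y :: "real \<Rightarrow> real"
  assumes T: "0 \<le> T"
    and eq: "\<And>t. t \<in> {0..T} \<Longrightarrow> y t - c + l * (\<integral>s. y s \<partial>lebesgue_on {0..t}) = 0"
    and t: "t \<in> {0..T}"
  shows "y t = exp (- l * t) * c"
proof -
  \<comment> \<open>The times up to which \<open>y\<close> is integrable, hence up to which the
    equation may be differentiated.\<close>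
  define I where "I = {t \<in> {0..T}. integrable (lebesgue_on {0..t}) y}"
  have sol: "y s = exp (- l * s) * c" if r: "r \<in> I" and s: "s \<in> {0..r}" for r s
  proof -
    have rT: "0 \<le> r" "r \<le> T" and int: "integrable (lebesgue_on {0..r}) y" using r by (auto simp: I_def)
    have sint: "integrable (lebesgue_on {0..s}) y" if "s \<in> {0..r}" for s
      using int that by (simp add: set_integrable_eq_lebesgue_on[symmetric]) (auto intro: set_integrable_subset)
    have yeq: "y s = c - l * integral {0..s} y" if "s \<in> {0..r}" for s
      using eq[of s] that rT sint[OF that] by (simp add: lebesgue_integral_eq_integral)
    have "y integrable_on {0..r}"
      using int by (simp add: set_integrable_eq_lebesgue_on[symmetric] set_lebesgue_integral_eq_integral(1))
    then have "continuous_on {0..r} (\<lambda>s. c - l * integral {0..s} y)"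
      by (intro continuous_intros indefinite_integral_continuous_1)
    then have cont: "continuous_on {0..r} y"
      using yeq by (subst continuous_on_cong[OF refl, of _ _ "\<lambda>s. c - l * integral {0..s} y"]) auto
    have der: "((\<lambda>s. exp (l * s) * (c - l * integral {0..s} y)) has_real_derivative 0) (at s within {0..r})"
      if s: "s \<in> {0..r}" for s
    proof -
      have "((\<lambda>s. integral {0..s} y) has_real_derivative y s) (at s within {0..r})"
        using integral_has_real_derivative[OF cont s] .
      then have "((\<lambda>s. exp (l * s) * (c - l * integral {0..s} y)) has_real_derivative
          exp (l * s) * l * (c - l * integral {0..s} y) + exp (l * s) * (- l * y s)) (at s within {0..r})"
        by (auto intro!: derivative_eq_intros)
      then show ?thesis using yeq[OF s] by (simp add: algebra_simps)
    qed
    have "exp (l * s) * (c - l * integral {0..s} y) = exp (l * 0) * (c - l * integral {0..0} y)"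
      using has_field_derivative_zero_constant[OF _ der] s rT by (metis atLeastAtMost_iff convex_real_interval(5) order_refl)
    then have "exp (l * s) * y s = c" using yeq[OF s] by simp
    then have "exp (- l * s) * (exp (l * s) * y s) = exp (- l * s) * c" by simp
    then show ?thesis by (simp flip: exp_add mult.assoc)
  qed
  have I0: "0 \<in> I"
  proof -
    have "(\<lambda>x. indicator {0::real} x *\<^sub>R y x) = (\<lambda>x. y 0 * indicator {0} x)" by (auto simp: indicator_def)
    then show ?thesis using T unfolding I_def by (simp add: integrable_restrict_space)
  qed
  have bdd: "bdd_above I" by (auto simp: I_def intro: bdd_aboveI[of _ T])
  define \<tau> where "\<tau> = Sup I"
  have below: "y s = exp (- l * s) * c" if "0 \<le> s" "s < \<tau>" for s
  proof -
    have "\<exists>r\<in>I. s < r"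
      using that less_cSup_iff[OF _ bdd, of s] I0 unfolding \<tau>_def by blast
    then obtain r where "r \<in> I" "s < r" by blast
    then show ?thesis using sol that by auto
  qed
  have above: "y s = c" if "\<tau> < s" "s \<le> T" for s
  proof -
    have s0: "0 \<le> s" using cSup_upper[OF I0 bdd] that unfolding \<tau>_def by linarith
    have "s \<notin> I" using cSup_upper[OF _ bdd, of s] that unfolding \<tau>_def by auto
    then have "\<not> integrable (lebesgue_on {0..s}) y" using s0 that by (auto simp: I_def)
    then show ?thesis using eq[of s] s0 that by (simp add: not_integrable_integral_eq)
  qed
  \<comment> \<open>\<open>?z\<close> agrees with \<open>y\<close> on the whole of [0, T] and is
    bounded and Borel. The value at \<tau> is not determined by the two sides, so \<open>y\<close>
    itself is kept there.\<close>
  let ?z = "\<lambda>s. if s < \<tau> then exp (- l * s) * c else if s = \<tau> then y \<tau> else c"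
  have "integrable (lebesgue_on {0..T}) ?z"
  proof -
    have fm: "finite_measure (lebesgue_on {0..T})" by (rule finite_measure_lebesgue_on) auto
    have "?z \<in> borel_measurable borel" by measurable
    then have "?z \<in> borel_measurable lebesgue" by (intro measurable_completion) simp
    then have m: "?z \<in> borel_measurable (lebesgue_on {0..T})" by (rule measurable_restrict_space1)
    show ?thesis
    proof (rule finite_measure.integrable_const_bound[OF fm _ m])
      show "AE s in lebesgue_on {0..T}. norm (?z s) \<le> exp (\<bar>l\<bar> * T) * \<bar>c\<bar> + \<bar>y \<tau>\<bar> + \<bar>c\<bar>"
      proof (rule AE_I2)
        fix s assume "s \<in> space (lebesgue_on {0..T})"
        then have "- l * s \<le> \<bar>l\<bar> * T" by (simp add: abs_if) (smt (verit) mult_left_mono mult_nonneg_nonneg)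
        then have "exp (- l * s) * \<bar>c\<bar> \<le> exp (\<bar>l\<bar> * T) * \<bar>c\<bar>" by (intro mult_right_mono) auto
        moreover have "0 \<le> exp (\<bar>l\<bar> * T) * \<bar>c\<bar>" by simp
        ultimately show "norm (?z s) \<le> exp (\<bar>l\<bar> * T) * \<bar>c\<bar> + \<bar>y \<tau>\<bar> + \<bar>c\<bar>" by (auto simp: abs_mult)
      qed
    qed
  qed
  moreover have "integrable (lebesgue_on {0..T}) ?z \<longleftrightarrow> integrable (lebesgue_on {0..T}) y"
    using below above by (intro Bochner_Integration.integrable_cong refl) auto
  ultimately have "T \<in> I" using T by (simp add: I_def)
  then show ?thesis using sol t by blast
qed

section \<open>Eigenfunction expansions of the heat flow\<close>

text \<open>Uniform rather than L^2 approximation, because it is paired with functions that are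
  merely L^1, such as weak solutions at a fixed time.\<close>

definition approximable :: "(nat \<Rightarrow> real \<Rightarrow> real) \<Rightarrow> (real \<Rightarrow> real) \<Rightarrow> bool" where
  "approximable \<phi> f \<longleftrightarrow> (\<forall>\<epsilon>>0. \<exists>N a. \<forall>u\<in>{0..1}. \<bar>f u - (\<Sum>k<N. a k * \<phi> k u)\<bar> \<le> \<epsilon>)"

text \<open>Common ground of both boundary conditions. Density is required only for equal end
  values, the most that modes on the torus allow; \<open>ev_ge\<close> supplies every comparison
  with the series of 1/k^2.\<close>

locale heat_basis =
  fixes \<phi> :: "nat \<Rightarrow> real \<Rightarrow> real" and ev :: "nat \<Rightarrow> real"
  assumes phi_continuous: "continuous_on UNIV (\<phi> k)"
    and phi_bound: "\<bar>\<phi> k u\<bar> \<le> 2"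
    and orthonormal: "L2_inner (\<phi> j) (\<phi> k) = of_bool (j = k)"
    and ev_ge: "(real k)\<^sup>2 \<le> ev k"
    and dense: "continuous_on {0..1} f \<Longrightarrow> f 0 = f 1 \<Longrightarrow> approximable \<phi> f"
begin

lemma phi_cont: "continuous_on S (\<phi> k)"
  using phi_continuous continuous_on_subset by blast

lemma ev_nonneg: "0 \<le> ev k"
  using ev_ge[of k] zero_le_power2[of "real k"] by linarith

lemma phi_L1: "L1_01 (\<phi> k)"
  by (intro continuous_L1_01 phi_cont)

lemma approximable_orthogonal:
  assumes f: "L1_01 f" and coef: "\<And>k. L2_inner f (\<phi> k) = 0"
    and H: "approximable \<phi> H" "continuous_on {0..1} H"
  shows "L2_inner f H = 0"
proof -
  define A where "A = (\<integral>u. \<bar>f u\<bar> \<partial>unit_measure)"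
  have A: "0 \<le> A" unfolding A_def by simp
  have "\<bar>L2_inner f H\<bar> \<le> \<epsilon>" if e: "\<epsilon> > 0" for \<epsilon>
  proof -
    \<comment> \<open>Dividing by \<open>A + 1\<close> avoids the case of a vanishing L^1 norm and
      still gives a total error of at most \<epsilon>.\<close>
    obtain N a where Na: "\<And>u. u \<in> {0..1} \<Longrightarrow> \<bar>H u - (\<Sum>k<N. a k * \<phi> k u)\<bar> \<le> \<epsilon> / (A + 1)"
      using H(1) e A unfolding approximable_def by (metis add_nonneg_pos divide_pos_pos zero_less_one)
    have "L2_inner f (\<lambda>u. H u - (\<Sum>k<N. a k * \<phi> k u)) = L2_inner f H - L2_inner f (\<lambda>u. \<Sum>k<N. a k * \<phi> k u)"
      by (intro L2_inner_diff_right f H continuous_intros phi_cont)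
    also have "L2_inner f (\<lambda>u. \<Sum>k<N. a k * \<phi> k u) = (\<Sum>k<N. a k * L2_inner f (\<phi> k))"
      by (intro L2_inner_sum_right f phi_cont)
    finally have "L2_inner f H = L2_inner f (\<lambda>u. H u - (\<Sum>k<N. a k * \<phi> k u))" by (simp add: coef)
    also have "\<bar>\<dots>\<bar> \<le> \<epsilon> / (A + 1) * A"
      using Na unfolding A_def by (intro L2_inner_bound f H continuous_intros phi_cont)
    also have "\<dots> = \<epsilon> * (A / (A + 1))" by simp
    also have "\<dots> \<le> \<epsilon> * 1" using A e by (intro mult_left_mono) auto
    also have "\<dots> = \<epsilon>" by simp
    finally show ?thesis .
  qed
  then show ?thesis using field_le_epsilon[of "\<bar>L2_inner f H\<bar>" 0] by simp
qed

text \<open>Reduces uniqueness of weak solutions, and of weak derivatives, to an identity between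
  numbers for each mode.\<close>

lemma AE_eq_if_coefficients_eq:
  assumes "L1_01 f" "L1_01 h" "\<And>k. L2_inner f (\<phi> k) = L2_inner h (\<phi> k)"
  shows "AE u in unit_measure. f u = h u"
proof -
  have L: "L1_01 (\<lambda>u. f u - h u)"
    using assms(1,2) unfolding L1_01_eq by (rule Bochner_Integration.integrable_diff)
  have "AE u in unit_measure. f u - h u = 0"
  proof (rule AE_zero_if_orthogonal_to_continuous[OF L])
    fix g :: "real \<Rightarrow> real" assume g: "continuous_on {0..1} g" "g 0 = 0" "g 1 = 0"
    show "L2_inner (\<lambda>u. f u - h u) g = 0"
    proof (rule approximable_orthogonal[OF L])
      show "L2_inner (\<lambda>u. f u - h u) (\<phi> k) = 0" for k
        unfolding L2_inner_diff_left[OF assms(1,2) phi_cont] assms(3) by simp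
      show "approximable \<phi> g" using g by (intro dense) auto
    qed (rule g)
  qed
  then show ?thesis by simp
qed

lemma series_coefficient:
  assumes a: "summable (\<lambda>k. \<bar>a k\<bar>)"
  shows "L2_inner (\<lambda>u. \<Sum>k. a k * \<phi> k u) (\<phi> j) = a j"
proof -
  have "(\<lambda>k. a k * L2_inner (\<phi> j) (\<phi> k)) sums L2_inner (\<phi> j) (\<lambda>u. \<Sum>k. a k * \<phi> k u)"
    by (rule L2_inner_series[OF phi_L1 phi_cont phi_bound a])
  moreover have "(\<lambda>k. a k * L2_inner (\<phi> j) (\<phi> k)) = (\<lambda>k. if k = j then a k else 0)"
    by (auto simp: orthonormal)
  ultimately show ?thesis
    using sums_If_finite_set[of "{j}" a] by (simp add: L2_inner_commute sums_unique2)
qed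

text \<open>The difference \<open>D\<close> between \<open>H\<close> and its uniformly convergent
  series has no coefficients, so it is orthogonal to both \<open>H\<close> and the series, hence to
  itself, and vanishes almost everywhere. This is why \<open>f\<close> may be merely
  integrable.\<close>

lemma parseval:
  assumes f: "L1_01 f" and H: "continuous_on {0..1} H" "approximable \<phi> H"
    and h: "summable (\<lambda>k. \<bar>L2_inner H (\<phi> k)\<bar>)"
  shows "(\<lambda>k. L2_inner f (\<phi> k) * L2_inner H (\<phi> k)) sums L2_inner f H"
proof -
  let ?h = "\<lambda>k. L2_inner H (\<phi> k)" and ?S = "\<lambda>u. \<Sum>k. L2_inner H (\<phi> k) * \<phi> k u"
  define D where "D u = H u - ?S u" for u
  have Sc: "continuous_on {0..1} ?S" by (rule continuous_on_series[OF phi_cont phi_bound h])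
  have Dc: "continuous_on {0..1} D" unfolding D_def by (intro continuous_intros H Sc)
  have LD: "L1_01 D" by (rule continuous_L1_01[OF Dc])
  have D0: "L2_inner D (\<phi> k) = 0" for k
    unfolding D_def using H Sc
    by (subst L2_inner_diff_left) (auto intro: continuous_L1_01 phi_cont simp: series_coefficient[OF h])
  have "L2_inner D H = 0" by (rule approximable_orthogonal[OF LD D0 H(2,1)])
  moreover have "L2_inner D ?S = 0"
    using L2_inner_series[OF LD phi_cont phi_bound h] D0 by (simp add: sums_iff)
  moreover have "L2_inner D D = L2_inner D H - L2_inner D ?S"
    using L2_inner_diff_right[OF LD H(1) Sc] by (simp add: D_def[abs_def])
  ultimately have "(\<integral>u. D u * D u \<partial>unit_measure) = 0" by (simp add: L2_inner_eq)
  then have "AE u in unit_measure. D u * D u = 0"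
    using integrable_mult_continuous[OF LD Dc]
    by (subst (asm) integral_nonneg_eq_0_iff_AE) auto
  then have "AE u in unit_measure. f u * D u = 0" by eventually_elim simp
  then have "L2_inner f D = 0" unfolding L2_inner_eq by (rule integral_eq_zero_AE)
  moreover have "L2_inner f D = L2_inner f H - L2_inner f ?S"
    using L2_inner_diff_right[OF f H(1) Sc] by (simp add: D_def[abs_def])
  ultimately show ?thesis
    using L2_inner_series[where h = \<phi>, OF f phi_cont phi_bound h] by (simp add: mult.commute)
qed

lemma summable_inverse_squares: "summable (\<lambda>k. C / (real k)\<^sup>2)"
  using summable_mult[OF inverse_power_summable[of 2, where 'a = real], of C]
  by (simp add: divide_inverse)

text \<open>From exp x \<ge> x^2 / 2 at x = ev k * t the terms are at most 4 / (t k)^2. The factor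
  \<open>1 + ev k\<close> leaves room for differentiating the series in space.\<close>

lemma summable_exp_ev:
  assumes t: "0 < t"
  shows "summable (\<lambda>k. (1 + ev k) * exp (- ev k * t))"
proof (rule summable_comparison_test'[where N = 1, OF summable_inverse_squares[of "4 / t\<^sup>2"]])
  fix k :: nat assume k: "1 \<le> k"
  have x: "(real k)\<^sup>2 \<le> ev k" "1 \<le> (real k)\<^sup>2" using ev_ge[of k] k by auto
  then have x1: "1 \<le> ev k" by linarith
  have "(ev k * t)\<^sup>2 / 2 \<le> exp (ev k * t)"
  proof -
    have "0 \<le> ev k * t" using x1 t by simp
    then show ?thesis using exp_lower_Taylor_quadratic[of "ev k * t"] by linarith
  qed
  then have "exp (- (ev k * t)) * ((ev k * t)\<^sup>2 / 2) \<le> exp (- (ev k * t)) * exp (ev k * t)"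
    by (intro mult_left_mono) auto
  then have e: "exp (- (ev k * t)) * (ev k)\<^sup>2 * t\<^sup>2 \<le> 2" by (simp flip: exp_add add: power_mult_distrib)
  have "(1 + ev k) * exp (- ev k * t) * (real k)\<^sup>2 \<le> (2 * ev k) * exp (- ev k * t) * ev k"
    using x1 x by (intro mult_mono) auto
  also have "\<dots> = 2 * (exp (- (ev k * t)) * (ev k)\<^sup>2)" by (simp add: power2_eq_square)
  also have "\<dots> \<le> 4 / t\<^sup>2" using e t by (simp add: field_simps)
  finally have "(1 + ev k) * exp (- ev k * t) \<le> 4 / t\<^sup>2 / (real k)\<^sup>2"
    using k by (subst pos_le_divide_eq) auto
  then show "norm ((1 + ev k) * exp (- ev k * t)) \<le> 4 / t\<^sup>2 / (real k)\<^sup>2" using x1 by simp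
qed

lemma summable_weighted_exp:
  assumes t: "0 < t" and a: "\<And>k. \<bar>a k\<bar> \<le> A * (1 + ev k)"
  shows "summable (\<lambda>k. \<bar>a k * exp (- ev k * t)\<bar>)"
proof (rule summable_comparison_test'[where N = 0, OF summable_mult[OF summable_exp_ev[OF t], of A]])
  fix k
  show "norm \<bar>a k * exp (- ev k * t)\<bar> \<le> A * ((1 + ev k) * exp (- ev k * t))"
    using mult_right_mono[OF a, of "exp (- ev k * t)" k] by (simp add: abs_mult mult.assoc)
qed

lemma coefficient_of_integral_equation:
  assumes "0 \<le> T" "t \<in> {0..T}"
    and "\<And>t. t \<in> {0..T} \<Longrightarrow> L2_inner (\<rho> t) (\<phi> k) - L2_inner \<rho>0 (\<phi> k)
       - (LINT s:{0..t}|lebesgue. L2_inner (\<rho> s) (\<lambda>u. - ev k * \<phi> k u)) = 0"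
  shows "L2_inner (\<rho> t) (\<phi> k) = exp (- ev k * t) * L2_inner \<rho>0 (\<phi> k)"
proof (rule integral_equation_exponential_decay[OF assms(1) _ assms(2)])
  fix t assume t: "t \<in> {0..T}"
  have "(LINT s:{0..t}|lebesgue. L2_inner (\<rho> s) (\<lambda>u. - ev k * \<phi> k u))
      = - ev k * (\<integral>s. L2_inner (\<rho> s) (\<phi> k) \<partial>lebesgue_on {0..t})"
    by (subst set_integral_eq_lebesgue_on) (simp_all only: L2_inner_scale_right integral_mult_right_zero, simp)
  then show "L2_inner (\<rho> t) (\<phi> k) - L2_inner \<rho>0 (\<phi> k)
      + ev k * (\<integral>s. L2_inner (\<rho> s) (\<phi> k) \<partial>lebesgue_on {0..t}) = 0"
    using assms(3)[OF t] by simp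
qed

end

locale heat_flow = heat_basis +
  fixes \<gamma> :: "real \<Rightarrow> real"
  assumes gamma_borel [measurable]: "\<gamma> \<in> borel_measurable borel"
    and gamma_range: "\<gamma> u \<in> {0..1}"
begin

definition "c k = L2_inner \<gamma> (\<phi> k)"

text \<open>Bounded coefficients do not make the series converge at time 0, so the profile itself is
  put there, as the weak formulation at t = 0 demands.\<close>

definition "flow t u = (if t \<le> 0 then \<gamma> u else \<Sum>k. (c k * exp (- ev k * t)) * \<phi> k u)"

lemma gamma_integrable: "integrable unit_measure \<gamma>"
proof -
  have fm: "finite_measure unit_measure" by (rule finite_measure_lebesgue_on) auto
  have "\<gamma> \<in> borel_measurable lebesgue" by (intro measurable_completion) simp
  then have m: "\<gamma> \<in> borel_measurable unit_measure" by (rule measurable_restrict_space1)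
  show ?thesis
    using gamma_range by (intro finite_measure.integrable_const_bound[OF fm _ m, of 1] AE_I2) auto
qed

lemma gamma_L1: "L1_01 \<gamma>"
  by (simp add: L1_01_eq gamma_integrable)

lemma gamma_abs_integral: "(\<integral>u. \<bar>\<gamma> u\<bar> \<partial>unit_measure) \<le> 1"
proof -
  have fm: "finite_measure unit_measure" by (rule finite_measure_lebesgue_on) auto
  have "(\<integral>u. \<bar>\<gamma> u\<bar> \<partial>unit_measure) \<le> (\<integral>u. 1 \<partial>unit_measure)"
    using gamma_range gamma_integrable finite_measure.integrable_const[OF fm]
    by (intro integral_mono) auto
  then show ?thesis by (simp add: measure_restrict_space)
qed

lemma c_bound: "\<bar>c k\<bar> \<le> 2"
proof -
  have "\<bar>c k\<bar> \<le> 2 * (\<integral>u. \<bar>\<gamma> u\<bar> \<partial>unit_measure)"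
    unfolding c_def by (intro L2_inner_bound gamma_L1 phi_cont phi_bound)
  then show ?thesis using gamma_abs_integral by linarith
qed

lemma summable_flow:
  assumes t: "0 < t"
  shows "summable (\<lambda>k. \<bar>c k * exp (- ev k * t)\<bar>)"
  by (rule summable_weighted_exp[OF t, where A = 2]) (rule order_trans[OF c_bound], use ev_nonneg in simp)

lemma flow_continuous: "0 < t \<Longrightarrow> continuous_on S (flow t)"
  using continuous_on_series[OF phi_cont phi_bound summable_flow, of t S]
  by (simp add: flow_def[abs_def])

lemma flow_L1: "L1_01 (flow t)"
  using gamma_L1 continuous_L1_01[OF flow_continuous, of t]
  by (cases "t \<le> 0") (auto simp: flow_def[abs_def])

lemma flow_inner:
  assumes "0 < t" "L1_01 f"
  shows "(\<lambda>k. c k * exp (- ev k * t) * L2_inner f (\<phi> k)) sums L2_inner (flow t) f"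
  using L2_inner_series[OF assms(2) phi_cont phi_bound summable_flow[OF assms(1)]] assms(1)
  by (simp add: flow_def[abs_def] L2_inner_commute)

lemma flow_coefficient: "0 \<le> t \<Longrightarrow> L2_inner (flow t) (\<phi> k) = exp (- ev k * t) * c k"
  using series_coefficient[OF summable_flow, of t k]
  by (cases "t = 0") (auto simp: flow_def[abs_def] c_def)

lemma phi_borel [measurable]: "\<phi> k \<in> borel_measurable borel"
  by (rule borel_measurable_continuous_onI[OF phi_continuous])

lemma flow_borel: "(\<lambda>(t, u). flow t u) \<in> borel_measurable borel"
proof -
  have "(\<lambda>p. flow (fst p) (snd p)) \<in> borel_measurable (borel \<Otimes>\<^sub>M borel)"
    unfolding flow_def by measurable
  then show ?thesis by (simp add: borel_prod split_beta)
qed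

lemma flow_measurable:
  assumes "A \<in> sets borel"
  shows "set_borel_measurable lebesgue A (\<lambda>(t, u). flow t u)"
proof -
  have "(\<lambda>x. indicator A x *\<^sub>R (case x of (t, u) \<Rightarrow> flow t u)) \<in> borel_measurable borel"
    using assms flow_borel by measurable
  then show ?thesis
    unfolding set_borel_measurable_def by (intro measurable_completion) simp
qed

lemma exp_ev_integral:
  assumes "0 \<le> t"
  shows "integrable (lebesgue_on {0..t}) (\<lambda>s. exp (- ev k * s))"
    and "ev k * (\<integral>s. exp (- ev k * s) \<partial>lebesgue_on {0..t}) = 1 - exp (- ev k * t)"
proof -
  have "continuous_on {0..t} (\<lambda>s. exp (- ev k * s))" by (intro continuous_intros)
  then have s: "set_integrable lebesgue {0..t} (\<lambda>s. exp (- ev k * s))"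
    by (rule absolutely_integrable_continuous_real)
  then show i: "integrable (lebesgue_on {0..t}) (\<lambda>s. exp (- ev k * s))"
    by (simp add: set_integrable_eq_lebesgue_on)
  have "((\<lambda>s. ev k * exp (- ev k * s)) has_integral (- exp (- ev k * t) - - exp (- ev k * 0))) {0..t}"
    by (rule fundamental_theorem_of_calculus[OF assms])
       (auto intro!: derivative_eq_intros simp flip: has_real_derivative_iff_has_vector_derivative)
  then have "integral {0..t} (\<lambda>s. ev k * exp (- ev k * s)) = 1 - exp (- ev k * t)"
    by (simp add: integral_unique del: integral_mult_right)
  then show "ev k * (\<integral>s. exp (- ev k * s) \<partial>lebesgue_on {0..t}) = 1 - exp (- ev k * t)"
    using i by (simp add: lebesgue_integral_eq_integral)
qed

lemma exp_ev_integral_le: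
  assumes "0 \<le> t" "1 \<le> k"
  shows "(\<integral>s. exp (- ev k * s) \<partial>lebesgue_on {0..t}) \<le> 1 / (real k)\<^sup>2"
proof -
  have "1 \<le> (real k)\<^sup>2" using assms(2) by simp
  then have e: "0 < ev k" using ev_ge[of k] by linarith
  have "(\<integral>s. exp (- ev k * s) \<partial>lebesgue_on {0..t}) = (1 - exp (- ev k * t)) / ev k"
    using exp_ev_integral(2)[OF assms(1), of k] e by (simp add: field_simps)
  also have "\<dots> \<le> 1 / ev k" using e by (intro divide_right_mono) auto
  also have "\<dots> \<le> 1 / (real k)\<^sup>2"
    using ev_ge[of k] assms(2) e by (intro divide_left_mono mult_pos_pos) auto
  finally show ?thesis .
qed

text \<open>No uniform domination is available near time 0 for coefficients that are only bounded;
  integrating each mode in time gains a factor 1/k^2, which makes the sum of the integrals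
  converge.\<close>

lemma time_integral:
  assumes t: "0 \<le> t" and a: "\<And>k. \<bar>a k\<bar> \<le> A"
    and Y: "\<And>s. 0 < s \<Longrightarrow> (\<lambda>k. a k * exp (- ev k * s)) sums Y s"
  shows "integrable (lebesgue_on {0..t}) Y"
    and "(\<lambda>k. a k * (\<integral>s. exp (- ev k * s) \<partial>lebesgue_on {0..t})) sums (\<integral>s. Y s \<partial>lebesgue_on {0..t})"
proof -
  let ?M = "lebesgue_on {0..t}"
  have A: "0 \<le> A" using a[of 0] by linarith
  let ?f = "\<lambda>k s. a k * exp (- ev k * s)"
  have pos: "AE s in ?M. 0 < s" by (rule AE_time_pos)
  have i: "integrable ?M (?f k)" for k using exp_ev_integral(1)[OF t] by simp
  have s1: "AE s in ?M. summable (\<lambda>k. norm (?f k s))"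
    using pos
  proof eventually_elim
    case (elim s)
    have "\<bar>a k\<bar> \<le> A * (1 + ev k)" for k
      using a[of k] mult_nonneg_nonneg[OF A ev_nonneg[of k]] by (simp add: algebra_simps)
    then show ?case using summable_weighted_exp[OF elim, of a A] by (simp add: real_norm_def)
  qed
  have s2: "summable (\<lambda>k. \<integral>s. norm (?f k s) \<partial>?M)"
  proof (rule summable_comparison_test'[where N = 1, OF summable_inverse_squares[of A]])
    fix k :: nat assume k: "1 \<le> k"
    have "(\<integral>s. norm (?f k s) \<partial>?M) = \<bar>a k\<bar> * (\<integral>s. exp (- ev k * s) \<partial>?M)"
      by (simp add: abs_mult)
    also have "\<dots> \<le> A * (1 / (real k)\<^sup>2)"
      using a A exp_ev_integral_le[OF t k] by (intro mult_mono) auto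
    finally show "norm (\<integral>s. norm (?f k s) \<partial>?M) \<le> A / (real k)\<^sup>2" by simp
  qed
  have eq: "AE s in ?M. (\<Sum>k. ?f k s) = Y s"
    using pos by eventually_elim (use Y in \<open>auto simp: sums_iff\<close>)
  have i1: "integrable ?M (\<lambda>s. \<Sum>k. ?f k s)" by (rule integrable_suminf[OF i s1 s2])
  have "Y \<in> borel_measurable ?M"
  proof -
    \<comment> \<open>No series represents \<open>Y 0\<close>; patching the point 0 gives equality
      with \<open>Y\<close> at every point of the interval, as measurability by congruence
      requires.\<close>
    have g: "(\<lambda>s. if s = 0 then Y 0 else \<Sum>k. ?f k s) \<in> borel_measurable ?M"
      using borel_measurable_integrable[OF i1]
      by (intro measurable_restrict_space1 measurable_completion) simp
    have "Y \<in> borel_measurable ?M \<longleftrightarrow> (\<lambda>s. if s = 0 then Y 0 else \<Sum>k. ?f k s) \<in> borel_measurable ?M"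
      using Y by (intro measurable_cong) (auto simp: sums_iff)
    then show ?thesis using g by simp
  qed
  then show "integrable ?M Y"
    by (rule integrable_cong_AE_imp[OF i1 _ eq])
  have "(\<integral>s. (\<Sum>k. ?f k s) \<partial>?M) = (\<integral>s. Y s \<partial>?M)"
    using eq \<open>Y \<in> borel_measurable ?M\<close> i1 by (intro integral_cong_AE) auto
  moreover have "(\<lambda>k. integral\<^sup>L ?M (?f k)) sums (\<integral>s. (\<Sum>k. ?f k s) \<partial>?M)"
    by (rule sums_integral[OF i s1 s2])
  ultimately show "(\<lambda>k. a k * (\<integral>s. exp (- ev k * s) \<partial>?M)) sums (\<integral>s. Y s \<partial>?M)"
    by simp
qed

text \<open>\<open>Y\<close> stands for the entire time integrand: the pairing with the second
  derivative of \<open>H\<close>, plus the boundary terms in the Neumann case. Each mode satisfies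
  the identity by integrating its exponential. The bound \<open>e\<close>, obtained by integrating
  by parts twice, makes the coefficients of \<open>H\<close> decay like 1/k^2.\<close>

lemma flow_weak_form:
  assumes t: "0 \<le> t" and H: "continuous_on {0..1} H" "approximable \<phi> H"
    and e: "\<And>k. \<bar>ev k * L2_inner H (\<phi> k)\<bar> \<le> E"
    and Y: "\<And>s. 0 < s \<Longrightarrow> (\<lambda>k. c k * exp (- ev k * s) * (- ev k * L2_inner H (\<phi> k))) sums Y s"
  shows "L2_inner (flow t) H - L2_inner \<gamma> H - (\<integral>s. Y s \<partial>lebesgue_on {0..t}) = 0"
proof (cases "t = 0")
  case True
  have "AE s in lebesgue_on {0..0::real}. Y s = 0"
    using AE_time_pos[of 0] AE_space by eventually_elim auto
  then have "(\<integral>s. Y s \<partial>lebesgue_on {0..0}) = 0" by (rule integral_eq_zero_AE)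
  then show ?thesis using True by (simp add: flow_def[abs_def])
next
  case False
  then have t: "0 < t" using t by simp
  let ?h = "\<lambda>k. L2_inner H (\<phi> k)"
  have hs: "summable (\<lambda>k. \<bar>?h k\<bar>)"
  proof (rule summable_comparison_test'[where N = 1, OF summable_inverse_squares[of E]])
    fix k :: nat assume k: "1 \<le> k"
    have "\<bar>?h k\<bar> * (real k)\<^sup>2 \<le> \<bar>?h k\<bar> * ev k" by (intro mult_left_mono ev_ge) auto
    also have "\<dots> \<le> E" using e[of k] ev_nonneg[of k] by (simp add: abs_mult mult.commute)
    finally show "norm \<bar>?h k\<bar> \<le> E / (real k)\<^sup>2" using k by (subst pos_le_divide_eq) auto
  qed
  have P: "(\<lambda>k. c k * ?h k) sums L2_inner \<gamma> H"
    using parseval[OF gamma_L1 H hs] by (simp add: c_def)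
  have F: "(\<lambda>k. c k * exp (- ev k * t) * ?h k) sums L2_inner (flow t) H"
    by (rule flow_inner[OF t continuous_L1_01[OF H(1)]])
  have "(\<lambda>k. (c k * (- ev k * ?h k)) * (\<integral>s. exp (- ev k * s) \<partial>lebesgue_on {0..t})) sums (\<integral>s. Y s \<partial>lebesgue_on {0..t})"
  proof (rule time_integral(2))
    show "0 \<le> t" using t by simp
    show "\<bar>c k * (- ev k * ?h k)\<bar> \<le> 2 * E" for k
      using mult_mono[OF c_bound[of k] e[of k]] by (simp add: abs_mult)
    show "(\<lambda>k. c k * (- ev k * ?h k) * exp (- ev k * s)) sums Y s" if "0 < s" for s
      using Y[OF that] by (simp add: mult_ac)
  qed
  also have "(\<lambda>k. (c k * (- ev k * ?h k)) * (\<integral>s. exp (- ev k * s) \<partial>lebesgue_on {0..t}))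
      = (\<lambda>k. c k * exp (- ev k * t) * ?h k - c k * ?h k)"
  proof
    fix k
    have "(c k * (- ev k * ?h k)) * (\<integral>s. exp (- ev k * s) \<partial>lebesgue_on {0..t})
        = - (c k * ?h k) * (ev k * (\<integral>s. exp (- ev k * s) \<partial>lebesgue_on {0..t}))" by (simp add: mult_ac)
    also have "\<dots> = c k * exp (- ev k * t) * ?h k - c k * ?h k"
      unfolding exp_ev_integral(2)[OF less_imp_le[OF t]] by (simp add: algebra_simps)
    finally show "(c k * (- ev k * ?h k)) * (\<integral>s. exp (- ev k * s) \<partial>lebesgue_on {0..t})
      = c k * exp (- ev k * t) * ?h k - c k * ?h k" .
  qed
  finally have "(\<lambda>k. c k * exp (- ev k * t) * ?h k - c k * ?h k) sums (\<integral>s. Y s \<partial>lebesgue_on {0..t})" .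
  then show ?thesis
    using sums_unique2[OF _ sums_diff[OF F P]] by simp
qed

text \<open>Expand the nonnegative integral of the squared difference between \<gamma> and its
  partial sum. Square summability is what keeps the time integral of the squared H^1 norm finite for
  a discontinuous profile.\<close>

lemma bessel: "summable (\<lambda>k. (c k)\<^sup>2)"
proof (rule bounded_imp_summable)
  show "0 \<le> (c k)\<^sup>2" for k by simp
  fix n
  define S where "S u = (\<Sum>k<Suc n. c k * \<phi> k u)" for u
  have Sc: "continuous_on {0..1} S" unfolding S_def by (intro continuous_intros phi_cont)
  have LS: "L1_01 S" by (rule continuous_L1_01[OF Sc])
  have gS: "L2_inner \<gamma> S = (\<Sum>k<Suc n. (c k)\<^sup>2)"
    unfolding S_def by (subst L2_inner_sum_right) (auto simp: gamma_L1 phi_cont c_def power2_eq_square)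
  have Sk: "L2_inner S (\<phi> k) = c k" if "k < Suc n" for k
  proof -
    have "L2_inner (\<phi> k) S = (\<Sum>j<Suc n. c j * L2_inner (\<phi> k) (\<phi> j))"
      unfolding S_def by (intro L2_inner_sum_right phi_L1 phi_cont)
    also have "\<dots> = (\<Sum>j<Suc n. if j = k then c j else 0)"
      by (intro sum.cong) (auto simp: orthonormal)
    also have "\<dots> = c k" using that by simp
    finally show ?thesis by (simp add: L2_inner_commute)
  qed
  have SS: "L2_inner S S = (\<Sum>k<Suc n. (c k)\<^sup>2)"
  proof -
    have "L2_inner S S = (\<Sum>k<Suc n. c k * L2_inner S (\<phi> k))"
      using L2_inner_sum_right[where h = \<phi> and N = "Suc n" and a = c, OF LS phi_cont] by (simp only: S_def[abs_def, symmetric])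
    then show ?thesis using Sk by (simp add: power2_eq_square)
  qed
  have i1: "integrable unit_measure (\<lambda>u. \<gamma> u * S u)" by (rule integrable_mult_continuous[OF gamma_L1 Sc])
  have i2: "integrable unit_measure (\<lambda>u. S u * S u)" by (rule integrable_mult_continuous[OF LS Sc])
  have i3: "integrable unit_measure (\<lambda>u. \<gamma> u * \<gamma> u)"
    using gamma_range gamma_integrable borel_measurable_integrable[OF gamma_integrable]
    by (intro integrable_mult_bounded(1)[where B = 1]) auto
  have "0 \<le> (\<integral>u. (\<gamma> u - S u)\<^sup>2 \<partial>unit_measure)" by simp
  also have "\<dots> = (\<integral>u. (\<gamma> u * \<gamma> u - 2 * (\<gamma> u * S u)) + S u * S u \<partial>unit_measure)"
    by (intro Bochner_Integration.integral_cong) (auto simp: power2_eq_square algebra_simps)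
  also have "\<dots> = L2_inner \<gamma> \<gamma> - 2 * L2_inner \<gamma> S + L2_inner S S"
    using i1 i2 i3 by (simp add: L2_inner_eq)
  finally have "(\<Sum>k<Suc n. (c k)\<^sup>2) \<le> L2_inner \<gamma> \<gamma>" using gS SS by linarith
  then show "(\<Sum>k\<le>n. (c k)\<^sup>2) \<le> L2_inner \<gamma> \<gamma>" by (simp add: lessThan_Suc_atMost)
qed

end

section \<open>The periodic and the Neumann basis\<close>

definition span_of :: "(nat \<Rightarrow> real \<Rightarrow> real) \<Rightarrow> (real \<Rightarrow> real) \<Rightarrow> bool" where
  "span_of \<phi> p \<longleftrightarrow> (\<exists>N a. \<forall>u. p u = (\<Sum>k<N. a k * \<phi> k u))"

lemma span_ofI: "(\<And>u. p u = (\<Sum>k<N. a k * \<phi> k u)) \<Longrightarrow> span_of \<phi> p"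
  unfolding span_of_def by blast

lemma span_of_basis: "span_of \<phi> (\<phi> k)"
proof -
  have "\<phi> k u = (\<Sum>j<Suc k. of_bool (j = k) * \<phi> j u)" for u
    by (simp add: of_bool_def if_distrib[of "\<lambda>x. x * _"] cong: if_cong)
  then show ?thesis by (rule span_ofI)
qed

lemma span_of_scale:
  assumes "span_of \<phi> p" shows "span_of \<phi> (\<lambda>u. r * p u)"
proof -
  obtain N a where "\<And>u. p u = (\<Sum>k<N. a k * \<phi> k u)" using assms by (auto simp: span_of_def)
  then have "r * p u = (\<Sum>k<N. (r * a k) * \<phi> k u)" for u by (simp add: sum_distrib_left mult.assoc)
  then show ?thesis by (rule span_ofI)
qed

lemma span_of_add:
  assumes "span_of \<phi> p" "span_of \<phi> q" shows "span_of \<phi> (\<lambda>u. p u + q u)"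
proof -
  obtain N a where p: "\<And>u. p u = (\<Sum>k<N. a k * \<phi> k u)" using assms by (auto simp: span_of_def)
  obtain M b where q: "\<And>u. q u = (\<Sum>k<M. b k * \<phi> k u)" using assms by (auto simp: span_of_def)
  have ext: "(\<Sum>k<K. d k * \<phi> k u) = (\<Sum>k<max N M. (if k < K then d k else 0) * \<phi> k u)"
    if "K \<le> max N M" for K d u
    using that by (intro sum.mono_neutral_cong_left) auto
  have "p u + q u = (\<Sum>k<max N M. ((if k < N then a k else 0) + (if k < M then b k else 0)) * \<phi> k u)" for u
    unfolding p q by (subst (1 2) ext) (simp_all add: sum.distrib distrib_right)
  then show ?thesis by (rule span_ofI)
qed

lemma span_of_sum:
  fixes N :: nat
  assumes "\<And>k. k < N \<Longrightarrow> span_of \<phi> (q k)" shows "span_of \<phi> (\<lambda>u. \<Sum>k<N. q k u)"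
  using assms
proof (induction N)
  case 0
  have "span_of \<phi> (\<lambda>u. 0 * \<phi> 0 u)" by (rule span_of_scale[OF span_of_basis])
  then show ?case by simp
next
  case (Suc N)
  then show ?case using span_of_add[of \<phi> "\<lambda>u. \<Sum>k<N. q k u" "q N"] by simp
qed

lemma span_of_mult:
  assumes m: "\<And>j k. span_of \<phi> (\<lambda>u. \<phi> j u * \<phi> k u)" and "span_of \<phi> p" "span_of \<phi> q"
  shows "span_of \<phi> (\<lambda>u. p u * q u)"
proof -
  obtain N a where p: "\<And>u. p u = (\<Sum>k<N. a k * \<phi> k u)" using assms by (auto simp: span_of_def)
  obtain M b where q: "\<And>u. q u = (\<Sum>k<M. b k * \<phi> k u)" using assms by (auto simp: span_of_def)
  have "p u * q u = (\<Sum>j<N. \<Sum>k<M. (a j * b k) * (\<phi> j u * \<phi> k u))" for u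
    unfolding p q sum_product by (simp add: mult_ac)
  then show ?thesis
    by (simp only:) (intro span_of_sum span_of_scale m)
qed

text \<open>Carries the Stone-Weierstrass theorem over to the modes: \<open>e\<close> is the
  parametrisation of the unit circle in the periodic case and cos (pi u) in the Neumann
  case.\<close>

lemma span_of_real_polynomial:
  fixes e :: "real \<Rightarrow> 'a::real_normed_vector"
  assumes m: "\<And>j k. span_of \<phi> (\<lambda>u. \<phi> j u * \<phi> k u)" and one: "span_of \<phi> (\<lambda>u. 1)"
    and lin: "\<And>l :: 'a \<Rightarrow> real. bounded_linear l \<Longrightarrow> span_of \<phi> (\<lambda>u. l (e u))"
    and g: "real_polynomial_function g"
  shows "span_of \<phi> (\<lambda>u. g (e u))"
  using g
proof (induction rule: real_polynomial_function.induct)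
  case (const c)
  then show ?case using span_of_scale[OF one, of c] by simp
qed (auto intro: lin span_of_add span_of_mult[OF m])

lemma approximable_if_near_span:
  assumes "\<And>\<epsilon>. \<epsilon> > 0 \<Longrightarrow> \<exists>p. span_of \<phi> p \<and> (\<forall>u\<in>{0..1}. \<bar>f u - p u\<bar> \<le> \<epsilon>)"
  shows "approximable \<phi> f"
  unfolding approximable_def
proof (intro allI impI)
  fix \<epsilon> :: real assume "\<epsilon> > 0"
  then obtain p N a where "\<forall>u\<in>{0..1}. \<bar>f u - p u\<bar> \<le> \<epsilon>" "\<And>u. p u = (\<Sum>k<N. a k * \<phi> k u)"
    using assms unfolding span_of_def by metis
  then show "\<exists>N a. \<forall>u\<in>{0..1}. \<bar>f u - (\<Sum>k<N. a k * \<phi> k u)\<bar> \<le> \<epsilon>" by auto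
qed

section \<open>Cosine integrals and the two families of modes\<close>

lemma mult_cos_cos: "(m * cos x) * (m' * cos y) = m * m' / 2 * (cos (x - y) + cos (x + y :: real))"
proof -
  have "(m * cos x) * (m' * cos y) = m * m' * (cos x * cos y)" by (simp add: mult_ac)
  then show ?thesis by (simp add: cos_times_cos)
qed

lemma integrable_unit_cos: "integrable unit_measure (\<lambda>u. cos (w * u + p))"
  by (rule continuous_L1_01[unfolded L1_01_eq]) (intro continuous_intros)

lemma unit_integral_cos:
  "(\<integral>u. cos (w * u + p) \<partial>unit_measure) = (if w = 0 then cos p else (sin (w + p) - sin p) / w)"
proof (cases "w = 0")
  case True
  then show ?thesis by (simp add: measure_restrict_space)
next
  case False
  have "((\<lambda>u. cos (w * u + p)) has_integral (sin (w * 1 + p) / w - sin (w * 0 + p) / w)) {0..1}"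
    using False by (intro fundamental_theorem_of_calculus)
      (auto intro!: derivative_eq_intros simp flip: has_real_derivative_iff_has_vector_derivative)
  moreover note integrable_unit_cos[of w p]
  ultimately show ?thesis
    using False by (simp add: lebesgue_integral_eq_integral integral_unique diff_divide_distrib)
qed

lemma L2_inner_cos_cos:
  "L2_inner (\<lambda>u. m * cos (v * u + p)) (\<lambda>u. m' * cos (w * u + q))
     = m * m' / 2 * ((\<integral>u. cos ((v - w) * u + (p - q)) \<partial>unit_measure)
                   + (\<integral>u. cos ((v + w) * u + (p + q)) \<partial>unit_measure))"
proof -
  have "m * cos (v * u + p) * (m' * cos (w * u + q))
      = m * m' / 2 * (cos ((v - w) * u + (p - q)) + cos ((v + w) * u + (p + q)))" for u
    unfolding mult_cos_cos by (rule arg_cong2[where f = "\<lambda>x y. m * m' / 2 * (cos x + cos y)"]) (simp_all add: algebra_simps)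
  then show ?thesis
    unfolding L2_inner_eq by (simp only: integral_mult_right_zero Bochner_Integration.integral_add[OF integrable_unit_cos integrable_unit_cos])
qed

text \<open>Normalisation in L^2: the square of a nonconstant mode without this factor has mean
  1/2.\<close>

definition "mode_norm k = (if k = (0::nat) then 1 else sqrt 2)"

lemma mode_norm_bounds: "0 < mode_norm k" "mode_norm k \<le> 2" "mode_norm k \<noteq> 0"
  using real_le_lsqrt[of 2 2] by (auto simp: mode_norm_def)

lemma mode_norm_sq: "mode_norm k * mode_norm k = (if k = 0 then 1 else 2)"
  by (auto simp: mode_norm_def)

text \<open>The real Fourier basis written with cosines only: index 2 n is the cosine and index 2 n
  - 1 the sine of frequency 2 pi n, since cos (x - pi/2) = sin x. One formula m * cos (w * u + p)
  then serves all modes.\<close>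

definition "periodic_freq k = 2 * pi * real ((k + 1) div 2)"
definition "periodic_phase (k::nat) = (if even k then 0 else - pi / 2)"
definition "periodic_mode k u = mode_norm k * cos (periodic_freq k * u + periodic_phase k)"

definition "neumann_freq k = pi * real k"
text \<open>The phase \<open>+ 0\<close> keeps the shape to which the lemmas on general phases
  apply.\<close>

definition "neumann_mode k u = mode_norm k * cos (neumann_freq k * u + 0)"

lemma abs_mode_le: "\<bar>mode_norm k * cos x\<bar> \<le> 2"
proof -
  have "\<bar>mode_norm k * cos x\<bar> \<le> 2 * 1"
    unfolding abs_mult using mode_norm_bounds[of k] by (intro mult_mono) auto
  then show ?thesis by simp
qed

text \<open>Products of modes produce sums and differences of frequencies and phases, hence integers
  of either sign and arbitrary phases. The addition formula removes the phase, evenness of the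
  cosine the sign.\<close>

lemma span_periodic_cos: "span_of periodic_mode (\<lambda>u. cos (2 * pi * of_int m * u + d))"
proof -
  have pos: "span_of periodic_mode (\<lambda>u. cos (2 * pi * real n * u + d))" for n d
  proof (cases "n = 0")
    case True
    have "span_of periodic_mode (\<lambda>u. cos d * periodic_mode 0 u)"
      by (rule span_of_scale[OF span_of_basis])
    then show ?thesis using True by (simp add: periodic_mode_def periodic_freq_def periodic_phase_def mode_norm_def)
  next
    case False
    have c: "periodic_mode (2 * n) u = sqrt 2 * cos (2 * pi * real n * u)" for u
      using False by (simp add: periodic_mode_def periodic_freq_def periodic_phase_def mode_norm_def)
    have s: "periodic_mode (2 * n - 1) u = sqrt 2 * sin (2 * pi * real n * u)" for u
    proof -
      have "(2 * n - 1 + 1) div 2 = n" "odd (2 * n - 1)" "2 * n - 1 \<noteq> 0" using False by auto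
      then show ?thesis
        using cos_sin_eq[of "pi / 2 - 2 * pi * real n * u"] cos_minus[of "2 * pi * real n * u - pi / 2"]
        by (simp add: periodic_mode_def periodic_freq_def periodic_phase_def mode_norm_def)
    qed
    have "span_of periodic_mode (\<lambda>u. (cos d / sqrt 2) * periodic_mode (2 * n) u
        + (- sin d / sqrt 2) * periodic_mode (2 * n - 1) u)"
      by (intro span_of_add span_of_scale span_of_basis)
    then show ?thesis unfolding c s by (simp add: cos_add mult_ac)
  qed
  show ?thesis
  proof (cases "0 \<le> m")
    case True
    then show ?thesis using pos[of "nat m" d] by simp
  next
    case False
    have "cos (2 * pi * of_int m * u + d) = cos (2 * pi * real (nat (- m)) * u + (- d))" for u
      using False cos_minus[of "2 * pi * of_int m * u + d"] by simp
    then show ?thesis using pos[of "nat (- m)" "- d"] by simp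
  qed
qed

lemma span_periodic_mult: "span_of periodic_mode (\<lambda>u. periodic_mode j u * periodic_mode k u)"
proof -
  let ?j = "int ((j + 1) div 2)" and ?k = "int ((k + 1) div 2)"
  have "periodic_mode j u * periodic_mode k u = (mode_norm j * mode_norm k / 2) *
     (cos (2 * pi * of_int (?j - ?k) * u + (periodic_phase j - periodic_phase k))
      + cos (2 * pi * of_int (?j + ?k) * u + (periodic_phase j + periodic_phase k)))" for u
    unfolding periodic_mode_def periodic_freq_def mult_cos_cos
    by (rule arg_cong2[where f = "\<lambda>x y. mode_norm j * mode_norm k / 2 * (cos x + cos y)"])
       (simp_all add: algebra_simps del: of_nat_Suc)
  then show ?thesis
    by (simp only:) (intro span_of_scale span_of_add span_periodic_cos)
qed

text \<open>A function with equal end values factors through the unit circle, and polynomials in the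
  circle coordinates are trigonometric polynomials. Stone-Weierstrass is applied on the
  circle.\<close>

lemma periodic_approximable:
  assumes f: "continuous_on {0..1} f" "f 0 = f 1"
  shows "approximable periodic_mode f"
proof (rule approximable_if_near_span)
  fix \<epsilon> :: real assume \<epsilon>: "\<epsilon> > 0"
  define e where "e u = exp (2 * of_real pi * \<i> * complex_of_real u)" for u
  have e_eq: "e u = cis (2 * pi * u)" for u by (simp add: e_def cis_conv_exp mult_ac)
  define C where "C = e ` {0..1}"
  have econt: "continuous_on S e" for S unfolding e_def by (intro continuous_intros)
  have compC: "compact C" unfolding C_def by (intro compact_continuous_image econt) auto
  have inj: "f u = f v" if "u \<in> {0..1}" "v \<in> {0..1}" "e u = e v" for u v
  proof -
    have "cis (2 * pi * (u - v)) = 1"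
    proof -
      have "2 * pi * (u - v) = 2 * pi * u - 2 * pi * v" by (simp add: right_diff_distrib)
      then have "cis (2 * pi * (u - v)) = cis (2 * pi * u) / cis (2 * pi * v)" by (simp only: cis_divide)
      then show ?thesis using that(3) by (simp add: e_eq)
    qed
    then have "cos (2 * pi * (u - v)) = 1" by (metis cis.sel(1) one_complex.sel(1))
    then obtain n :: int where n: "2 * pi * (u - v) = of_int n * 2 * pi" by (auto simp: cos_one_2pi_int)
    then have "2 * pi * (u - v) = 2 * pi * of_int n" by (simp add: mult_ac)
    then have n: "u - v = of_int n" by (subst (asm) mult_left_cancel) auto
    have "- 1 \<le> u - v" "u - v \<le> 1" using that by auto
    then have "n = -1 \<or> n = 0 \<or> n = 1" unfolding n by linarith
    then have "(u = 0 \<and> v = 1) \<or> u = v \<or> (u = 1 \<and> v = 0)" using n that by auto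
    then show ?thesis using f(2) by auto
  qed
  define F where "F z = f (SOME u. u \<in> {0..1} \<and> e u = z)" for z
  have F: "F (e u) = f u" if "u \<in> {0..1}" for u
  proof -
    have "(SOME v. v \<in> {0..1} \<and> e v = e u) \<in> {0..1} \<and> e (SOME v. v \<in> {0..1} \<and> e v = e u) = e u"
      using that by (intro someI[where P = "\<lambda>v. v \<in> {0..1} \<and> e v = e u"]) auto
    then show ?thesis unfolding F_def using inj that by blast
  qed
  \<comment> \<open>The circle is a quotient of the compact interval: the preimage of a closed set
    under \<open>F\<close> is the image under \<open>e\<close> of a compact set.\<close>
  have "continuous_on C F"
  proof (subst continuous_on_closed_vimage[OF compact_imp_closed[OF compC]], intro allI impI)
    fix B :: "real set" assume B: "closed B"
    have "F -` B \<inter> C = e ` (f -` B \<inter> {0..1})" using F by (auto simp: C_def)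
    moreover have "closed (f -` B \<inter> {0..1})"
      using f(1) B by (subst (asm) continuous_on_closed_vimage) auto
    then have "compact (f -` B \<inter> {0..1})"
      by (subst compact_eq_bounded_closed) (blast intro: bounded_subset[OF bounded_closed_interval])
    ultimately show "closed (F -` B \<inter> C)"
      by (metis compact_continuous_image compact_imp_closed econt)
  qed
  then obtain g where g: "real_polynomial_function g" "\<And>z. z \<in> C \<Longrightarrow> \<bar>F z - g z\<bar> < \<epsilon>"
    using Stone_Weierstrass_real_polynomial_function[OF compC _ \<epsilon>] by blast
  have "span_of periodic_mode (\<lambda>u. g (e u))"
  proof (rule span_of_real_polynomial[OF span_periodic_mult _ _ g(1)])
    show "span_of periodic_mode (\<lambda>u. 1)" using span_periodic_cos[of 0 0] by simp
    fix l :: "complex \<Rightarrow> real" assume "bounded_linear l"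
    then have l: "linear l" by (rule bounded_linear.linear)
    have "l (e u) = l 1 * cos (2 * pi * of_int 1 * u + 0) + l \<i> * cos (2 * pi * of_int 1 * u + - pi / 2)" for u
    proof -
      have "e u = cos (2 * pi * u) *\<^sub>R 1 + sin (2 * pi * u) *\<^sub>R \<i>"
        unfolding e_eq by (simp add: complex_eq_iff)
      moreover have "cos (2 * pi * u - pi / 2) = sin (2 * pi * u)"
        using cos_sin_eq[of "pi / 2 - 2 * pi * u"] cos_minus[of "2 * pi * u - pi / 2"] by simp
      ultimately show ?thesis by (simp add: linear_add[OF l] linear_scale[OF l])
    qed
    then show "span_of periodic_mode (\<lambda>u. l (e u))"
      by (simp only:) (intro span_of_add span_of_scale span_periodic_cos)
  qed
  moreover have "\<forall>u\<in>{0..1}. \<bar>f u - g (e u)\<bar> \<le> \<epsilon>"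
  proof
    fix u :: real assume u: "u \<in> {0..1}"
    then show "\<bar>f u - g (e u)\<bar> \<le> \<epsilon>" using g(2)[of "e u"] F[OF u] by (simp add: C_def)
  qed
  ultimately show "\<exists>p. span_of periodic_mode p \<and> (\<forall>u\<in>{0..1}. \<bar>f u - p u\<bar> \<le> \<epsilon>)" by blast
qed

lemma sin_add_int_2pi: "sin (2 * pi * of_int m + p) = sin p"
  by (simp add: sin_add)

lemma periodic_basis: "heat_basis periodic_mode (\<lambda>k. (periodic_freq k)\<^sup>2)"
proof
  show "continuous_on UNIV (periodic_mode k)" for k
    unfolding periodic_mode_def by (intro continuous_intros)
  show "\<bar>periodic_mode k u\<bar> \<le> 2" for k u
    unfolding periodic_mode_def by (rule abs_mode_le)
  show "approximable periodic_mode f" if "continuous_on {0..1} f" "f 0 = f 1" for f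
    by (rule periodic_approximable[OF that])
  show "(real k)\<^sup>2 \<le> (periodic_freq k)\<^sup>2" for k
  proof -
    have "real k \<le> 2 * real ((k + 1) div 2)" by linarith
    also have "\<dots> \<le> pi * (2 * real ((k + 1) div 2))"
      using pi_ge_two mult_right_mono[of 1 pi "2 * real ((k + 1) div 2)"] by simp
    finally show ?thesis unfolding periodic_freq_def by (intro power_mono) auto
  qed
  show "L2_inner (periodic_mode j) (periodic_mode k) = of_bool (j = k)" for j k
  proof -
    let ?j = "int ((j + 1) div 2)" and ?k = "int ((k + 1) div 2)"
    let ?p = periodic_phase
    have v: "periodic_freq j - periodic_freq k = 2 * pi * of_int (?j - ?k)"
      "periodic_freq j + periodic_freq k = 2 * pi * of_int (?j + ?k)"
      by (simp_all add: periodic_freq_def algebra_simps del: of_nat_Suc)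
    have "L2_inner (periodic_mode j) (periodic_mode k) = mode_norm j * mode_norm k / 2 *
        ((if ?j - ?k = 0 then cos (?p j - ?p k) else 0) + (if ?j + ?k = 0 then cos (?p j + ?p k) else 0))"
      unfolding periodic_mode_def[abs_def] L2_inner_cos_cos v unit_integral_cos sin_add_int_2pi
      by simp
    also have "\<dots> = of_bool (j = k)"
    proof (cases "j = k")
      case True
      have "(k + 1) div 2 = 0 \<longleftrightarrow> k = 0" by linarith
      with True show ?thesis using mode_norm_sq[of k] by (auto simp: periodic_phase_def)
    next
      case False
      have 1: "\<not> (?j + ?k = 0)" using False by linarith
      \<comment> \<open>Distinct modes of equal frequency are a cosine and a sine; their phases
        differ by pi/2, so the surviving integral vanishes as well.\<close>
      have 2: "(even j \<and> odd k) \<or> (odd j \<and> even k)" if "?j - ?k = 0" using False that by presburger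
      show ?thesis
      proof (cases "?j - ?k = 0")
        case True
        then have "cos (?p j - ?p k) = 0" using 2 by (auto simp: periodic_phase_def)
        then show ?thesis using 1 False by auto
      qed (use 1 False in auto)
    qed
    finally show ?thesis .
  qed
qed

lemma span_neumann_cos: "span_of neumann_mode (\<lambda>u. cos (pi * real n * u))"
proof -
  have "span_of neumann_mode (\<lambda>u. (1 / mode_norm n) * neumann_mode n u)"
    by (rule span_of_scale[OF span_of_basis])
  then show ?thesis using mode_norm_bounds(3)[of n] by (simp add: neumann_mode_def neumann_freq_def)
qed

lemma span_neumann_mult: "span_of neumann_mode (\<lambda>u. neumann_mode j u * neumann_mode k u)"
proof -
  have sym: "cos (pi * (real j - real k) * u) = cos (pi * real (if k \<le> j then j - k else k - j) * u)" for u
    using cos_minus[of "pi * (real j - real k) * u"] by (auto simp: of_nat_diff algebra_simps)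
  have "neumann_mode j u * neumann_mode k u = (mode_norm j * mode_norm k / 2) *
     (cos (pi * real (if k \<le> j then j - k else k - j) * u) + cos (pi * real (j + k) * u))" for u
    unfolding neumann_mode_def neumann_freq_def sym[symmetric] mult_cos_cos
    by (rule arg_cong2[where f = "\<lambda>x y. mode_norm j * mode_norm k / 2 * (cos x + cos y)"])
       (simp_all add: algebra_simps)
  then show ?thesis
    by (simp only:) (intro span_of_scale span_of_add span_neumann_cos)
qed

text \<open>The substitution x = cos (pi u) reduces this to polynomial approximation on [-1, 1]. The
  two end values may differ, which is needed for test functions of the Neumann problem.\<close>

lemma neumann_approximable:
  assumes f: "continuous_on {0..1} f"
  shows "approximable neumann_mode f"
proof (rule approximable_if_near_span)
  fix \<epsilon> :: real assume \<epsilon>: "\<epsilon> > 0"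
  have "continuous_on {-1..1} (\<lambda>x. f (arccos x / pi))"
    using arccos_lbound arccos_ubound
    by (intro continuous_on_compose2[OF f] continuous_intros) (auto simp: divide_le_eq_1 intro!: divide_nonneg_pos)
  then obtain g where g: "real_polynomial_function g" "\<And>x. x \<in> {-1..1} \<Longrightarrow> \<bar>f (arccos x / pi) - g x\<bar> < \<epsilon>"
    using Stone_Weierstrass_real_polynomial_function[OF compact_Icc _ \<epsilon>] by blast
  have "span_of neumann_mode (\<lambda>u. g (cos (pi * u)))"
  proof (rule span_of_real_polynomial[OF span_neumann_mult _ _ g(1)])
    show "span_of neumann_mode (\<lambda>u. 1)" using span_neumann_cos[of 0] by simp
    fix l :: "real \<Rightarrow> real" assume "bounded_linear l"
    then have l: "linear l" by (rule bounded_linear.linear)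
    have "l (cos (pi * u)) = l 1 * cos (pi * real 1 * u)" for u
      using linear_scale[OF l, of "cos (pi * u)" 1] by simp
    then show "span_of neumann_mode (\<lambda>u. l (cos (pi * u)))"
      by (simp only:) (intro span_of_scale span_neumann_cos)
  qed
  moreover have "\<bar>f u - g (cos (pi * u))\<bar> \<le> \<epsilon>" if "u \<in> {0..1}" for u
    using g(2)[of "cos (pi * u)"] that by (simp add: arccos_cos)
  ultimately show "\<exists>p. span_of neumann_mode p \<and> (\<forall>u\<in>{0..1}. \<bar>f u - p u\<bar> \<le> \<epsilon>)" by blast
qed

lemma neumann_basis: "heat_basis neumann_mode (\<lambda>k. (neumann_freq k)\<^sup>2)"
proof
  show "continuous_on UNIV (neumann_mode k)" for k
    unfolding neumann_mode_def by (intro continuous_intros)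
  show "\<bar>neumann_mode k u\<bar> \<le> 2" for k u
    unfolding neumann_mode_def by (rule abs_mode_le)
  show "approximable neumann_mode f" if "continuous_on {0..1} f" "f 0 = f 1" for f
    by (rule neumann_approximable[OF that(1)])
  show "(real k)\<^sup>2 \<le> (neumann_freq k)\<^sup>2" for k
    unfolding neumann_freq_def using pi_ge_two mult_right_mono[of 1 pi "real k"]
    by (intro power_mono) auto
  show "L2_inner (neumann_mode j) (neumann_mode k) = of_bool (j = k)" for j k
  proof -
    have v: "neumann_freq j - neumann_freq k = pi * of_int (int j - int k)"
      "neumann_freq j + neumann_freq k = pi * of_int (int j + int k)"
      by (simp_all add: neumann_freq_def algebra_simps)
    have s: "sin (pi * of_int m + 0) = 0" for m :: int
      using sin_zero_iff_int2[of "pi * of_int m"] by (auto simp: mult.commute)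
    have "L2_inner (neumann_mode j) (neumann_mode k) = mode_norm j * mode_norm k / 2 *
        ((if int j - int k = 0 then 1 else 0) + (if int j + int k = 0 then 1 else 0))"
      unfolding neumann_mode_def[abs_def] L2_inner_cos_cos v unit_integral_cos
      using s[of "int j - int k"] s[of "int j + int k"] by simp
    also have "\<dots> = of_bool (j = k)"
      using mode_norm_sq[of k] by auto
    finally show ?thesis .
  qed
qed

section \<open>Test functions and weak derivatives\<close>

text \<open>The functions \<open>f u * exp (- c / ((u - a) (b - u)))\<close> on \<open>(a, b)\<close>, extended by 0, are smooth: this class of
  functions \<open>f\<close> is closed under the operation that differentiation of the product induces on \<open>f\<close>,
  and the exponential dominates the polynomial growth of \<open>f\<close> at the end points.\<close>

inductive coefficient_fun :: "real \<Rightarrow> real \<Rightarrow> (real \<Rightarrow> real) \<Rightarrow> bool" for a b where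
  const: "coefficient_fun a b (\<lambda>u. r)"
| ident: "coefficient_fun a b (\<lambda>u. u)"
| weight: "coefficient_fun a b (\<lambda>u. 1 / ((u - a) * (b - u)))"
| cos: "coefficient_fun a b (\<lambda>u. cos (w * u))"
| sin: "coefficient_fun a b (\<lambda>u. sin (w * u))"
| add: "coefficient_fun a b f \<Longrightarrow> coefficient_fun a b g \<Longrightarrow> coefficient_fun a b (\<lambda>u. f u + g u)"
| mult: "coefficient_fun a b f \<Longrightarrow> coefficient_fun a b g \<Longrightarrow> coefficient_fun a b (\<lambda>u. f u * g u)"

lemma coefficient_fun_deriv:
  assumes "coefficient_fun a b f"
  shows "\<exists>f'. coefficient_fun a b f' \<and> (\<forall>u\<in>{a<..<b}. (f has_real_derivative f' u) (at u))"
  using assms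
proof induction
  case (const r)
  show ?case by (intro exI[of _ "\<lambda>u. 0"] conjI coefficient_fun.const) auto
next
  case ident
  show ?case by (intro exI[of _ "\<lambda>u. 1"] conjI coefficient_fun.const) (auto intro!: derivative_eq_intros)
next
  case weight
  let ?w = "\<lambda>u. 1 / ((u - a) * (b - u))"
  have "coefficient_fun a b (\<lambda>u. (?w u * ?w u) * (2 * u + - (a + b)))"
    by (intro coefficient_fun.mult coefficient_fun.add coefficient_fun.weight coefficient_fun.const coefficient_fun.ident)
  moreover have "\<forall>u\<in>{a<..<b}. (?w has_real_derivative (?w u * ?w u) * (2 * u + - (a + b))) (at u)"
    by (auto intro!: derivative_eq_intros simp: divide_simps)
  ultimately show ?case by blast
next
  case (cos w)
  have "coefficient_fun a b (\<lambda>u. - w * sin (w * u))"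
    by (intro coefficient_fun.mult coefficient_fun.const coefficient_fun.sin)
  moreover have "\<forall>u\<in>{a<..<b}. ((\<lambda>u. cos (w * u)) has_real_derivative - w * sin (w * u)) (at u)"
    by (auto intro!: derivative_eq_intros)
  ultimately show ?case by blast
next
  case (sin w)
  have "coefficient_fun a b (\<lambda>u. w * cos (w * u))"
    by (intro coefficient_fun.mult coefficient_fun.const coefficient_fun.cos)
  moreover have "\<forall>u\<in>{a<..<b}. ((\<lambda>u. sin (w * u)) has_real_derivative w * cos (w * u)) (at u)"
    by (auto intro!: derivative_eq_intros)
  ultimately show ?case by blast
next
  case (add f g)
  then obtain f' g' where
    "coefficient_fun a b f'" "\<forall>u\<in>{a<..<b}. (f has_real_derivative f' u) (at u)"
    "coefficient_fun a b g'" "\<forall>u\<in>{a<..<b}. (g has_real_derivative g' u) (at u)" by blast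
  then show ?case
    by (intro exI[of _ "\<lambda>u. f' u + g' u"] conjI coefficient_fun.add ballI DERIV_add) auto
next
  case (mult f g)
  then obtain f' g' where
    "coefficient_fun a b f'" "\<forall>u\<in>{a<..<b}. (f has_real_derivative f' u) (at u)"
    "coefficient_fun a b g'" "\<forall>u\<in>{a<..<b}. (g has_real_derivative g' u) (at u)" by blast
  then show ?case
    using mult.hyps
    by (intro exI[of _ "\<lambda>u. f' u * g u + g' u * f u"] conjI coefficient_fun.add coefficient_fun.mult ballI DERIV_mult) auto
qed

lemma weight_ge_1:
  fixes a b u :: real
  assumes "b - a \<le> 1" "u \<in> {a<..<b}"
  shows "1 \<le> 1 / ((u - a) * (b - u))" "0 < (u - a) * (b - u)"
proof -
  show p: "0 < (u - a) * (b - u)" using assms by simp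
  have "(u - a) * (b - u) \<le> 1 * 1" using assms by (intro mult_mono) auto
  then show "1 \<le> 1 / ((u - a) * (b - u))" using p by (simp add: divide_simps)
qed

text \<open>On an interval of length at most 1 the weight is at least 1, so different exponents can
  be raised to a common one.\<close>

lemma coefficient_fun_growth:
  assumes "coefficient_fun a b f" and ab: "b - a \<le> 1"
  shows "\<exists>C N. \<forall>u\<in>{a<..<b}. \<bar>f u\<bar> \<le> C * (1 / ((u - a) * (b - u))) ^ N"
proof -
  let ?w = "\<lambda>u. 1 / ((u - a) * (b - u))"
  show ?thesis using assms(1)
  proof induction
    case (const r)
    show ?case by (rule exI[of _ "\<bar>r\<bar>"], rule exI[of _ 0]) auto
  next
    case ident
    show ?case by (rule exI[of _ "\<bar>a\<bar> + \<bar>b\<bar>"], rule exI[of _ 0]) auto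
  next
    case weight
    have "\<bar>?w u\<bar> \<le> 1 * ?w u ^ 1" if "u \<in> {a<..<b}" for u
      using weight_ge_1[OF ab that] by simp
    then show ?case by blast
  next
    case (cos w)
    show ?case by (rule exI[of _ 1], rule exI[of _ 0]) auto
  next
    case (sin w)
    show ?case by (rule exI[of _ 1], rule exI[of _ 0]) auto
  next
    case (add f g)
    then obtain C N D M where f: "\<And>u. u \<in> {a<..<b} \<Longrightarrow> \<bar>f u\<bar> \<le> C * ?w u ^ N"
      and g: "\<And>u. u \<in> {a<..<b} \<Longrightarrow> \<bar>g u\<bar> \<le> D * ?w u ^ M" by metis
    have "\<bar>f u + g u\<bar> \<le> (\<bar>C\<bar> + \<bar>D\<bar>) * ?w u ^ (N + M)" if u: "u \<in> {a<..<b}" for u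
    proof -
      have w: "1 \<le> ?w u" by (rule weight_ge_1[OF ab u])
      have w0: "0 \<le> ?w u ^ K" for K using w by (intro zero_le_power) linarith
      have "?w u ^ N \<le> ?w u ^ (N + M)" "?w u ^ M \<le> ?w u ^ (N + M)"
        using power_increasing[OF _ w, of N "N + M"] power_increasing[OF _ w, of M "N + M"] by auto
      then have "\<bar>C\<bar> * ?w u ^ N \<le> \<bar>C\<bar> * ?w u ^ (N + M)" "\<bar>D\<bar> * ?w u ^ M \<le> \<bar>D\<bar> * ?w u ^ (N + M)"
        by (intro mult_left_mono; simp)+
      moreover have "C * ?w u ^ N \<le> \<bar>C\<bar> * ?w u ^ N" "D * ?w u ^ M \<le> \<bar>D\<bar> * ?w u ^ M"
        by (intro mult_right_mono w0 abs_ge_self)+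
      ultimately show ?thesis using f[OF u] g[OF u] by (simp only: distrib_right) linarith
    qed
    then show ?case by blast
  next
    case (mult f g)
    then obtain C N D M where f: "\<And>u. u \<in> {a<..<b} \<Longrightarrow> \<bar>f u\<bar> \<le> C * ?w u ^ N"
      and g: "\<And>u. u \<in> {a<..<b} \<Longrightarrow> \<bar>g u\<bar> \<le> D * ?w u ^ M" by metis
    have "\<bar>f u * g u\<bar> \<le> (C * D) * ?w u ^ (N + M)" if u: "u \<in> {a<..<b}" for u
    proof -
      have "\<bar>f u\<bar> * \<bar>g u\<bar> \<le> (C * ?w u ^ N) * (D * ?w u ^ M)"
        using f[OF u] g[OF u] by (intro mult_mono) (auto intro: order_trans[OF abs_ge_zero])
      then show ?thesis by (simp only: abs_mult power_add mult_ac)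
    qed
    then show ?case by blast
  qed
qed

text \<open>The strength \<open>c\<close> is a parameter so that the cutoff can be removed: with a
  -> 0, b -> 1 and c -> 0 the function \<open>f\<close> is recovered inside the unit
  interval.\<close>

definition bump :: "real \<Rightarrow> real \<Rightarrow> real \<Rightarrow> (real \<Rightarrow> real) \<Rightarrow> real \<Rightarrow> real" where
  "bump a b c f u = (if u \<in> {a<..<b} then f u * exp (- c * (1 / ((u - a) * (b - u)))) else 0)"

text \<open>Differentiates a bump at the end points and outside its interval by one
  argument.\<close>

lemma has_real_derivative_zero_if_quadratic:
  fixes f :: "real \<Rightarrow> real"
  assumes "f x = 0" "\<And>u. \<bar>f u\<bar> \<le> K * (u - x)\<^sup>2"
  shows "(f has_real_derivative 0) (at x)"
  unfolding has_field_derivative_iff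
proof (rule Lim_null_comparison[where g = "\<lambda>u. K * \<bar>u - x\<bar>"])
  show "\<forall>\<^sub>F u in at x. norm ((f u - f x) / (u - x)) \<le> K * \<bar>u - x\<bar>"
    using assms by (intro eventually_at_filter[THEN iffD2] always_eventually)
      (auto simp: abs_divide divide_simps power2_eq_square abs_mult_self_eq mult.assoc)
  have "((\<lambda>u. K * \<bar>u - x\<bar>) \<longlongrightarrow> K * \<bar>x - x\<bar>) (at x)" by (intro tendsto_intros)
  then show "((\<lambda>u. K * \<bar>u - x\<bar>) \<longlongrightarrow> 0) (at x)" by simp
qed

lemma power_le_fact_exp: "0 \<le> x \<Longrightarrow> x ^ n \<le> fact n * exp (x::real)"
proof -
  assume x: "0 \<le> x"
  have "(\<Sum>k\<in>{n}. inverse (fact k) * x ^ k) \<le> (\<Sum>k. inverse (fact k) * x ^ k)"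
    using x by (intro sum_le_suminf summable_exp) auto
  then have "inverse (fact n) * x ^ n \<le> exp x" by (simp add: exp_def divide_inverse scaleR_conv_of_real mult.commute)
  then show ?thesis by (simp add: field_simps)
qed

lemma bump_bound:
  assumes f: "coefficient_fun a b f" and ab: "b - a \<le> 1" and c: "0 < c"
  shows "\<exists>K\<ge>0. \<forall>u\<in>{a<..<b}. \<bar>bump a b c f u\<bar> \<le> K * ((u - a) * (b - u))\<^sup>2"
proof -
  let ?w = "\<lambda>u. 1 / ((u - a) * (b - u))"
  obtain C N where CN: "\<And>u. u \<in> {a<..<b} \<Longrightarrow> \<bar>f u\<bar> \<le> C * ?w u ^ N"
    using coefficient_fun_growth[OF f ab] by blast
  \<comment> \<open>From x^j \<le> j! * exp x with j = N + 2 and x = c times the weight: N powers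
    absorb the growth of \<open>f\<close>, the other two leave the squared distance factor.\<close>
  let ?K = "\<bar>C\<bar> * fact (N + 2) / c ^ (N + 2)"
  have "\<bar>bump a b c f u\<bar> \<le> ?K * ((u - a) * (b - u))\<^sup>2" if u: "u \<in> {a<..<b}" for u
  proof -
    have w: "1 \<le> ?w u" and p: "0 < (u - a) * (b - u)" using weight_ge_1[OF ab u] by auto
    have e: "exp (c * ?w u) * exp (- c * ?w u) = 1" by (simp flip: exp_add)
    have "(c * ?w u) ^ (N + 2) \<le> fact (N + 2) * exp (c * ?w u)"
      using w c by (intro power_le_fact_exp mult_nonneg_nonneg) linarith+
    then have "(c * ?w u) ^ (N + 2) * exp (- c * ?w u) \<le> fact (N + 2) * exp (c * ?w u) * exp (- c * ?w u)"
      by (intro mult_right_mono) auto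
    then have "c ^ (N + 2) * ?w u ^ (N + 2) * exp (- c * ?w u) \<le> fact (N + 2)"
      using e by (simp only: mult.assoc power_mult_distrib mult_1_right)
    then have 1: "?w u ^ (N + 2) * exp (- c * ?w u) \<le> fact (N + 2) / c ^ (N + 2)"
      using c by (simp only: pos_le_divide_eq zero_less_power mult_ac)
    have "\<bar>bump a b c f u\<bar> = \<bar>f u\<bar> * exp (- c * ?w u)" using u by (simp add: bump_def abs_mult)
    also have "\<dots> \<le> (\<bar>C\<bar> * ?w u ^ N) * exp (- c * ?w u)"
    proof (intro mult_right_mono order_trans[OF CN[OF u]])
      show "0 \<le> ?w u ^ N" using w by (intro zero_le_power) linarith
    qed auto
    also have "\<dots> = \<bar>C\<bar> * (?w u ^ (N + 2) * exp (- c * ?w u)) * ((u - a) * (b - u))\<^sup>2"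
    proof -
      have "(1 / x)\<^sup>2 * x\<^sup>2 = 1" if "0 < x" for x :: real using that by (simp add: power_divide)
      from this[OF p] have "?w u ^ 2 * ((u - a) * (b - u))\<^sup>2 = 1" .
      then show ?thesis unfolding power_add by (simp only: mult_ac mult_1_right) simp
    qed
    also have "\<dots> \<le> \<bar>C\<bar> * (fact (N + 2) / c ^ (N + 2)) * ((u - a) * (b - u))\<^sup>2"
      by (intro mult_right_mono mult_left_mono 1) auto
    finally show ?thesis by simp
  qed
  moreover have "0 \<le> ?K" using c by simp
  ultimately show ?thesis by blast
qed

lemma bump_deriv:
  assumes f: "coefficient_fun a b f" and ab: "b - a \<le> 1" and c: "0 < c"
  shows "\<exists>f'. coefficient_fun a b f' \<and> (\<forall>u. (bump a b c f has_real_derivative bump a b c f' u) (at u))"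
proof -
  let ?w = "\<lambda>u. 1 / ((u - a) * (b - u))"
  obtain f' where f': "coefficient_fun a b f'" "\<And>u. u \<in> {a<..<b} \<Longrightarrow> (f has_real_derivative f' u) (at u)"
    using coefficient_fun_deriv[OF f] by blast
  obtain w' where w': "coefficient_fun a b w'" "\<And>u. u \<in> {a<..<b} \<Longrightarrow> (?w has_real_derivative w' u) (at u)"
    using coefficient_fun_deriv[OF coefficient_fun.weight[of a b]] by blast
  obtain K where K: "K \<ge> 0" "\<And>u. u \<in> {a<..<b} \<Longrightarrow> \<bar>bump a b c f u\<bar> \<le> K * ((u - a) * (b - u))\<^sup>2"
    using bump_bound[OF f ab c] by blast
  let ?h = "\<lambda>u. f' u + (- c) * (w' u * f u)"
  have "coefficient_fun a b ?h"
    by (intro coefficient_fun.add coefficient_fun.mult coefficient_fun.const f f' w')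
  moreover have "(bump a b c f has_real_derivative bump a b c ?h u) (at u)" for u
  proof (cases "u \<in> {a<..<b}")
    case True
    have "((\<lambda>u. f u * exp (- c * ?w u)) has_real_derivative bump a b c ?h u) (at u)"
    proof (rule DERIV_cong[OF DERIV_mult[OF f'(2)[OF True] DERIV_fun_exp[OF DERIV_cmult[OF w'(2)[OF True]]]]])
      have "f' u * E + E * (- c * w' u) * f u = (f' u + (- c) * (w' u * f u)) * E" for E
        by (simp add: algebra_simps)
      then show "f' u * exp (- c * ?w u) + exp (- c * ?w u) * (- c * w' u) * f u = bump a b c ?h u"
        using True by (simp add: bump_def)
    qed
    then show ?thesis
      by (rule has_field_derivative_transform_within_open[of _ _ _ "{a<..<b}"]) (use True in \<open>auto simp: bump_def\<close>)
  next
    case False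
    have q: "\<bar>bump a b c f v\<bar> \<le> K * (v - u)\<^sup>2" for v
    proof (cases "v \<in> {a<..<b}")
      case v: True
      \<comment> \<open>A point \<open>u\<close> outside the interval lies beyond one of its ends;
        the factor belonging to that end is at most |v - u| and the other factor at most 1.\<close>
      have "(v - a) * (b - v) \<le> \<bar>v - u\<bar>"
      proof (cases "u \<le> a")
        case True
        have "(v - a) * (b - v) \<le> (v - a) * 1" using v ab by (intro mult_left_mono) auto
        also have "\<dots> \<le> \<bar>v - u\<bar>" using True v by auto
        finally show ?thesis .
      next
        case ua: False
        have "(v - a) * (b - v) \<le> 1 * (b - v)" using v ab by (intro mult_right_mono) auto
        also have "\<dots> \<le> \<bar>v - u\<bar>" using False ua v by auto
        finally show ?thesis .
      qed
      moreover have "0 \<le> (v - a) * (b - v)" using v by simp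
      ultimately have "((v - a) * (b - v))\<^sup>2 \<le> (v - u)\<^sup>2" by (simp only: abs_le_square_iff[symmetric] abs_of_nonneg)
      then show ?thesis using K v mult_left_mono by (meson order_trans)
    qed (use K in \<open>auto simp: bump_def\<close>)
    have "(bump a b c f has_real_derivative 0) (at u)"
      by (rule has_real_derivative_zero_if_quadratic[OF _ q]) (use False in \<open>auto simp: bump_def\<close>)
    then show ?thesis using False by (auto simp: bump_def)
  qed
  ultimately show ?thesis by blast
qed

lemma bump_test_function:
  assumes f: "coefficient_fun a b f" and ab: "0 < a" "a < b" "b < 1" and c: "0 < c"
  shows "test_function (bump a b c f)"
proof -
  have ab1: "b - a \<le> 1" using ab by simp
  have "\<exists>h. coefficient_fun a b h \<and> (deriv ^^ k) (bump a b c f) = bump a b c h" for k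
  proof (induction k)
    case (Suc k)
    then obtain h where h: "coefficient_fun a b h" "(deriv ^^ k) (bump a b c f) = bump a b c h" by blast
    obtain h' where h': "coefficient_fun a b h'" "\<And>u. (bump a b c h has_real_derivative bump a b c h' u) (at u)"
      using bump_deriv[OF h(1) ab1 c] by blast
    have "deriv (bump a b c h) = bump a b c h'" using h'(2) by (auto intro: DERIV_imp_deriv)
    then show ?case using h h' by auto
  qed (use f in auto)
  then have "(deriv ^^ k) (bump a b c f) differentiable (at x)" for k x
    using bump_deriv[OF _ ab1 c] real_differentiable_def by metis
  moreover have "closure {x. bump a b c f x \<noteq> 0} \<subseteq> {a..b}"
    by (intro closure_minimal) (auto simp: bump_def split: if_splits)
  ultimately show ?thesis using ab unfolding test_function_def by fastforce
qed

section \<open>Weak derivatives, boundary values and Green's formula\<close>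

lemma AE_unit_open: "AE u in unit_measure. 0 < u \<and> u < 1"
proof -
  have "AE u in lebesgue. u \<notin> {0::real, 1}"
    using negligible_finite[of "{0::real, 1}"] by (intro AE_not_in) (simp add: negligible_iff_null_sets)
  then have "AE u in unit_measure. u \<notin> {0, 1}" by (subst AE_restrict_space_iff) auto
  then show ?thesis using AE_space by eventually_elim auto
qed

lemma L2_01_imp_L1_01:
  assumes "L2_01 v" shows "L1_01 v"
proof -
  have "v \<in> borel_measurable unit_measure"
    using assms unfolding L2_01_def set_borel_measurable_def by (subst borel_measurable_restrict_space_iff) auto
  moreover have "integrable unit_measure (\<lambda>u. 1 + (v u)\<^sup>2)"
    using assms finite_measure.integrable_const[OF finite_measure_lebesgue_on, of "{0..1::real}" "1::real"]
    by (simp add: L2_01_def set_integrable_eq_lebesgue_on)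
  moreover have "\<bar>x\<bar> \<le> 1 + x\<^sup>2" for x :: real
    using zero_le_power2[of "\<bar>x\<bar> - 1"] by (simp add: power2_diff)
  ultimately show ?thesis
    unfolding L1_01_eq by (elim Bochner_Integration.integrable_bound) auto
qed

lemma test_function_differentiable: "test_function G \<Longrightarrow> (G has_real_derivative deriv G x) (at x)"
  unfolding test_function_def using DERIV_deriv_iff_real_differentiable by (metis funpow_0)

lemma test_function_deriv_differentiable: "test_function G \<Longrightarrow> (deriv G has_real_derivative deriv (deriv G) x) (at x)"
  unfolding test_function_def using DERIV_deriv_iff_real_differentiable
  by (metis funpow_0 funpow_simps_right(2) o_apply)

lemma test_function_continuous: "test_function G \<Longrightarrow> continuous_on S G"
  by (meson DERIV_continuous_on has_field_derivative_at_within test_function_differentiable)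

lemma test_function_deriv_continuous: "test_function G \<Longrightarrow> continuous_on S (deriv G)"
  by (meson DERIV_continuous_on has_field_derivative_at_within test_function_deriv_differentiable)

lemma test_function_boundary:
  assumes "test_function G" shows "G 0 = 0" "G 1 = 0"
proof -
  have "{x. G x \<noteq> 0} \<subseteq> closure {x. G x \<noteq> 0}" by (rule closure_subset)
  also have "\<dots> \<subseteq> {0<..<1}" using assms by (simp add: test_function_def)
  finally show "G 0 = 0" "G 1 = 0" by auto
qed

lemma unit_FTC:
  assumes d: "\<And>u. u \<in> {0..1} \<Longrightarrow> (F has_real_derivative f u) (at u within {0..1})" and f: "continuous_on {0..1} f"
  shows "(\<integral>u. f u \<partial>unit_measure) = F 1 - F 0"
proof -
  have "(f has_integral (F 1 - F 0)) {0..1}"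
    using d by (intro fundamental_theorem_of_calculus) (auto simp flip: has_real_derivative_iff_has_vector_derivative)
  moreover have "integrable unit_measure f" using continuous_L1_01[OF f] by (simp add: L1_01_eq)
  ultimately show ?thesis by (simp add: lebesgue_integral_eq_integral integral_unique)
qed

text \<open>\<open>H1_norm\<close> rests on a derivative picked by choice, so it can be computed
  only after uniqueness. Cosines times bumps are test functions; removing the cutoff by dominated
  convergence shows that both derivatives have the same cosine coefficients.\<close>

lemma weak_deriv_unique:
  assumes v: "is_weak_deriv \<zeta> v" and w: "is_weak_deriv \<zeta> w"
  shows "AE u in unit_measure. v u = w u"
proof (rule heat_basis.AE_eq_if_coefficients_eq[OF neumann_basis])
  have Lv: "L1_01 v" and Lw: "L1_01 w"
    using v w L2_01_imp_L1_01 unfolding is_weak_deriv_def by auto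
  then show "L1_01 v" "L1_01 w" by auto
  have d: "integrable unit_measure (\<lambda>u. v u - w u)" using Lv Lw by (simp add: L1_01_eq)
  have test: "L2_inner (\<lambda>u. v u - w u) G = 0" if G: "test_function G" for G
    using v w G unfolding is_weak_deriv_def
    by (subst L2_inner_diff_left[OF Lv Lw test_function_continuous[OF G]]) (simp add: L2_inner_commute)
  fix k
  let ?f = "\<lambda>u. cos (neumann_freq k * u)"
  \<comment> \<open>The offset 3 guarantees a < b already for m = 0.\<close>
  define a b c where "a m = 1 / (real m + 3)" and "b m = 1 - 1 / (real m + 3)" and "c m = 1 / (real m + 1)" for m :: nat
  have ab: "0 < a m" "a m < b m" "b m < 1" "0 < c m" for m by (auto simp: a_def b_def c_def field_simps)
  let ?G = "\<lambda>m. bump (a m) (b m) (c m) ?f"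
  have G: "test_function (?G m)" for m
    by (rule bump_test_function[OF coefficient_fun.cos ab])
  have "(\<lambda>m. \<integral>u. (v u - w u) * ?G m u \<partial>unit_measure) \<longlonglongrightarrow> (\<integral>u. (v u - w u) * ?f u \<partial>unit_measure)"
  proof (rule integral_dominated_convergence[where w = "\<lambda>u. \<bar>v u - w u\<bar>"])
    have fm: "?f \<in> borel_measurable unit_measure" by (intro continuous_borel_lebesgue_on continuous_intros)
    show "(\<lambda>u. (v u - w u) * ?f u) \<in> borel_measurable unit_measure" using d fm by measurable
    show "(\<lambda>u. (v u - w u) * ?G m u) \<in> borel_measurable unit_measure" for m
      using borel_measurable_integrable[OF d] continuous_borel_lebesgue_on[OF test_function_continuous[OF G[of m]]]
      by (rule borel_measurable_times)
    show "integrable unit_measure (\<lambda>u. \<bar>v u - w u\<bar>)" using d by simp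
    show "AE u in unit_measure. norm ((v u - w u) * ?G m u) \<le> \<bar>v u - w u\<bar>" for m
    proof (rule AE_I2)
      fix u
      have "\<bar>?G m u\<bar> \<le> 1"
      proof (cases "u \<in> {a m<..<b m}")
        case True
        then have "0 \<le> c m * (1 / ((u - a m) * (b m - u)))" using ab(4)[of m] by (intro mult_nonneg_nonneg) auto
        then have "exp (- c m * (1 / ((u - a m) * (b m - u)))) \<le> 1" by simp
        then have "\<bar>?f u\<bar> * \<bar>exp (- c m * (1 / ((u - a m) * (b m - u))))\<bar> \<le> 1 * 1"
          by (intro mult_mono) auto
        then show ?thesis using True by (simp add: bump_def abs_mult)
      qed (auto simp: bump_def)
      then show "norm ((v u - w u) * ?G m u) \<le> \<bar>v u - w u\<bar>"
        using mult_left_mono[of "\<bar>?G m u\<bar>" 1 "\<bar>v u - w u\<bar>"] by (simp add: abs_mult)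
    qed
    show "AE u in unit_measure. (\<lambda>m. (v u - w u) * ?G m u) \<longlonglongrightarrow> (v u - w u) * ?f u"
      using AE_unit_open
    proof eventually_elim
      case (elim u)
      have lim: "(\<lambda>m. a m) \<longlonglongrightarrow> 0" "(\<lambda>m. b m) \<longlonglongrightarrow> 1" "(\<lambda>m. c m) \<longlonglongrightarrow> 0"
        unfolding a_def b_def c_def by real_asymp+
      have ev: "\<forall>\<^sub>F m in sequentially. ?f u * exp (- c m * (1 / ((u - a m) * (b m - u)))) = ?G m u"
      proof (rule eventually_mono)
        show "\<forall>\<^sub>F m in sequentially. a m < u \<and> u < b m"
          using elim by (intro eventually_conj order_tendstoD[OF lim(1)] order_tendstoD[OF lim(2)]) auto
      qed (simp add: bump_def)
      have "(\<lambda>m. ?f u * exp (- c m * (1 / ((u - a m) * (b m - u))))) \<longlonglongrightarrow> ?f u * exp (- 0 * (1 / ((u - 0) * (1 - u))))"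
        using elim by (intro tendsto_intros lim) auto
      then have "(\<lambda>m. ?G m u) \<longlonglongrightarrow> ?f u"
        using Lim_transform_eventually[OF _ ev] by simp
      then show ?case by (intro tendsto_intros)
    qed
  qed
  then have "(\<integral>u. (v u - w u) * ?f u \<partial>unit_measure) = 0"
    using test[OF G] by (simp add: L2_inner_eq LIMSEQ_const_iff)
  then have "L2_inner (\<lambda>u. v u - w u) ?f = 0" by (simp add: L2_inner_eq)
  then have "L2_inner (\<lambda>u. v u - w u) (\<lambda>u. mode_norm k * ?f u) = 0" by (simp only: L2_inner_scale_right)
  then have "L2_inner (\<lambda>u. v u - w u) (neumann_mode k) = 0"
    by (simp add: neumann_mode_def[abs_def])
  then show "L2_inner v (neumann_mode k) = L2_inner w (neumann_mode k)"
    using L2_inner_diff_left[OF Lv Lw heat_basis.phi_cont[OF neumann_basis]] by simp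
qed

lemma L2_inner_cong_AE:
  assumes "AE u in unit_measure. v u = w u" "L1_01 v" "L1_01 w"
  shows "L2_inner v v = L2_inner w w"
  unfolding L2_inner_eq
  using assms by (intro integral_cong_AE) (auto simp: L1_01_eq)

lemma H1_norm_sq:
  assumes "is_weak_deriv \<zeta> v"
  shows "(H1_norm \<zeta>)\<^sup>2 = L2_inner \<zeta> \<zeta> + L2_inner v v"
proof -
  have s: "is_weak_deriv \<zeta> (weak_deriv \<zeta>)" unfolding weak_deriv_def by (rule someI[of "is_weak_deriv \<zeta>", OF assms])
  have "L2_inner (weak_deriv \<zeta>) (weak_deriv \<zeta>) = L2_inner v v"
    using weak_deriv_unique[OF s assms] s assms L2_01_imp_L1_01 unfolding is_weak_deriv_def
    by (intro L2_inner_cong_AE) auto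
  moreover have "0 \<le> L2_inner f f" for f by (simp add: L2_inner_eq)
  ultimately show ?thesis by (simp add: H1_norm_def)
qed

text \<open>Boundary values are point evaluations of a chosen representative. The integral of the
  distance between two continuous representatives is 0, and continuity forces equality at every
  point, the ends included.\<close>

lemma continuous_version_eq:
  assumes z: "continuous_on {0..1} \<zeta>" and x: "x \<in> {0..1}"
  shows "continuous_version \<zeta> x = \<zeta> x"
proof -
  let ?P = "\<lambda>z. continuous_on {0..1} z \<and> (AE u in lebesgue. u \<in> {0..1} \<longrightarrow> z u = \<zeta> u)"
  define c where "c = continuous_version \<zeta>"
  have c: "?P c" unfolding c_def continuous_version_def by (rule someI[where P = ?P and x = \<zeta>]) (use z in auto)
  have dc: "continuous_on {0..1} (\<lambda>u. \<bar>c u - \<zeta> u\<bar>)" using c z by (intro continuous_intros) auto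
  have "AE u in unit_measure. \<bar>c u - \<zeta> u\<bar> = 0"
    using c by (subst AE_restrict_space_iff) auto
  then have "(\<integral>u. \<bar>c u - \<zeta> u\<bar> \<partial>unit_measure) = 0" by (rule integral_eq_zero_AE)
  moreover have "integrable unit_measure (\<lambda>u. \<bar>c u - \<zeta> u\<bar>)" using continuous_L1_01[OF dc] by (simp add: L1_01_eq)
  ultimately have "integral {0..1} (\<lambda>u. \<bar>c u - \<zeta> u\<bar>) = 0"
    by (simp add: lebesgue_integral_eq_integral)
  then have "\<bar>c x - \<zeta> x\<bar> = 0"
    using integral_eq_0_iff[OF dc] x by simp
  then show ?thesis by (simp add: c_def)
qed

lemma C2_on_continuous:
  assumes "C2_on S H H' H''"
  shows "continuous_on S H" "continuous_on S H'" "continuous_on S H''"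
  using assms unfolding C2_on_def by (auto intro: DERIV_continuous_on)

text \<open>Green's formula with antiderivative H' \<phi> - H \<phi>'. All boundary terms cancel for
  periodic functions; for Neumann modes only those with H' survive.\<close>

lemma cos_by_parts:
  assumes H: "C2_on {0..1} H H' H''" and phi: "\<phi> = (\<lambda>u. m * cos (w * u + p))"
  shows "L2_inner H'' \<phi> + w\<^sup>2 * L2_inner H \<phi>
       = H' 1 * \<phi> 1 - H' 0 * \<phi> 0 + m * w * (H 1 * sin (w + p) - H 0 * sin p)"
proof -
  have pc: "continuous_on {0..1} \<phi>" unfolding phi by (intro continuous_intros)
  note Hc = C2_on_continuous[OF H]
  let ?F = "\<lambda>u. H' u * \<phi> u + m * w * (H u * sin (w * u + p))"
  have "(\<integral>u. H'' u * \<phi> u + w\<^sup>2 * (H u * \<phi> u) \<partial>unit_measure) = ?F 1 - ?F 0"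
  proof (rule unit_FTC)
    fix u :: real assume u: "u \<in> {0..1}"
    then have 1: "(H has_real_derivative H' u) (at u within {0..1})" "(H' has_real_derivative H'' u) (at u within {0..1})"
      using H by (auto simp: C2_on_def)
    show "(?F has_real_derivative H'' u * \<phi> u + w\<^sup>2 * (H u * \<phi> u)) (at u within {0..1})"
      unfolding phi by (auto intro!: derivative_eq_intros 1 simp: algebra_simps power2_eq_square)
  qed (intro continuous_intros Hc pc)
  moreover have "(\<integral>u. H'' u * \<phi> u + w\<^sup>2 * (H u * \<phi> u) \<partial>unit_measure) = L2_inner H'' \<phi> + w\<^sup>2 * L2_inner H \<phi>"
    unfolding L2_inner_eq
    using integrable_mult_continuous[OF continuous_L1_01[OF Hc(3)] pc] integrable_mult_continuous[OF continuous_L1_01[OF Hc(1)] pc]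
    by simp
  ultimately show ?thesis by (simp add: algebra_simps)
qed

lemma C2_on_cos: "C2_on S (\<lambda>u. m * cos (w * u + p)) (\<lambda>u. - m * w * sin (w * u + p)) (\<lambda>u. - w\<^sup>2 * (m * cos (w * u + p)))"
  unfolding C2_on_def
  by (auto intro!: derivative_eq_intros continuous_intros simp: power2_eq_square)

section \<open>Existence and uniqueness of weak solutions\<close>

definition neumann_sine :: "nat \<Rightarrow> real \<Rightarrow> real" where
  "neumann_sine k u = mode_norm k * cos (neumann_freq k * u + (- pi / 2))"

lemma neumann_sine_eq: "neumann_sine k u = mode_norm k * sin (neumann_freq k * u)"
  using cos_sin_eq[of "pi / 2 - neumann_freq k * u"] cos_minus[of "neumann_freq k * u - pi / 2"]
  by (simp add: neumann_sine_def)

lemma neumann_sine_orthonormal: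
  "L2_inner (neumann_sine j) (neumann_sine k) = (if j = k \<and> k \<noteq> 0 then 1 else 0)"
proof -
  have v: "neumann_freq j - neumann_freq k = pi * of_int (int j - int k)"
    "neumann_freq j + neumann_freq k = pi * of_int (int j + int k)"
    by (simp_all add: neumann_freq_def algebra_simps)
  have s: "sin (pi * of_int m) = 0" for m :: int
    using sin_zero_iff_int2[of "pi * of_int m"] by (auto simp: mult.commute)
  have "- pi / 2 - - pi / 2 = 0" "- pi / 2 + - pi / 2 = - pi" by simp_all
  then have "L2_inner (neumann_sine j) (neumann_sine k) = mode_norm j * mode_norm k / 2 *
      ((if int j - int k = 0 then 1 else 0) + (if int j + int k = 0 then - 1 else 0))"
    unfolding neumann_sine_def[abs_def] L2_inner_cos_cos v unit_integral_cos
    using s[of "int j - int k"] s[of "int j + int k"] by (simp add: sin_diff)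
  also have "\<dots> = (if j = k \<and> k \<noteq> 0 then 1 else 0)"
    using mode_norm_sq[of k] by auto
  finally show ?thesis .
qed

lemma L2_inner_neumann_modes_deriv:
  assumes G: "test_function G"
  shows "L2_inner (deriv G) (neumann_mode k) = neumann_freq k * L2_inner G (neumann_sine k)"
proof -
  let ?w = "neumann_freq k"
  have c1: "continuous_on {0..1} (neumann_mode k)" unfolding neumann_mode_def by (intro continuous_intros)
  have c2: "continuous_on {0..1} (neumann_sine k)" unfolding neumann_sine_def by (intro continuous_intros)
  have "(\<integral>u. deriv G u * neumann_mode k u - ?w * (G u * neumann_sine k u) \<partial>unit_measure)
      = G 1 * neumann_mode k 1 - G 0 * neumann_mode k 0"
  proof (rule unit_FTC)
    fix u :: real
    have "((\<lambda>u. G u * neumann_mode k u) has_real_derivative deriv G u * neumann_mode k u - ?w * (G u * neumann_sine k u)) (at u)"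
      unfolding neumann_mode_def neumann_sine_eq
      by (auto intro!: derivative_eq_intros test_function_differentiable[OF G] simp: algebra_simps)
    then show "((\<lambda>u. G u * neumann_mode k u) has_real_derivative deriv G u * neumann_mode k u - ?w * (G u * neumann_sine k u)) (at u within {0..1})"
      by (rule has_field_derivative_at_within)
  qed (intro continuous_intros c1 c2 test_function_continuous[OF G] test_function_deriv_continuous[OF G])
  moreover have "(\<integral>u. deriv G u * neumann_mode k u - ?w * (G u * neumann_sine k u) \<partial>unit_measure)
     = L2_inner (deriv G) (neumann_mode k) - ?w * L2_inner G (neumann_sine k)"
    unfolding L2_inner_eq
    using integrable_mult_continuous[OF continuous_L1_01[OF test_function_deriv_continuous[OF G]] c1]
      integrable_mult_continuous[OF continuous_L1_01[OF test_function_continuous[OF G]] c2]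
    by simp
  ultimately show ?thesis using test_function_boundary[OF G] by simp
qed

lemma continuous_L2_01: "continuous_on {0..1} v \<Longrightarrow> L2_01 v"
  using continuous_borel_lebesgue_on[of 0 1 v] unfolding L2_01_def set_borel_measurable_def
  by (intro conjI absolutely_integrable_continuous_real continuous_intros)
     (auto simp: borel_measurable_restrict_space_iff)

locale neumann_flow = heat_flow neumann_mode "\<lambda>k. (neumann_freq k)\<^sup>2" \<gamma> for \<gamma>
begin

definition "eig k = (neumann_freq k)\<^sup>2"

lemma freq_nonneg: "0 \<le> neumann_freq k" by (simp add: neumann_freq_def)

text \<open>Coefficients of the spatial derivative of the flow: a mode differentiates to minus its
  frequency times the sine of the same index.\<close>

definition "slope_coef t k = - (c k * neumann_freq k * exp (- eig k * t))"
definition "slope t u = (\<Sum>k. slope_coef t k * neumann_sine k u)"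

lemma sine_continuous: "continuous_on S (neumann_sine k)"
  unfolding neumann_sine_def by (intro continuous_intros)

lemma sine_bound: "\<bar>neumann_sine k u\<bar> \<le> 2"
  unfolding neumann_sine_def by (rule abs_mode_le)

lemma slope_summable:
  assumes "0 < t" shows "summable (\<lambda>k. \<bar>slope_coef t k\<bar>)"
proof -
  have "\<bar>- (c k * neumann_freq k)\<bar> \<le> 2 * (1 + (neumann_freq k)\<^sup>2)" for k
  proof -
    have "neumann_freq k \<le> 1 + (neumann_freq k)\<^sup>2"
      using zero_le_power2[of "neumann_freq k - 1"] freq_nonneg[of k] by (simp add: power2_diff)
    then have "\<bar>c k\<bar> * \<bar>neumann_freq k\<bar> \<le> 2 * (1 + (neumann_freq k)\<^sup>2)"
      using freq_nonneg[of k] c_bound[of k] by (intro mult_mono) auto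
    then show ?thesis by (simp add: abs_mult)
  qed
  from summable_weighted_exp[OF assms this] show ?thesis
    by (simp add: slope_coef_def eig_def)
qed

lemma slope_continuous: "0 < t \<Longrightarrow> continuous_on {0..1} (slope t)"
  unfolding slope_def[abs_def] by (rule continuous_on_series[OF sine_continuous sine_bound slope_summable])

text \<open>The derivative is moved onto the test function in each mode; the two series of pairings
  then agree term by term up to sign.\<close>

lemma slope_weak_deriv:
  assumes t: "0 < t" shows "is_weak_deriv (flow t) (slope t)"
  unfolding is_weak_deriv_def
proof (intro conjI allI impI)
  show "L2_01 (slope t)" by (rule continuous_L2_01[OF slope_continuous[OF t]])
  fix G assume G: "test_function G"
  have "(\<lambda>k. c k * exp (- eig k * t) * L2_inner (deriv G) (neumann_mode k)) sums L2_inner (deriv G) (flow t)"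
    using flow_inner[OF t continuous_L1_01[OF test_function_deriv_continuous[OF G]]]
    by (simp add: L2_inner_commute[of "flow t"] eig_def)
  then have 1: "(\<lambda>k. - (slope_coef t k * L2_inner G (neumann_sine k))) sums L2_inner (deriv G) (flow t)"
    by (simp add: L2_inner_neumann_modes_deriv[OF G] slope_coef_def mult_ac)
  have "(\<lambda>k. slope_coef t k * L2_inner G (neumann_sine k)) sums L2_inner G (slope t)"
    unfolding slope_def[abs_def]
    by (rule L2_inner_series[OF continuous_L1_01[OF test_function_continuous[OF G]] sine_continuous sine_bound slope_summable[OF t]])
  then show "L2_inner (deriv G) (flow t) = - L2_inner G (slope t)"
    using 1 sums_minus sums_unique2 by blast
qed

lemma slope_norm:
  assumes t: "0 < t" shows "(\<lambda>k. (slope_coef t k)\<^sup>2) sums L2_inner (slope t) (slope t)"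
proof -
  have L: "L1_01 (slope t)" by (rule continuous_L1_01[OF slope_continuous[OF t]])
  have "slope_coef t j * L2_inner (slope t) (neumann_sine j) = (slope_coef t j)\<^sup>2" for j
  proof -
    have "L1_01 (neumann_sine j)" by (rule continuous_L1_01[OF sine_continuous])
    then have "(\<lambda>k. slope_coef t k * L2_inner (neumann_sine j) (neumann_sine k)) sums L2_inner (neumann_sine j) (slope t)"
      unfolding slope_def[abs_def]
      by (rule L2_inner_series[OF _ sine_continuous sine_bound slope_summable[OF t]])
    moreover have "(\<lambda>k. slope_coef t k * L2_inner (neumann_sine j) (neumann_sine k)) = (\<lambda>k. if k = j then slope_coef t j else 0)"
      by (auto simp: neumann_sine_orthonormal slope_coef_def neumann_freq_def)
    ultimately have "L2_inner (neumann_sine j) (slope t) = slope_coef t j"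
      using sums_If_finite_set[of "{j}" "\<lambda>k. slope_coef t j"] by (simp add: sums_unique2)
    then show ?thesis by (simp add: L2_inner_commute power2_eq_square)
  qed
  moreover have S: "slope t = (\<lambda>u. \<Sum>k. slope_coef t k * neumann_sine k u)"
    by (simp add: slope_def fun_eq_iff)
  have "(\<lambda>k. slope_coef t k * L2_inner (slope t) (neumann_sine k)) sums L2_inner (slope t) (slope t)"
    using L2_inner_series[where h = neumann_sine, OF L sine_continuous sine_bound slope_summable[OF t]]
    by (simp only: S[symmetric])
  ultimately show ?thesis by simp
qed

lemma H1_norm_flow:
  assumes t: "0 < t"
  shows "(\<lambda>k. (c k)\<^sup>2 * ((1 + eig k) * exp (- eig k * (2 * t)))) sums (H1_norm (flow t))\<^sup>2"
proof -
  have e: "exp (- eig k * t) * exp (- eig k * t) = exp (- eig k * (2 * t))" for k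
    by (simp flip: exp_add)
  have "(\<lambda>k. c k * exp (- eig k * t) * L2_inner (flow t) (neumann_mode k)) sums L2_inner (flow t) (flow t)"
    using flow_inner[OF t flow_L1] by (simp add: eig_def)
  moreover have "c k * exp (- eig k * t) * L2_inner (flow t) (neumann_mode k) = (c k)\<^sup>2 * exp (- eig k * (2 * t))" for k
  proof -
    have "L2_inner (flow t) (neumann_mode k) = exp (- eig k * t) * c k"
      using flow_coefficient[of t k] t by (simp add: eig_def)
    then show ?thesis unfolding e[symmetric] by (simp only: power2_eq_square mult_ac)
  qed
  moreover have "(slope_coef t k)\<^sup>2 = (c k)\<^sup>2 * (eig k * exp (- eig k * (2 * t)))" for k
  proof -
    have "(slope_coef t k)\<^sup>2 = (c k)\<^sup>2 * (neumann_freq k)\<^sup>2 * (exp (- eig k * t) * exp (- eig k * t))"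
      unfolding slope_coef_def power2_minus power_mult_distrib by (simp only: power2_eq_square)
    then show ?thesis unfolding e by (simp only: eig_def mult.assoc)
  qed
  ultimately have "(\<lambda>k. (c k)\<^sup>2 * exp (- eig k * (2 * t)) + (c k)\<^sup>2 * (eig k * exp (- eig k * (2 * t)))) sums
      (L2_inner (flow t) (flow t) + L2_inner (slope t) (slope t))"
    using sums_add slope_norm[OF t] by simp
  then show ?thesis
    unfolding H1_norm_sq[OF slope_weak_deriv[OF t]] by (simp add: algebra_simps)
qed

lemma flow_H1: "0 < t \<Longrightarrow> flow t \<in> H1"
  using slope_weak_deriv flow_L1 by (auto simp: H1_def)

text \<open>Energy estimate: the time integral of eig * exp (- eig s) is at most 1 whatever the
  mode, so \<open>bessel\<close> dominates the sum, without any uniform bound on the norm as time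
  tends to 0.\<close>

lemma H1_norm_integrable:
  assumes T: "0 \<le> T"
  shows "integrable (lebesgue_on {0..T}) (\<lambda>t. (H1_norm (flow t))\<^sup>2)"
proof -
  let ?M = "lebesgue_on {0..T}"
  let ?f = "\<lambda>k s. (c k)\<^sup>2 * ((1 + eig k) * exp (- eig k * (2 * s)))"
  have eig0: "0 \<le> eig k" for k by (simp add: eig_def)
  have cont: "continuous_on {0..T} (?f k)" for k by (intro continuous_intros)
  have i: "integrable ?M (?f k)" for k
    using absolutely_integrable_continuous_real[OF cont] by (simp add: set_integrable_eq_lebesgue_on)
  have s1: "AE s in ?M. summable (\<lambda>k. norm (?f k s))"
    using AE_time_pos
  proof eventually_elim
    case (elim s)
    then show ?case using sums_summable[OF H1_norm_flow[OF elim]] eig0 by simp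
  qed
  have s2: "summable (\<lambda>k. \<integral>s. norm (?f k s) \<partial>?M)"
  proof (rule summable_comparison_test'[where N = 0, OF summable_mult2[OF bessel, of "T + 1"]])
    fix k :: nat
    have e: "integrable ?M (\<lambda>s. exp (- eig k * s))" "eig k * (\<integral>s. exp (- eig k * s) \<partial>?M) = 1 - exp (- eig k * T)"
      using exp_ev_integral[OF T, of k] by (simp_all add: eig_def)
    have one: "integrable ?M (\<lambda>s. 1 :: real)" by (rule finite_measure.integrable_const) (rule finite_measure_lebesgue_on, simp)
    have "(\<integral>s. norm (?f k s) \<partial>?M) \<le> (\<integral>s. (c k)\<^sup>2 * (1 + eig k * exp (- eig k * s)) \<partial>?M)"
    proof (rule integral_mono)
      fix s assume "s \<in> space ?M"
      then have s: "0 \<le> s" by simp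
      \<comment> \<open>Dropping the 2 in the exponent reduces the second summand to
        \<open>exp_ev_integral\<close>; the two summands contribute at most T and 1.\<close>
      have "exp (- eig k * (2 * s)) \<le> 1" "exp (- eig k * (2 * s)) \<le> exp (- eig k * s)"
        using s eig0[of k] by (auto simp: mult_nonneg_nonneg mult_left_mono)
      then have "(1 + eig k) * exp (- eig k * (2 * s)) \<le> 1 + eig k * exp (- eig k * s)"
        using eig0[of k] mult_left_mono[of _ _ "eig k"] by (simp add: distrib_right add_mono)
      then have "?f k s \<le> (c k)\<^sup>2 * (1 + eig k * exp (- eig k * s))" by (intro mult_left_mono) auto
      then show "norm (?f k s) \<le> (c k)\<^sup>2 * (1 + eig k * exp (- eig k * s))" using eig0[of k] by simp
    qed (use i e one in auto)
    also have "\<dots> = (c k)\<^sup>2 * (T + (1 - exp (- eig k * T)))"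
      using e one T by (simp add: measure_restrict_space)
    also have "\<dots> \<le> (c k)\<^sup>2 * (T + 1)" by (intro mult_left_mono) auto
    finally show "norm (\<integral>s. norm (?f k s) \<partial>?M) \<le> (c k)\<^sup>2 * (T + 1)" by simp
  qed
  have i1: "integrable ?M (\<lambda>s. \<Sum>k. ?f k s)" by (rule integrable_suminf[OF i s1 s2])
  have eq: "AE s in ?M. (\<Sum>k. ?f k s) = (H1_norm (flow s))\<^sup>2"
    using AE_time_pos by eventually_elim (use H1_norm_flow in \<open>auto simp: sums_iff\<close>)
  have "(\<lambda>t. (H1_norm (flow t))\<^sup>2) \<in> borel_measurable ?M"
  proof -
    have g: "(\<lambda>s. if s = 0 then (H1_norm (flow 0))\<^sup>2 else \<Sum>k. ?f k s) \<in> borel_measurable ?M"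
      by (intro measurable_restrict_space1 measurable_completion) simp
    have "(\<lambda>t. (H1_norm (flow t))\<^sup>2) \<in> borel_measurable ?M \<longleftrightarrow> (\<lambda>s. if s = 0 then (H1_norm (flow 0))\<^sup>2 else \<Sum>k. ?f k s) \<in> borel_measurable ?M"
      using H1_norm_flow by (intro measurable_cong) (auto simp: sums_iff)
    then show ?thesis using g by simp
  qed
  then show ?thesis by (rule integrable_cong_AE_imp[OF i1 _ eq])
qed

lemma flow_in_L2_time_H1:
  assumes "0 \<le> T" shows "L2_time_H1 T flow"
  unfolding L2_time_H1_def
proof (intro conjI)
  show "set_borel_measurable lebesgue ({0..T} \<times> {0..1}) (\<lambda>(t, u). flow t u)"
    by (intro flow_measurable borel_closed closed_Times) auto
  show "AE t in lebesgue. t \<in> {0..T} \<longrightarrow> flow t \<in> H1"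
    using AE_time_pos[of T] flow_H1 by (subst (asm) AE_restrict_space_iff) auto
  show "set_integrable lebesgue {0..T} (\<lambda>t. (H1_norm (flow t))\<^sup>2)"
    using H1_norm_integrable[OF assms] by (simp add: set_integrable_eq_lebesgue_on)
qed

lemma neumann_by_parts:
  assumes H: "C2_on {0..1} H H' H''"
  shows "L2_inner H'' (neumann_mode k) + (H' 0 * neumann_mode k 0 - H' 1 * neumann_mode k 1)
      = - eig k * L2_inner H (neumann_mode k)"
proof -
  have "sin (neumann_freq k + 0) = 0" using sin_npi2[of k] by (simp add: neumann_freq_def)
  then show ?thesis
    using cos_by_parts[OF H, of "neumann_mode k" "mode_norm k" "neumann_freq k" 0]
    by (simp add: neumann_mode_def[abs_def] eig_def)
qed

text \<open>The bulk coefficient \<open>a k\<close> and the boundary coefficient \<open>b k\<close>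
  add up to the eigenvalue times that of \<open>H\<close>, so both time integrals form a single
  \<open>Y\<close> in \<open>flow_weak_form\<close>. No boundary condition on \<open>H\<close> is
  required for this.\<close>

lemma flow_neumann_weak_form:
  assumes t: "0 \<le> t" and H: "C2_on {0..1} H H' H''"
  shows "L2_inner (flow t) H - L2_inner \<gamma> H
          - (LINT s:{0..t}|lebesgue. L2_inner (flow s) H'')
          - (LINT s:{0..t}|lebesgue.
               continuous_version (flow s) 0 * H' 0 - continuous_version (flow s) 1 * H' 1) = 0"
proof -
  note Hc = C2_on_continuous[OF H]
  let ?phi = neumann_mode
  let ?A = "\<lambda>s. L2_inner (flow s) H''"
  let ?B = "\<lambda>s. continuous_version (flow s) 0 * H' 0 - continuous_version (flow s) 1 * H' 1"
  define a where "a k = L2_inner H'' (?phi k)" for k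
  define b where "b k = H' 0 * ?phi k 0 - H' 1 * ?phi k 1" for k
  have ab: "a k + b k = - eig k * L2_inner H (?phi k)" for k
    unfolding a_def b_def by (rule neumann_by_parts[OF H])
  define E where "E = 2 * (\<integral>u. \<bar>H'' u\<bar> \<partial>unit_measure)"
  define D where "D = 2 * \<bar>H' 0\<bar> + 2 * \<bar>H' 1\<bar>"
  have a_bd: "\<bar>a k\<bar> \<le> E" for k
    unfolding a_def E_def by (intro L2_inner_bound continuous_L1_01 Hc phi_cont phi_bound)
  have b_bd: "\<bar>b k\<bar> \<le> D" for k
  proof -
    have "\<bar>H' 0\<bar> * \<bar>?phi k 0\<bar> \<le> \<bar>H' 0\<bar> * 2" "\<bar>H' 1\<bar> * \<bar>?phi k 1\<bar> \<le> \<bar>H' 1\<bar> * 2"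
      by (intro mult_left_mono phi_bound; simp)+
    then show ?thesis
      using abs_triangle_ineq4[of "H' 0 * ?phi k 0" "H' 1 * ?phi k 1"]
      unfolding b_def D_def by (simp add: abs_mult)
  qed
  have A: "(\<lambda>k. c k * exp (- eig k * s) * a k) sums ?A s" if "0 < s" for s
    unfolding a_def using flow_inner[OF that continuous_L1_01[OF Hc(3)]] by (simp add: eig_def)
  have B: "(\<lambda>k. c k * exp (- eig k * s) * b k) sums ?B s" if s: "0 < s" for s
  proof -
    have cv: "continuous_version (flow s) x = flow s x" if "x \<in> {0..1}" for x
      by (rule continuous_version_eq[OF flow_continuous[OF s] that])
    have fs: "(\<lambda>k. (c k * exp (- eig k * s)) * ?phi k x) sums flow s x" for x
    proof -
      have "summable (\<lambda>k. (c k * exp (- eig k * s)) * ?phi k x)"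
      proof (rule summable_comparison_test'[where N = 0, OF summable_mult2[OF summable_flow[OF s], of 2]])
        fix k
        show "norm (c k * exp (- eig k * s) * ?phi k x) \<le> \<bar>c k * exp (- (neumann_freq k)\<^sup>2 * s)\<bar> * 2"
          unfolding eig_def real_norm_def abs_mult[of _ "?phi k x"] by (intro mult_left_mono phi_bound) auto
      qed
      then show ?thesis using s by (simp add: flow_def summable_sums eig_def)
    qed
    show ?thesis
      using sums_diff[OF sums_mult[OF fs[of 0], of "H' 0"] sums_mult[OF fs[of 1], of "H' 1"]]
      by (simp add: cv b_def algebra_simps)
  qed
  have bd: "\<bar>c k * x\<bar> \<le> 2 * C" if "\<bar>x\<bar> \<le> C" for x C k
    using mult_mono[OF c_bound[of k] that] by (simp add: abs_mult)
  have iA: "integrable (lebesgue_on {0..t}) ?A"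
    by (rule time_integral(1)[OF t bd[OF a_bd]]) (use A in \<open>simp add: eig_def mult_ac\<close>)
  have iB: "integrable (lebesgue_on {0..t}) ?B"
    by (rule time_integral(1)[OF t bd[OF b_bd]]) (use B in \<open>simp add: eig_def mult_ac\<close>)
  have "L2_inner (flow t) H - L2_inner \<gamma> H - (\<integral>s. ?A s + ?B s \<partial>lebesgue_on {0..t}) = 0"
  proof (rule flow_weak_form[OF t Hc(1) neumann_approximable[OF Hc(1)]])
    show "\<bar>(neumann_freq k)\<^sup>2 * L2_inner H (?phi k)\<bar> \<le> E + D" for k
      using ab[of k] a_bd[of k] b_bd[of k] by (simp add: eig_def)
    show "(\<lambda>k. c k * exp (- (neumann_freq k)\<^sup>2 * s) * (- (neumann_freq k)\<^sup>2 * L2_inner H (?phi k))) sums (?A s + ?B s)"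
      if "0 < s" for s
      using sums_add[OF A[OF that] B[OF that]] ab unfolding distrib_left[symmetric] by (simp add: eig_def)
  qed
  then show ?thesis using iA iB by (simp add: set_integral_eq_lebesgue_on)
qed

lemma flow_solves_neumann: "0 \<le> T \<Longrightarrow> weak_solution_neumann T \<gamma> flow"
  unfolding weak_solution_neumann_def
  using flow_in_L2_time_H1 flow_L1 flow_neumann_weak_form by auto

lemma neumann_solution_unique:
  assumes T: "0 \<le> T" and sol: "weak_solution_neumann T \<gamma> \<rho>" and t: "t \<in> {0..T}"
  shows "AE u in lebesgue. u \<in> {0..1} \<longrightarrow> \<rho> t u = flow t u"
proof -
  have "AE u in unit_measure. \<rho> t u = flow t u"
  proof (rule AE_eq_if_coefficients_eq[OF _ flow_L1])
    show "L1_01 (\<rho> t)" using sol t by (simp add: weak_solution_neumann_def)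
    fix k
    let ?w = "neumann_freq k"
    \<comment> \<open>The derivative of a mode vanishes at both ends; the boundary integral drops
      out and the equation for the coefficient closes.\<close>
    have "sin ?w = 0" using sin_npi2[of k] by (simp add: neumann_freq_def)
    have "L2_inner (\<rho> t) (neumann_mode k) = exp (- ?w\<^sup>2 * t) * L2_inner \<gamma> (neumann_mode k)"
    proof (rule coefficient_of_integral_equation[OF T t])
      fix s assume s: "s \<in> {0..T}"
      have "C2_on {0..1} (neumann_mode k) (\<lambda>u. - mode_norm k * ?w * sin (?w * u + 0)) (\<lambda>u. - ?w\<^sup>2 * neumann_mode k u)"
        unfolding neumann_mode_def[abs_def] by (rule C2_on_cos)
      then have "L2_inner (\<rho> s) (neumann_mode k) - L2_inner \<gamma> (neumann_mode k)
          - (LINT s:{0..s}|lebesgue. L2_inner (\<rho> s) (\<lambda>u. - ?w\<^sup>2 * neumann_mode k u))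
          - (LINT s:{0..s}|lebesgue. continuous_version (\<rho> s) 0 * (- mode_norm k * ?w * sin (?w * 0 + 0))
               - continuous_version (\<rho> s) 1 * (- mode_norm k * ?w * sin (?w * 1 + 0))) = 0"
        using sol s unfolding weak_solution_neumann_def by blast
      then show "L2_inner (\<rho> s) (neumann_mode k) - L2_inner \<gamma> (neumann_mode k)
          - (LINT s:{0..s}|lebesgue. L2_inner (\<rho> s) (\<lambda>u. - ?w\<^sup>2 * neumann_mode k u)) = 0"
        using \<open>sin ?w = 0\<close> by simp
    qed
    then show "L2_inner (\<rho> t) (neumann_mode k) = L2_inner (flow t) (neumann_mode k)"
      using flow_coefficient[of t k] t by (simp add: c_def)
  qed
  then show ?thesis by (subst (asm) AE_restrict_space_iff) auto
qed

lemma flow_is_the_neumann_solution: "0 \<le> T \<Longrightarrow> is_the_solution T (weak_solution_neumann T \<gamma>) flow"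
  unfolding is_the_solution_def using flow_solves_neumann neumann_solution_unique by blast

end

section \<open>Periodic solutions\<close>

lemma cos_add_int_2pi: "cos (2 * pi * of_int m + p) = cos p"
  by (simp add: cos_add)

lemma periodic_freq_shift:
  "sin (periodic_freq k + x) = sin x" "cos (periodic_freq k + x) = cos x"
proof -
  have f: "periodic_freq k = 2 * pi * of_int (int ((k + 1) div 2))" by (simp add: periodic_freq_def)
  show "sin (periodic_freq k + x) = sin x" "cos (periodic_freq k + x) = cos x"
    unfolding f by (simp_all only: sin_add_int_2pi cos_add_int_2pi)
qed

locale periodic_flow = heat_flow periodic_mode "\<lambda>k. (periodic_freq k)\<^sup>2" \<gamma> for \<gamma>
begin

lemma flow_periodic_weak_form:
  assumes t: "0 \<le> t" and H: "C2_on UNIV H H' H''" and per: "periodic_fun_simple' H"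
  shows "L2_inner (flow t) H - L2_inner \<gamma> H - (LINT s:{0..t}|lebesgue. L2_inner (flow s) H'') = 0"
proof -
  let ?phi = periodic_mode
  have H01: "C2_on {0..1} H H' H''"
    using H unfolding C2_on_def
    by (auto intro: has_field_derivative_at_within continuous_on_subset)
  note Hc = C2_on_continuous[OF H01]
  interpret per: periodic_fun_simple' H by (rule per)
  have H1: "H 1 = H 0" using per.plus_1[of 0] by simp
  \<comment> \<open>Periodicity is given for \<open>H\<close> alone; translation by 1 transfers it
    to the derivative at the end points.\<close>
  have H'1: "H' 1 = H' 0"
  proof -
    have "(H has_real_derivative H' 1) (at (0 + 1))" using H by (simp add: C2_on_def)
    then have "((\<lambda>u. H (u + 1)) has_real_derivative H' 1) (at 0)" by (simp only: DERIV_shift)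
    then have "(H has_real_derivative H' 1) (at 0)" by (simp add: per.plus_1)
    then show ?thesis using H DERIV_unique unfolding C2_on_def by blast
  qed
  have e: "- (periodic_freq k)\<^sup>2 * L2_inner H (?phi k) = L2_inner H'' (?phi k)" for k
  proof -
    show ?thesis
      using cos_by_parts[OF H01, of "?phi k" "mode_norm k" "periodic_freq k" "periodic_phase k"] H1 H'1
      by (simp add: periodic_mode_def[abs_def] periodic_freq_shift)
  qed
  have "L2_inner (flow t) H - L2_inner \<gamma> H - (\<integral>s. L2_inner (flow s) H'' \<partial>lebesgue_on {0..t}) = 0"
  proof (rule flow_weak_form[OF t Hc(1) periodic_approximable[OF Hc(1)]])
    show "H 0 = H 1" using H1 by simp
    show "\<bar>(periodic_freq k)\<^sup>2 * L2_inner H (?phi k)\<bar> \<le> 2 * (\<integral>u. \<bar>H'' u\<bar> \<partial>unit_measure)" for k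
    proof -
      have "\<bar>L2_inner H'' (?phi k)\<bar> \<le> 2 * (\<integral>u. \<bar>H'' u\<bar> \<partial>unit_measure)"
        by (intro L2_inner_bound continuous_L1_01 Hc phi_cont phi_bound)
      then show ?thesis unfolding e[symmetric] by simp
    qed
    show "(\<lambda>k. c k * exp (- (periodic_freq k)\<^sup>2 * s) * (- (periodic_freq k)\<^sup>2 * L2_inner H (?phi k))) sums L2_inner (flow s) H''"
      if "0 < s" for s
      unfolding e by (rule flow_inner[OF that continuous_L1_01[OF Hc(3)]])
  qed
  then show ?thesis by (simp add: set_integral_eq_lebesgue_on)
qed

text \<open>The range is supplied by \<open>flow_range_if_hydrodynamic_limit\<close>. There is no
  circle: the limit towards \<open>flow\<close> is proved from its coefficients and not from its
  being a solution.\<close>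

lemma flow_solves_periodic:
  assumes "\<And>t u. 0 < t \<Longrightarrow> t \<le> T \<Longrightarrow> u \<in> {0..<1} \<Longrightarrow> flow t u \<in> {0..1}"
  shows "weak_solution_periodic T \<gamma> flow"
  unfolding weak_solution_periodic_def
proof (intro conjI)
  have "\<bar>flow t u\<bar> \<le> 1" if "t \<in> {0..T}" "u \<in> {0..<1}" for t u
    using assms[of t u] that gamma_range[of u] by (cases "t = 0") (auto simp: flow_def)
  then show "\<exists>B. \<forall>t\<in>{0..T}. \<forall>u\<in>{0..<1}. \<bar>flow t u\<bar> \<le> B" by blast
  show "set_borel_measurable lebesgue ({0..T} \<times> {0..<1}) (\<lambda>(t, u). flow t u)"
    by (rule flow_measurable) (simp add: borel_prod[symmetric])
qed (use flow_L1 flow_periodic_weak_form in auto)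

lemma periodic_solution_unique:
  assumes T: "0 \<le> T" and sol: "weak_solution_periodic T \<gamma> \<rho>" and t: "t \<in> {0..T}"
  shows "AE u in lebesgue. u \<in> {0..1} \<longrightarrow> \<rho> t u = flow t u"
proof -
  have "AE u in unit_measure. \<rho> t u = flow t u"
  proof (rule AE_eq_if_coefficients_eq[OF _ flow_L1])
    show "L1_01 (\<rho> t)" using sol t by (simp add: weak_solution_periodic_def)
    fix k
    let ?w = "periodic_freq k" and ?p = "periodic_phase k"
    have "L2_inner (\<rho> t) (periodic_mode k) = exp (- ?w\<^sup>2 * t) * L2_inner \<gamma> (periodic_mode k)"
    proof (rule coefficient_of_integral_equation[OF T t])
      fix s assume s: "s \<in> {0..T}"
      have "C2_on UNIV (periodic_mode k) (\<lambda>u. - mode_norm k * ?w * sin (?w * u + ?p)) (\<lambda>u. - ?w\<^sup>2 * periodic_mode k u)"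
        unfolding periodic_mode_def[abs_def] by (rule C2_on_cos)
      moreover have "periodic_fun_simple' (periodic_mode k)"
      proof
        fix u
        have "?w * (u + 1) + ?p = ?w + (?w * u + ?p)" by (simp add: distrib_left)
        then have "cos (?w * (u + 1) + ?p) = cos (?w * u + ?p)" by (simp only: periodic_freq_shift)
        then show "periodic_mode k (u + 1) = periodic_mode k u" by (simp add: periodic_mode_def)
      qed
      ultimately show "L2_inner (\<rho> s) (periodic_mode k) - L2_inner \<gamma> (periodic_mode k)
          - (LINT s:{0..s}|lebesgue. L2_inner (\<rho> s) (\<lambda>u. - ?w\<^sup>2 * periodic_mode k u)) = 0"
        using sol s unfolding weak_solution_periodic_def by blast
    qed
    then show "L2_inner (\<rho> t) (periodic_mode k) = L2_inner (flow t) (periodic_mode k)"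
      using flow_coefficient[of t k] t by (simp add: c_def)
  qed
  then show ?thesis by (subst (asm) AE_restrict_space_iff) auto
qed

end

section \<open>The generator of the exclusion process\<close>

abbreviation occ :: "(nat \<Rightarrow> bool) \<Rightarrow> nat \<Rightarrow> real" where "occ \<eta> x \<equiv> of_bool (\<eta> x)"

definition swap_sites :: "nat \<Rightarrow> nat \<Rightarrow> (nat \<Rightarrow> bool) \<Rightarrow> nat \<Rightarrow> bool" where
  "swap_sites x y \<eta> = \<eta>(x := \<eta> y, y := \<eta> x)"

lemma configs_iff: "\<eta> \<in> configs n \<longleftrightarrow> (\<forall>x\<ge>n. \<not> \<eta> x)"
  by (auto simp: configs_def PiE_dflt_def)

lemma swap_in_configs: "\<eta> \<in> configs n \<Longrightarrow> x < n \<Longrightarrow> y < n \<Longrightarrow> swap_sites x y \<eta> \<in> configs n"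
  by (auto simp: configs_iff swap_sites_def)

lemma finite_configs: "finite (configs n)"
  unfolding configs_def by (intro finite_PiE_dflt) auto

lemma torus_neighbours_iff:
  assumes "x < n" "y < n"
  shows "torus_neighbours n x y \<longleftrightarrow> y = (x + 1) mod n \<or> x = (y + 1) mod n"
proof -
  have key: "[int x - int y = 1] (mod int n) \<longleftrightarrow> x = (y + 1) mod n" if "x < n" for x y
  proof -
    have "[int x - int y = 1] (mod int n) \<longleftrightarrow> [int x = int (y + 1)] (mod int n)"
      using cong_add_rcancel[of "int x - int y" "int y" 1 "int n"] by (simp add: add.commute)
    also have "\<dots> \<longleftrightarrow> x mod n = (y + 1) mod n" by (simp only: cong_int_iff) (simp add: cong_def)
    finally show ?thesis using that by simp
  qed
  have "[int x - int y = - 1] (mod int n) \<longleftrightarrow> [int y - int x = 1] (mod int n)"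
    using cong_minus_minus_iff[of "int x - int y" "- 1" "int n"] by simp
  then show ?thesis unfolding torus_neighbours_def using key assms by blast
qed

lemma next_site_bij: "0 < n \<Longrightarrow> bij_betw (\<lambda>i. (i + 1) mod n) {..<n} {..<(n::nat)}"
proof -
  assume n: "0 < n"
  have "inj_on (\<lambda>i. (i + 1) mod n) {..<n}"
    by (rule inj_onI) (auto simp: mod_if split: if_splits)
  moreover have "(\<lambda>i. (i + 1) mod n) ` {..<n} \<subseteq> {..<n}" using n by auto
  ultimately show ?thesis by (simp add: bij_betw_def endo_inj_surj)
qed

text \<open>From three sites on, the two orientations of the bonds are disjoint families of ordered
  pairs, because two steps forward never return to the start; on two sites they would coincide. This
  is the source of the threshold 3.\<close>

lemma sum_neighbours:
  fixes h :: "nat \<Rightarrow> nat \<Rightarrow> real"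
  assumes n: "3 \<le> n"
  shows "(\<Sum>(x, y) \<in> {(x, y). x < n \<and> y < n \<and> torus_neighbours n x y}. h x y)
       = (\<Sum>i<n. h i ((i + 1) mod n) + h ((i + 1) mod n) i)"
proof -
  let ?s = "\<lambda>i. (i + 1) mod n"
  let ?A = "(\<lambda>i. (i, ?s i)) ` {..<n}" and ?B = "(\<lambda>i. (?s i, i)) ` {..<n}"
  have P: "{(x, y). x < n \<and> y < n \<and> torus_neighbours n x y} = ?A \<union> ?B"
    using n by (auto simp: torus_neighbours_iff)
  have "?A \<inter> ?B = {}"
  proof (rule ccontr)
    assume "?A \<inter> ?B \<noteq> {}"
    then obtain i where "i < n" "?s (?s i) = i" by auto
    then show False using n by (auto simp: mod_if split: if_splits)
  qed
  then show ?thesis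
    unfolding P by (subst sum.union_disjoint) (auto simp: sum.reindex inj_on_def sum.distrib)
qed

definition empirical :: "nat \<Rightarrow> (nat \<Rightarrow> real) \<Rightarrow> (nat \<Rightarrow> bool) \<Rightarrow> real" where
  "empirical n a \<eta> = 1 / real n * (\<Sum>x<n. a x * occ \<eta> x)"

lemma empirical_swap:
  assumes "x < n" "y < n" "x \<noteq> y" "\<eta> x" "\<not> \<eta> y"
  shows "empirical n a (swap_sites x y \<eta>) - empirical n a \<eta> = (a y - a x) / real n"
proof -
  have "(\<Sum>z<n. a z * occ (swap_sites x y \<eta>) z) - (\<Sum>z<n. a z * occ \<eta> z)
      = (\<Sum>z<n. (if z = y then a y else 0) - (if z = x then a x else 0))"
    unfolding sum_subtractf[symmetric]
    using assms by (intro sum.cong) (auto simp: swap_sites_def)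
  also have "\<dots> = a y - a x" using assms by (simp add: sum_subtractf)
  finally have D: "(\<Sum>z<n. a z * occ (swap_sites x y \<eta>) z) - (\<Sum>z<n. a z * occ \<eta> z) = a y - a x" .
  show ?thesis unfolding empirical_def right_diff_distrib[symmetric] D by simp
qed

lemma empirical_bound:
  assumes "\<And>x. x < n \<Longrightarrow> \<bar>a x\<bar> \<le> K" "0 < n"
  shows "\<bar>empirical n a \<eta>\<bar> \<le> K"
proof -
  have "\<bar>\<Sum>x<n. a x * occ \<eta> x\<bar> \<le> (\<Sum>x<n. K)"
  proof (rule order_trans[OF sum_abs sum_mono])
    fix x assume "x \<in> {..<n}"
    then show "\<bar>a x * occ \<eta> x\<bar> \<le> K" using assms(1)[of x] by (auto simp: of_bool_def)
  qed
  then show ?thesis using assms(2) by (simp add: empirical_def abs_mult divide_simps mult.commute)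
qed

section \<open>The generator on linear and quadratic observables\<close>

locale slow_ssep =
  fixes n :: nat and g :: real and \<mu> :: "(nat \<Rightarrow> bool) pmf"
    and M :: "'w measure" and X :: "real \<Rightarrow> 'w \<Rightarrow> nat \<Rightarrow> bool"
  assumes n_ge: "3 \<le> n" and g_nonneg: "0 \<le> g" and ssep: "slow_site_ssep n g \<mu> M X"
begin

definition "gen f \<eta> = (real n)\<^sup>2 * ssep_generator n g f \<eta>"

abbreviation nxt where "nxt i \<equiv> (i + 1) mod n"

lemma nxt_less: "nxt i < n" using n_ge by simp

lemma nxt_neq: "i < n \<Longrightarrow> nxt i \<noteq> i" using n_ge by (auto simp: mod_if)

definition "rate x y \<eta> = site_rate g x * occ \<eta> x * (1 - occ \<eta> y)"

lemma gen_eq: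
  "gen f \<eta> = (real n)\<^sup>2 * (\<Sum>i<n. rate i (nxt i) \<eta> * (f (swap_sites i (nxt i) \<eta>) - f \<eta>)
     + rate (nxt i) i \<eta> * (f (swap_sites (nxt i) i \<eta>) - f \<eta>))"
  unfolding gen_def ssep_generator_def
  using sum_neighbours[OF n_ge, of "\<lambda>x y. rate x y \<eta> * (f (swap_sites x y \<eta>) - f \<eta>)"]
  by (simp add: rate_def swap_sites_def)

lemma rate_bounds: "0 \<le> rate x y \<eta>" "rate x y \<eta> \<le> 1 + g"
  using g_nonneg by (auto simp: rate_def site_rate_def of_bool_def)

text \<open>Crude count: time scale n^2, n bonds, two directions, rate at most 1 + g, increment at
  most 2 B. It serves only to make the exponential series converge for each fixed n.\<close>

lemma gen_bound:
  assumes f: "\<forall>\<zeta>\<in>configs n. \<bar>f \<zeta>\<bar> \<le> B" and \<eta>: "\<eta> \<in> configs n"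
  shows "\<bar>gen f \<eta>\<bar> \<le> ((real n)\<^sup>2 * (real n * (2 * ((1 + g) * 2)))) * B"
proof -
  have B: "0 \<le> B" using f \<eta> abs_ge_zero order_trans by blast
  have t: "\<bar>rate x y \<eta> * (f (swap_sites x y \<eta>) - f \<eta>)\<bar> \<le> (1 + g) * (2 * B)" if "x < n" "y < n" for x y
  proof -
    have "\<bar>f (swap_sites x y \<eta>) - f \<eta>\<bar> \<le> 2 * B"
      using f \<eta> swap_in_configs[OF \<eta> that] by (smt (verit))
    then have "\<bar>rate x y \<eta>\<bar> * \<bar>f (swap_sites x y \<eta>) - f \<eta>\<bar> \<le> (1 + g) * (2 * B)"
      using rate_bounds[of x y \<eta>] g_nonneg by (intro mult_mono) auto
    then show ?thesis by (simp add: abs_mult)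
  qed
  have "\<bar>\<Sum>i<n. rate i (nxt i) \<eta> * (f (swap_sites i (nxt i) \<eta>) - f \<eta>)
     + rate (nxt i) i \<eta> * (f (swap_sites (nxt i) i \<eta>) - f \<eta>)\<bar> \<le> (\<Sum>i<n. 2 * ((1 + g) * (2 * B)))"
  proof (rule order_trans[OF sum_abs sum_mono])
    fix i assume "i \<in> {..<n}"
    then show "\<bar>rate i (nxt i) \<eta> * (f (swap_sites i (nxt i) \<eta>) - f \<eta>)
     + rate (nxt i) i \<eta> * (f (swap_sites (nxt i) i \<eta>) - f \<eta>)\<bar> \<le> 2 * ((1 + g) * (2 * B))"
      using t[of i "nxt i"] t[of "nxt i" i] nxt_less[of i] by simp
  qed
  then have "(real n)\<^sup>2 * \<bar>\<Sum>i<n. rate i (nxt i) \<eta> * (f (swap_sites i (nxt i) \<eta>) - f \<eta>)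
     + rate (nxt i) i \<eta> * (f (swap_sites (nxt i) i \<eta>) - f \<eta>)\<bar> \<le> (real n)\<^sup>2 * (real n * (2 * ((1 + g) * (2 * B))))"
    by (intro mult_left_mono) auto
  then show ?thesis unfolding gen_eq by (simp add: abs_mult mult_ac)
qed

sublocale finite_markov M X "configs n" gen "(real n)\<^sup>2 * (real n * (2 * ((1 + g) * 2)))"
proof
  show "markov_process_with_generator M X (configs n) gen"
    using ssep unfolding slow_site_ssep_def gen_def[abs_def] by simp
qed (use g_nonneg gen_bound finite_configs in auto)

text \<open>The net rate across a bond governs the drift of linear observables, the total rate
  \<open>activity\<close> their quadratic variation.\<close>

definition "flux i \<eta> = rate i (nxt i) \<eta> - rate (nxt i) i \<eta>"
definition "activity i \<eta> = rate i (nxt i) \<eta> + rate (nxt i) i \<eta>"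

text \<open>Blocked jumps have rate 0, so behind the rate the increment formula holds for all
  configurations.\<close>

lemma rate_empirical_swap:
  assumes "x < n" "y < n" "x \<noteq> y"
  shows "rate x y \<eta> * (empirical n a (swap_sites x y \<eta>) - empirical n a \<eta>) = rate x y \<eta> * ((a y - a x) / real n)"
    and "rate x y \<eta> * ((empirical n a (swap_sites x y \<eta>))\<^sup>2 - (empirical n a \<eta>)\<^sup>2)
       = rate x y \<eta> * (2 * empirical n a \<eta> * ((a y - a x) / real n) + ((a y - a x) / real n)\<^sup>2)"
proof -
  have "u\<^sup>2 - v\<^sup>2 = 2 * v * (u - v) + (u - v)\<^sup>2" for u v :: real
    by (simp add: power2_eq_square algebra_simps)
  then show "rate x y \<eta> * (empirical n a (swap_sites x y \<eta>) - empirical n a \<eta>) = rate x y \<eta> * ((a y - a x) / real n)"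
    "rate x y \<eta> * ((empirical n a (swap_sites x y \<eta>))\<^sup>2 - (empirical n a \<eta>)\<^sup>2)
       = rate x y \<eta> * (2 * empirical n a \<eta> * ((a y - a x) / real n) + ((a y - a x) / real n)\<^sup>2)"
    using empirical_swap[OF assms, of \<eta> a] by (cases "\<eta> x \<and> \<not> \<eta> y"; auto simp: rate_def)+
qed

lemma gen_empirical: "gen (empirical n a) \<eta> = real n * (\<Sum>i<n. (a (nxt i) - a i) * flux i \<eta>)"
proof -
  have n0: "real n \<noteq> 0" using n_ge by simp
  have "(\<Sum>i<n. rate i (nxt i) \<eta> * (empirical n a (swap_sites i (nxt i) \<eta>) - empirical n a \<eta>)
     + rate (nxt i) i \<eta> * (empirical n a (swap_sites (nxt i) i \<eta>) - empirical n a \<eta>))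
     = (\<Sum>i<n. (a (nxt i) - a i) * flux i \<eta> / real n)"
  proof (rule sum.cong[OF refl])
    fix i assume "i \<in> {..<n}"
    then have i: "i < n" "nxt i \<noteq> i" using nxt_neq by auto
    show "rate i (nxt i) \<eta> * (empirical n a (swap_sites i (nxt i) \<eta>) - empirical n a \<eta>)
     + rate (nxt i) i \<eta> * (empirical n a (swap_sites (nxt i) i \<eta>) - empirical n a \<eta>)
     = (a (nxt i) - a i) * flux i \<eta> / real n"
      unfolding rate_empirical_swap(1)[OF i(1) nxt_less i(2)[symmetric]] rate_empirical_swap(1)[OF nxt_less i(1) i(2)] flux_def
      using n0 by (simp add: field_simps)
  qed
  then show ?thesis
    unfolding gen_eq using n0 by (simp add: sum_divide_distrib[symmetric] power2_eq_square)
qed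

text \<open>By u^2 - v^2 = 2 v (u - v) + (u - v)^2. The second sum is the carre du champ; its time
  factor n^2 cancels against the squared factor 1/n of the empirical measure.\<close>

lemma gen_empirical_sq:
  "gen (\<lambda>\<eta>. (empirical n a \<eta>)\<^sup>2) \<eta>
     = 2 * empirical n a \<eta> * gen (empirical n a) \<eta> + (\<Sum>i<n. (a (nxt i) - a i)\<^sup>2 * activity i \<eta>)"
proof -
  have n0: "real n \<noteq> 0" using n_ge by simp
  let ?Y = "empirical n a \<eta>"
  have "(\<Sum>i<n. rate i (nxt i) \<eta> * ((empirical n a (swap_sites i (nxt i) \<eta>))\<^sup>2 - ?Y\<^sup>2)
     + rate (nxt i) i \<eta> * ((empirical n a (swap_sites (nxt i) i \<eta>))\<^sup>2 - ?Y\<^sup>2))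
     = (\<Sum>i<n. 2 * ?Y / real n * ((a (nxt i) - a i) * flux i \<eta>) + (a (nxt i) - a i)\<^sup>2 * activity i \<eta> / (real n)\<^sup>2)"
  proof (rule sum.cong[OF refl])
    fix i assume "i \<in> {..<n}"
    then have i: "i < n" "nxt i \<noteq> i" using nxt_neq by auto
    have "r * (2 * Y * ((a' - a'') / m) + ((a' - a'') / m)\<^sup>2) + s * (2 * Y * ((a'' - a') / m) + ((a'' - a') / m)\<^sup>2)
       = 2 * Y / m * ((a' - a'') * (r - s)) + (a' - a'')\<^sup>2 * (r + s) / m\<^sup>2" if "m \<noteq> 0" for r s Y a' a'' m :: real
      using that by (simp add: field_simps power2_eq_square)
    from this[OF n0]
    show "rate i (nxt i) \<eta> * ((empirical n a (swap_sites i (nxt i) \<eta>))\<^sup>2 - ?Y\<^sup>2)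
     + rate (nxt i) i \<eta> * ((empirical n a (swap_sites (nxt i) i \<eta>))\<^sup>2 - ?Y\<^sup>2)
     = 2 * ?Y / real n * ((a (nxt i) - a i) * flux i \<eta>) + (a (nxt i) - a i)\<^sup>2 * activity i \<eta> / (real n)\<^sup>2"
      unfolding rate_empirical_swap(2)[OF i(1) nxt_less i(2)[symmetric]] rate_empirical_swap(2)[OF nxt_less i(1) i(2)] flux_def activity_def
      by blast
  qed
  also have "\<dots> = 2 * ?Y / real n * (\<Sum>i<n. (a (nxt i) - a i) * flux i \<eta>) + (\<Sum>i<n. (a (nxt i) - a i)\<^sup>2 * activity i \<eta>) / (real n)\<^sup>2"
    by (simp add: sum.distrib sum_distrib_left sum_divide_distrib)
  finally have "gen (\<lambda>\<eta>. (empirical n a \<eta>)\<^sup>2) \<eta> = (real n)\<^sup>2 *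
     (2 * ?Y / real n * (\<Sum>i<n. (a (nxt i) - a i) * flux i \<eta>) + (\<Sum>i<n. (a (nxt i) - a i)\<^sup>2 * activity i \<eta>) / (real n)\<^sup>2)"
    unfolding gen_eq by simp
  moreover have "N\<^sup>2 * (2 * Y / N * S + R / N\<^sup>2) = 2 * Y * (N * S) + R" if "N \<noteq> 0" for N Y S R :: real
    using that by (simp add: field_simps power2_eq_square)
  ultimately show ?thesis unfolding gen_empirical using n0 by simp
qed

text \<open>Plays the part of \<open>q\<close> in \<open>approximate_eigenfunction\<close>, with
  \<kappa> = 1/n.\<close>

definition "origin_mass = empirical n (\<lambda>x. of_bool (x = 0))"

lemma origin_mass_bounds: "0 \<le> origin_mass \<eta>" "origin_mass \<eta> \<le> 1 / real n"
proof -
  have "(\<Sum>x<n. of_bool (x = 0) * occ \<eta> x) = (\<Sum>x<n. if x = 0 then occ \<eta> 0 else 0)"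
    by (intro sum.cong) auto
  then have "origin_mass \<eta> = occ \<eta> 0 / real n"
    using n_ge by (simp add: origin_mass_def empirical_def)
  then show "0 \<le> origin_mass \<eta>" "origin_mass \<eta> \<le> 1 / real n"
    by (auto simp: of_bool_def)
qed

text \<open>The error terms may involve the generator applied to the mass at the origin: a slow site
  absorbs particles quickly, but it holds at most one.\<close>

lemma empirical_second_moment:
  assumes a: "\<And>x. x < n \<Longrightarrow> \<bar>a x\<bar> \<le> 2" and l: "0 \<le> l" and C: "0 \<le> C" and t: "0 \<le> t"
    and drift: "\<And>\<eta>. \<eta> \<in> configs n \<Longrightarrow>
        \<bar>gen (empirical n a) \<eta> + l * empirical n a \<eta>\<bar> \<le> \<epsilon> + C * gen origin_mass \<eta>"
    and noise: "\<And>\<eta>. \<eta> \<in> configs n \<Longrightarrow>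
        (\<Sum>i<n. (a (nxt i) - a i)\<^sup>2 * activity i \<eta>) \<le> \<epsilon> + C * gen origin_mass \<eta>"
  shows "expectation (\<lambda>\<omega>. (empirical n a (X t \<omega>) - exp (- l * t) * c)\<^sup>2)
    \<le> expectation (\<lambda>\<omega>. (empirical n a (X 0 \<omega>) - c)\<^sup>2) + (5 + 2 * \<bar>c\<bar>) * (\<epsilon> * t + C / real n)"
proof -
  let ?Y = "empirical n a"
  define A where "A = \<epsilon> * t + C / real n"
  have Y2: "\<bar>?Y \<eta>\<bar> \<le> 2" for \<eta> using a n_ge by (intro empirical_bound) auto
  have 1: "\<bar>expectation (\<lambda>\<omega>. ?Y (X t \<omega>)) - exp (- l * t) * expectation (\<lambda>\<omega>. ?Y (X 0 \<omega>))\<bar> \<le> A"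
    using approximate_eigenfunction[OF l C t drift, of "1 / real n"] origin_mass_bounds by (simp add: A_def)
  \<comment> \<open>The constant 5 is 4 + 1: the drift error is multiplied by 2 |Y| \<le> 4, and the
    carre du champ adds one more error of the same form.\<close>
  have sq: "\<bar>gen (\<lambda>\<eta>. (?Y \<eta>)\<^sup>2) \<eta> + 2 * l * (?Y \<eta>)\<^sup>2\<bar> \<le> 5 * \<epsilon> + 5 * C * gen origin_mass \<eta>"
    if \<eta>: "\<eta> \<in> configs n" for \<eta>
  proof -
    let ?S = "\<Sum>i<n. (a (nxt i) - a i)\<^sup>2 * activity i \<eta>"
    have S0: "0 \<le> ?S" unfolding activity_def using rate_bounds(1) by (intro sum_nonneg mult_nonneg_nonneg add_nonneg_nonneg) auto
    have "gen (\<lambda>\<eta>. (?Y \<eta>)\<^sup>2) \<eta> + 2 * l * (?Y \<eta>)\<^sup>2 = 2 * ?Y \<eta> * (gen ?Y \<eta> + l * ?Y \<eta>) + ?S"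
      unfolding gen_empirical_sq by (simp add: algebra_simps power2_eq_square)
    moreover have "\<bar>2 * ?Y \<eta> * (gen ?Y \<eta> + l * ?Y \<eta>)\<bar> \<le> 4 * (\<epsilon> + C * gen origin_mass \<eta>)"
      unfolding abs_mult using Y2[of \<eta>] drift[OF \<eta>] by (intro mult_mono) auto
    ultimately have "\<bar>gen (\<lambda>\<eta>. (?Y \<eta>)\<^sup>2) \<eta> + 2 * l * (?Y \<eta>)\<^sup>2\<bar> \<le> 4 * (\<epsilon> + C * gen origin_mass \<eta>) + (\<epsilon> + C * gen origin_mass \<eta>)"
      using noise[OF \<eta>] S0 by linarith
    then show ?thesis by (simp add: algebra_simps)
  qed
  have "\<bar>expectation (\<lambda>\<omega>. (?Y (X t \<omega>))\<^sup>2) - exp (- (2 * l) * t) * expectation (\<lambda>\<omega>. (?Y (X 0 \<omega>))\<^sup>2)\<bar> \<le> 5 * \<epsilon> * t + 5 * C * (1 / real n)"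
    by (rule approximate_eigenfunction[OF _ _ t sq]) (use l C origin_mass_bounds in auto)
  then have 2: "\<bar>expectation (\<lambda>\<omega>. (?Y (X t \<omega>))\<^sup>2) - exp (- (2 * l) * t) * expectation (\<lambda>\<omega>. (?Y (X 0 \<omega>))\<^sup>2)\<bar> \<le> 5 * A"
    by (simp add: A_def algebra_simps)
  have ex: "expectation (\<lambda>\<omega>. (?Y (X s \<omega>) - r)\<^sup>2) = expectation (\<lambda>\<omega>. (?Y (X s \<omega>))\<^sup>2) - 2 * r * expectation (\<lambda>\<omega>. ?Y (X s \<omega>)) + r\<^sup>2"
    if "0 \<le> s" for s r
  proof -
    have "expectation (\<lambda>\<omega>. (?Y (X s \<omega>) - r)\<^sup>2) = expectation (\<lambda>\<omega>. ((?Y (X s \<omega>))\<^sup>2 - 2 * r * ?Y (X s \<omega>)) + r\<^sup>2)"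
      by (intro Bochner_Integration.integral_cong) (auto simp: power2_diff)
    also have "\<dots> = expectation (\<lambda>\<omega>. (?Y (X s \<omega>))\<^sup>2) - 2 * r * expectation (\<lambda>\<omega>. ?Y (X s \<omega>)) + r\<^sup>2"
      using f_X_integrable[OF that, of ?Y] f_X_integrable[OF that, of "\<lambda>\<eta>. (?Y \<eta>)\<^sup>2"]
      by (simp add: prob_space)
    finally show ?thesis .
  qed
  define e where "e = exp (- l * t)"
  have e: "0 < e" "e \<le> 1" "exp (- (2 * l) * t) = e\<^sup>2"
    using l t by (auto simp: e_def power2_eq_square simp flip: exp_add)
  define y where "y = expectation (\<lambda>\<omega>. ?Y (X 0 \<omega>))"
  define z where "z = expectation (\<lambda>\<omega>. (?Y (X 0 \<omega>))\<^sup>2)"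
  have A0: "0 \<le> A" using 1 abs_ge_zero order_trans by blast
  have "\<bar>2 * (e * c) * (expectation (\<lambda>\<omega>. ?Y (X t \<omega>)) - e * y)\<bar> \<le> 2 * \<bar>c\<bar> * A"
  proof -
    have "\<bar>2 * (e * c)\<bar> \<le> 2 * \<bar>c\<bar>" using e mult_right_mono[of e 1 "\<bar>c\<bar>"] by (simp add: abs_mult)
    then show ?thesis unfolding abs_mult[of "2 * (e * c)"] using 1 by (intro mult_mono) (auto simp: e_def y_def)
  qed
  \<comment> \<open>The mean square at time t is e^2 times the initial one up to two errors: 5 A
    from the second moment and 2 |c| A from the first. Hence the factor 5 + 2 |c|.\<close>
  moreover have "expectation (\<lambda>\<omega>. (?Y (X t \<omega>) - e * c)\<^sup>2)
      = (expectation (\<lambda>\<omega>. (?Y (X t \<omega>))\<^sup>2) - e\<^sup>2 * z) - 2 * (e * c) * (expectation (\<lambda>\<omega>. ?Y (X t \<omega>)) - e * y)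
        + e\<^sup>2 * (z - 2 * c * y + c\<^sup>2)"
    unfolding ex[OF t] by (simp add: algebra_simps power2_eq_square)
  moreover have "expectation (\<lambda>\<omega>. (?Y (X t \<omega>))\<^sup>2) - e\<^sup>2 * z \<le> 5 * A"
    using 2 unfolding e(3) z_def by linarith
  moreover have "e\<^sup>2 * (z - 2 * c * y + c\<^sup>2) \<le> expectation (\<lambda>\<omega>. (?Y (X 0 \<omega>) - c)\<^sup>2)"
  proof -
    have "z - 2 * c * y + c\<^sup>2 = expectation (\<lambda>\<omega>. (?Y (X 0 \<omega>) - c)\<^sup>2)"
      using ex[of 0 c] by (simp add: z_def y_def)
    moreover have "0 \<le> expectation (\<lambda>\<omega>. (?Y (X 0 \<omega>) - c)\<^sup>2)" by simp
    moreover have "e\<^sup>2 \<le> 1" using e power_le_one[of e 2] by simp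
    ultimately show ?thesis using mult_right_mono[of "e\<^sup>2" 1] by simp
  qed
  ultimately show ?thesis
    unfolding e_def[symmetric] A_def[symmetric] by (simp add: algebra_simps)
qed

end

section \<open>Discrete Laplacians and the two mean-square estimates\<close>

lemma abs_cos_diff_le: "\<bar>cos x - cos y\<bar> \<le> \<bar>x - y :: real\<bar>"
proof -
  have "\<bar>cos x - cos y\<bar> = 2 * (\<bar>sin ((x + y) / 2)\<bar> * \<bar>sin ((y - x) / 2)\<bar>)"
    by (simp add: cos_diff_cos abs_mult)
  also have "\<dots> \<le> 2 * (1 * \<bar>(y - x) / 2\<bar>)"
    by (intro mult_left_mono mult_mono abs_sin_x_le_abs_x abs_sin_le_one) auto
  finally show ?thesis by simp
qed

lemma one_minus_cos_le: "2 - 2 * cos x \<le> x\<^sup>2" for x :: real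
proof -
  have "2 - 2 * cos x = 4 * (sin (x / 2))\<^sup>2"
    using cos_double_sin[of "x / 2"] by simp
  also have "\<dots> \<le> 4 * (x / 2)\<^sup>2"
    using abs_sin_x_le_abs_x[of "x / 2"] abs_le_square_iff[of "sin (x / 2)" "x / 2"] by simp
  finally show ?thesis by (simp add: power2_eq_square)
qed

text \<open>Cosines of any phase are exact eigenvectors of the second difference: no Taylor
  remainder enters the drift, and only the eigenvalues have to converge.\<close>

lemma cos_second_difference: "m * cos (x + h) + m * cos (x - h) = 2 * cos h * (m * cos x)" for m :: real
  by (simp add: cos_add cos_diff algebra_simps)

context slow_ssep
begin

lemma sum_sites: "(\<Sum>i<n. h i) = h 0 + (\<Sum>i\<in>{1..<n - 1}. h i) + (h (n - 1) :: real)"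
proof -
  have "{..<n} = insert 0 (insert (n - 1) {1..<n - 1})" using n_ge by auto
  then show ?thesis using n_ge by simp
qed

lemma nxt_simps: "nxt 0 = 1" "i < n - 1 \<Longrightarrow> nxt i = i + 1" "nxt (n - 1) = 0"
  using n_ge by auto

lemma nxt_last: "i < n \<Longrightarrow> \<not> i < n - 1 \<Longrightarrow> nxt i = 0"
  using nxt_simps(3) by (metis One_nat_def Suc_pred' gr_implies_not0 less_antisym not_gr_zero)

text \<open>Jumps into the origin start at ordinary sites and have rate 1; the rate g of jumps out
  of it is kept as a separate factor.\<close>

definition "inflow \<eta> = (1 - occ \<eta> 0) * (occ \<eta> 1 + occ \<eta> (n - 1))"
definition "outflow \<eta> = occ \<eta> 0 * ((1 - occ \<eta> 1) + (1 - occ \<eta> (n - 1)))"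

lemma flow_bounds: "0 \<le> inflow \<eta>" "0 \<le> outflow \<eta>" "outflow \<eta> \<le> 2"
  by (auto simp: inflow_def outflow_def of_bool_def)

lemma gen_origin_mass: "gen origin_mass \<eta> = real n * (inflow \<eta> - g * outflow \<eta>)"
proof -
  let ?a = "\<lambda>x. of_bool (x = 0) :: real"
  have "(\<Sum>i<n. (?a (nxt i) - ?a i) * flux i \<eta>) = - flux 0 \<eta> + flux (n - 1) \<eta>"
  proof -
    have "(\<Sum>i\<in>{1..<n - 1}. (?a (nxt i) - ?a i) * flux i \<eta>) = 0"
    proof (intro sum.neutral ballI)
      fix i assume i: "i \<in> {1..<n - 1}"
      then have "nxt i = i + 1" by (intro nxt_simps(2)) simp
      then show "(?a (nxt i) - ?a i) * flux i \<eta> = 0" using i by simp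
    qed
    then show ?thesis using n_ge by (subst sum_sites) (simp only: nxt_simps, simp)
  qed
  also have "\<dots> = inflow \<eta> - g * outflow \<eta>"
    using n_ge by (simp add: flux_def rate_def site_rate_def inflow_def outflow_def nxt_simps algebra_simps)
  finally show ?thesis unfolding origin_mass_def gen_empirical by simp
qed

text \<open>The total exchange exceeds the net one, which is \<open>gen origin_mass\<close>, by
  twice the outflow term; as \<open>outflow\<close> is at most 2, this is at most 4 n g. The net
  part is harmless after integration in time.\<close>

lemma exchange_le: "real n * (inflow \<eta> + g * outflow \<eta>) \<le> gen origin_mass \<eta> + 4 * (real n * g)"
proof -
  have "real n * (g * outflow \<eta>) \<le> real n * (g * 2)"
    using flow_bounds[of \<eta>] g_nonneg by (intro mult_left_mono) auto
  then show ?thesis unfolding gen_origin_mass by (simp add: algebra_simps)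
qed

text \<open>Summation by parts on the cycle. Taking \<open>b\<close> on the real line with period n
  makes the bond that closes the cycle look like all others.\<close>

lemma periodic_laplacian:
  fixes b :: "real \<Rightarrow> real"
  assumes per: "\<And>u. b (u + real n) = b u" and lap: "\<And>u. b (u + 1) + b (u - 1) = \<kappa> * b u"
  shows "(\<Sum>i<n. (b (real (nxt i)) - b (real i)) * (occ \<eta> i - occ \<eta> (nxt i))) = (\<kappa> - 2) * (\<Sum>i<n. b (real i) * occ \<eta> i)"
proof -
  have bn: "b (real (nxt i) + r) = b (real i + 1 + r)" if "i < n" for i r
  proof (cases "i < n - 1")
    case True
    then show ?thesis by (simp only: nxt_simps) (simp add: algebra_simps)
  next
    case False
    then have "real i + 1 + r = r + real n" "nxt i = 0" using that n_ge nxt_last[OF that] by auto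
    then show ?thesis using per[of r] by (simp only:) simp
  qed
  have "(\<Sum>i<n. (b (real (nxt i)) - b (real (nxt i) - 1)) * occ \<eta> (nxt i)) = (\<Sum>j<n. (b (real j) - b (real j - 1)) * occ \<eta> j)"
    using sum.reindex_bij_betw[OF next_site_bij, of n "\<lambda>j. (b (real j) - b (real j - 1)) * occ \<eta> j"] n_ge by simp
  moreover have "(\<Sum>i<n. (b (real (nxt i)) - b (real i)) * (occ \<eta> i - occ \<eta> (nxt i)))
     = (\<Sum>i<n. (b (real i + 1) - b (real i)) * occ \<eta> i - (b (real (nxt i)) - b (real (nxt i) - 1)) * occ \<eta> (nxt i))"
  proof (rule sum.cong[OF refl])
    fix i assume "i \<in> {..<n}"
    then have "i < n" by simp
    then show "(b (real (nxt i)) - b (real i)) * (occ \<eta> i - occ \<eta> (nxt i))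
      = (b (real i + 1) - b (real i)) * occ \<eta> i - (b (real (nxt i)) - b (real (nxt i) - 1)) * occ \<eta> (nxt i)"
      using bn[of i 0] bn[of i "-1"] by (simp add: algebra_simps)
  qed
  ultimately have "(\<Sum>i<n. (b (real (nxt i)) - b (real i)) * (occ \<eta> i - occ \<eta> (nxt i)))
     = (\<Sum>i<n. (b (real i + 1) - b (real i)) * occ \<eta> i - (b (real i) - b (real i - 1)) * occ \<eta> i)"
    by (simp only: sum_subtractf)
  also have "\<dots> = (\<Sum>i<n. (\<kappa> - 2) * (b (real i) * occ \<eta> i))"
  proof (rule sum.cong[OF refl])
    fix i
    have "(b (real i + 1) + b (real i - 1) - 2 * b (real i)) * occ \<eta> i = (\<kappa> - 2) * (b (real i) * occ \<eta> i)"
      unfolding lap by (simp add: algebra_simps)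
    then show "(b (real i + 1) - b (real i)) * occ \<eta> i - (b (real i) - b (real i - 1)) * occ \<eta> i = (\<kappa> - 2) * (b (real i) * occ \<eta> i)"
      by (simp add: algebra_simps)
  qed
  finally show ?thesis by (simp only: sum_distrib_left)
qed

text \<open>At rate 1 the flux is a discrete gradient. Each of the two bonds at the origin deviates
  by at most |g - 1|, weighted by n times an increment of at most 2 |w| / n. The noise is n squared
  increments times an activity of at most 2 (1 + g). No correction by the mass at the origin is
  needed, so C = 0.\<close>

lemma periodic_second_moment:
  fixes w p m c t :: real
  assumes per: "\<And>x. cos (w + x) = cos x" and m: "0 \<le> m" "m \<le> 2" and t: "0 \<le> t"
  defines "a \<equiv> \<lambda>i. m * cos (w * (real i / real n) + p)"
  shows "expectation (\<lambda>\<omega>. (empirical n a (X t \<omega>) - exp (- ((real n)\<^sup>2 * (2 - 2 * cos (w / real n))) * t) * c)\<^sup>2)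
    \<le> expectation (\<lambda>\<omega>. (empirical n a (X 0 \<omega>) - c)\<^sup>2)
      + (5 + 2 * \<bar>c\<bar>) * ((4 * \<bar>w\<bar> * \<bar>g - 1\<bar> + 8 * w\<^sup>2 * (1 + g) / real n) * t)"
proof -
  have n0: "0 < real n" using n_ge by simp
  define b where "b u = m * cos (w * (u / real n) + p)" for u
  have ab: "a i = b (real i)" for i by (simp add: a_def b_def)
  have b_per: "b (u + real n) = b u" for u
  proof -
    have "w * ((u + real n) / real n) + p = w + (w * (u / real n) + p)" using n0 by (simp add: field_simps)
    then show ?thesis unfolding b_def by (simp only: per)
  qed
  have b_lap: "b (u + 1) + b (u - 1) = (2 * cos (w / real n)) * b u" for u
  proof -
    have "w * ((u + 1) / real n) + p = (w * (u / real n) + p) + w / real n"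
      "w * ((u - 1) / real n) + p = (w * (u / real n) + p) - w / real n"
      by (simp_all add: add_divide_distrib diff_divide_distrib distrib_left right_diff_distrib)
    then show ?thesis unfolding b_def by (simp only: cos_second_difference)
  qed
  have step: "\<bar>a (nxt i) - a i\<bar> \<le> 2 * \<bar>w\<bar> / real n" if "i < n" for i
  proof -
    have "a (nxt i) = b (real i + 1)"
    proof (cases "i < n - 1")
      case True
      then show ?thesis unfolding ab by (simp only: nxt_simps) (simp add: add.commute)
    next
      case False
      then have "real i + 1 = 0 + real n" "nxt i = 0" using that n_ge nxt_last[OF that] by auto
      then show ?thesis unfolding ab by (simp only: b_per) simp
    qed
    then have "\<bar>a (nxt i) - a i\<bar> = \<bar>b (real i + 1) - b (real i)\<bar>" by (simp only: ab)
    also have "\<dots> = m * \<bar>cos (w * ((real i + 1) / real n) + p) - cos (w * (real i / real n) + p)\<bar>"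
      using m by (simp add: b_def right_diff_distrib[symmetric] abs_mult)
    also have "\<dots> \<le> 2 * \<bar>(w * ((real i + 1) / real n) + p) - (w * (real i / real n) + p)\<bar>"
      using m by (intro mult_mono abs_cos_diff_le) auto
    also have "(w * ((real i + 1) / real n) + p) - (w * (real i / real n) + p) = w / real n"
      using n0 by (simp add: field_simps)
    finally show ?thesis using n0 by (simp add: abs_divide)
  qed
  define l where "l = (real n)\<^sup>2 * (2 - 2 * cos (w / real n))"
  let ?e1 = "4 * \<bar>w\<bar> * \<bar>g - 1\<bar>" and ?e2 = "8 * w\<^sup>2 * (1 + g) / real n"
  have e: "0 \<le> ?e1" "0 \<le> ?e2" using g_nonneg n0 by auto
  have "expectation (\<lambda>\<omega>. (empirical n a (X t \<omega>) - exp (- l * t) * c)\<^sup>2)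
    \<le> expectation (\<lambda>\<omega>. (empirical n a (X 0 \<omega>) - c)\<^sup>2) + (5 + 2 * \<bar>c\<bar>) * ((?e1 + ?e2) * t + 0 / real n)"
  proof (rule empirical_second_moment[OF _ _ _ t])
    show "\<bar>a x\<bar> \<le> 2" for x
      using m mult_mono[of m 2 "\<bar>cos (w * (real x / real n) + p)\<bar>" 1] by (simp add: a_def abs_mult)
    show "0 \<le> l" unfolding l_def using cos_le_one[of "w / real n"] by (intro mult_nonneg_nonneg) auto
    show "0 \<le> (0::real)" by simp
    fix \<eta>
    define r where "r i = flux i \<eta> - (occ \<eta> i - occ \<eta> (nxt i))" for i
    have r: "\<bar>r 0\<bar> \<le> \<bar>g - 1\<bar>" "\<bar>r (n - 1)\<bar> \<le> \<bar>g - 1\<bar>"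
      using n_ge by (auto simp: r_def flux_def rate_def site_rate_def nxt_simps of_bool_def)
    have r_bulk: "r i = 0" if i: "i \<in> {1..<n - 1}" for i
    proof -
      have nx: "nxt i = i + 1" using i by (intro nxt_simps(2)) simp
      show ?thesis unfolding r_def flux_def rate_def site_rate_def nx using i by (auto simp: of_bool_def)
    qed
    have dr: "\<bar>(a (nxt i) - a i) * r i\<bar> \<le> 2 * \<bar>w\<bar> / real n * \<bar>r i\<bar>" if "i < n" for i
      unfolding abs_mult by (intro mult_right_mono step that) auto
    have "\<bar>\<Sum>i<n. (a (nxt i) - a i) * r i\<bar> \<le> (\<Sum>i<n. 2 * \<bar>w\<bar> / real n * \<bar>r i\<bar>)"
      using dr by (intro order_trans[OF sum_abs sum_mono]) auto
    also have "\<dots> = 2 * \<bar>w\<bar> / real n * (\<bar>r 0\<bar> + \<bar>r (n - 1)\<bar>)"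
      unfolding sum_distrib_left[symmetric] by (subst sum_sites) (simp add: r_bulk)
    also have "\<dots> \<le> 2 * \<bar>w\<bar> / real n * (\<bar>g - 1\<bar> + \<bar>g - 1\<bar>)"
      using r(1,2) n0 by (intro mult_left_mono add_mono) auto
    finally have R: "\<bar>\<Sum>i<n. (a (nxt i) - a i) * r i\<bar> \<le> 2 * \<bar>w\<bar> / real n * (\<bar>g - 1\<bar> + \<bar>g - 1\<bar>)" .
    have "gen (empirical n a) \<eta> = real n * ((\<Sum>i<n. (a (nxt i) - a i) * (occ \<eta> i - occ \<eta> (nxt i))) + (\<Sum>i<n. (a (nxt i) - a i) * r i))"
      unfolding gen_empirical r_def sum.distrib[symmetric] by (simp add: algebra_simps)
    also have "(\<Sum>i<n. (a (nxt i) - a i) * (occ \<eta> i - occ \<eta> (nxt i))) = (2 * cos (w / real n) - 2) * (\<Sum>i<n. a i * occ \<eta> i)"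
      unfolding ab by (rule periodic_laplacian[OF b_per b_lap])
    also have "(\<Sum>i<n. a i * occ \<eta> i) = real n * empirical n a \<eta>" using n0 by (simp add: empirical_def)
    finally have "gen (empirical n a) \<eta> + l * empirical n a \<eta> = real n * (\<Sum>i<n. (a (nxt i) - a i) * r i)"
      by (simp add: l_def algebra_simps power2_eq_square)
    also have "\<bar>\<dots>\<bar> \<le> real n * (2 * \<bar>w\<bar> / real n * (\<bar>g - 1\<bar> + \<bar>g - 1\<bar>))"
      unfolding abs_mult using R by (intro mult_mono) auto
    also have "\<dots> = ?e1" using n0 by (simp add: field_simps)
    finally show "\<bar>gen (empirical n a) \<eta> + l * empirical n a \<eta>\<bar> \<le> ?e1 + ?e2 + 0 * gen origin_mass \<eta>"
      using e by linarith
    have "(\<Sum>i<n. (a (nxt i) - a i)\<^sup>2 * activity i \<eta>) \<le> (\<Sum>i<n. (2 * \<bar>w\<bar> / real n)\<^sup>2 * (2 * (1 + g)))"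
    proof (rule sum_mono)
      fix i assume "i \<in> {..<n}"
      then have "(a (nxt i) - a i)\<^sup>2 \<le> (2 * \<bar>w\<bar> / real n)\<^sup>2"
        using step[of i] n0 by (simp add: abs_le_square_iff[symmetric] abs_divide)
      then show "(a (nxt i) - a i)\<^sup>2 * activity i \<eta> \<le> (2 * \<bar>w\<bar> / real n)\<^sup>2 * (2 * (1 + g))"
        using rate_bounds[of i "nxt i" \<eta>] rate_bounds[of "nxt i" i \<eta>] unfolding activity_def by (intro mult_mono) auto
    qed
    also have "\<dots> = ?e2" using n0 by (simp add: field_simps power2_eq_square)
    finally show "(\<Sum>i<n. (a (nxt i) - a i)\<^sup>2 * activity i \<eta>) \<le> ?e1 + ?e2 + 0 * gen origin_mass \<eta>"
      using e by linarith
  qed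
  then show ?thesis by (simp add: l_def)
qed

text \<open>Summation by parts on the segment 1, ..., n - 1; the two reflection conditions
  annihilate its boundary terms.\<close>

lemma neumann_laplacian:
  fixes b :: "real \<Rightarrow> real"
  assumes refl: "b 0 = b 1" "b (real n) = b (real n - 1)" and lap: "\<And>u. b (u + 1) + b (u - 1) = \<kappa> * b u"
  shows "(\<Sum>i\<in>{1..<n - 1}. (b (real i + 1) - b (real i)) * (occ \<eta> i - occ \<eta> (i + 1)))
    = (\<kappa> - 2) * (\<Sum>i\<in>{1..<n}. b (real i) * occ \<eta> i)"
proof -
  have 1: "(\<Sum>i\<in>{1..<n - 1}. (b (real i + 1) - b (real i)) * occ \<eta> i) = (\<Sum>i\<in>{1..<n}. (b (real i + 1) - b (real i)) * occ \<eta> i)"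
  proof -
    have "{1..<n} = insert (n - 1) {1..<n - 1}" using n_ge by auto
    moreover have "real (n - 1) + 1 = real n" "real (n - 1) = real n - 1" using n_ge by auto
    ultimately show ?thesis using refl(2) by (simp del: sum_mult_of_bool_eq)
  qed
  have 2: "(\<Sum>i\<in>{1..<n - 1}. (b (real i + 1) - b (real i)) * occ \<eta> (i + 1)) = (\<Sum>i\<in>{1..<n}. (b (real i) - b (real i - 1)) * occ \<eta> i)"
  proof -
    have "(\<Sum>i\<in>{1..<n}. (b (real i) - b (real i - 1)) * occ \<eta> i) = (\<Sum>i\<in>{2..<n}. (b (real i) - b (real i - 1)) * occ \<eta> i)"
    proof -
      have "{1..<n} = insert 1 {2..<n}" using n_ge by auto
      then show ?thesis using refl(1) by (simp del: sum_mult_of_bool_eq)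
    qed
    also have "\<dots> = (\<Sum>i\<in>{1..<n - 1}. (b (real (i + 1)) - b (real (i + 1) - 1)) * occ \<eta> (i + 1))"
      by (rule sum.reindex_bij_witness[of _ "\<lambda>i. i + 1" "\<lambda>i. i - 1"]) auto
    finally show ?thesis by (simp add: add.commute)
  qed
  have "(\<Sum>i\<in>{1..<n - 1}. (b (real i + 1) - b (real i)) * (occ \<eta> i - occ \<eta> (i + 1)))
    = (\<Sum>i\<in>{1..<n}. (b (real i + 1) - b (real i)) * occ \<eta> i - (b (real i) - b (real i - 1)) * occ \<eta> i)"
    unfolding right_diff_distrib sum_subtractf 1 2 ..
  also have "\<dots> = (\<Sum>i\<in>{1..<n}. (\<kappa> - 2) * (b (real i) * occ \<eta> i))"
  proof (rule sum.cong[OF HOL.refl])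
    fix i
    have "(b (real i + 1) + b (real i - 1) - 2 * b (real i)) * occ \<eta> i = (\<kappa> - 2) * (b (real i) * occ \<eta> i)"
      unfolding lap by (simp add: algebra_simps)
    then show "(b (real i + 1) - b (real i)) * occ \<eta> i - (b (real i) - b (real i - 1)) * occ \<eta> i = (\<kappa> - 2) * (b (real i) * occ \<eta> i)"
      by (simp add: algebra_simps)
  qed
  finally show ?thesis by (simp only: sum_distrib_left)
qed

text \<open>The vector \<open>a\<close> is an eigenvector of the Laplacian of the segment \<open>1, \<dots>, n - 1\<close> with reflecting ends;
  it takes the same value at 0 and at 1, so jumps between these two sites do not change the observable.\<close>

lemma neumann_second_moment:
  fixes m c t :: real and k :: nat
  assumes m: "0 \<le> m" "m \<le> 2" and t: "0 \<le> t"
  defines "w \<equiv> pi * real k"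
  defines "\<theta> \<equiv> w / (real n - 1)"
  defines "a \<equiv> \<lambda>i. m * cos (\<theta> * (real i - 1 / 2))"
  shows "expectation (\<lambda>\<omega>. (empirical n a (X t \<omega>) - exp (- ((real n)\<^sup>2 * (2 - 2 * cos \<theta>)) * t) * c)\<^sup>2)
    \<le> expectation (\<lambda>\<omega>. (empirical n a (X 0 \<omega>) - c)\<^sup>2)
      + (5 + 2 * \<bar>c\<bar>) * ((16 * w\<^sup>2 / real n + 64 * (real n * g)) * t + 16 / real n)"
proof -
  have n0: "0 < real n" "2 \<le> real n - 1" using n_ge by auto
  have w0: "0 \<le> w" by (simp add: w_def)
  have th0: "0 \<le> \<theta>" using w0 n0 by (simp add: \<theta>_def)
  have th: "\<theta> \<le> 2 * w / real n"
    using w0 n0 mult_left_mono[of 2 "real n" w] by (simp add: \<theta>_def field_simps)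
  define b where "b u = m * cos (\<theta> * (u - 1 / 2))" for u
  have ab: "a i = b (real i)" for i by (simp add: a_def b_def)
  \<comment> \<open>The half-step shift makes \<open>b\<close> even about 1/2, and \<theta> = pi k /
    (n - 1) makes it even about n - 1/2: these are the reflection conditions at the two
    ends.\<close>
  have b01: "b 0 = b 1" using cos_minus[of "\<theta> / 2"] by (simp add: b_def)
  have bn: "b (real n) = b (real n - 1)"
  proof -
    have tn: "\<theta> * (real n - 1) = w" using n0 by (simp add: \<theta>_def)
    have s: "sin w = 0" using sin_npi2[of k] by (simp add: w_def)
    have "\<theta> * (real n - 1 / 2) = w + \<theta> / 2" "\<theta> * (real n - 1 - 1 / 2) = w - \<theta> / 2"
      unfolding tn[symmetric] by (simp_all add: algebra_simps)
    then show ?thesis unfolding b_def by (simp only: cos_add cos_diff s) simp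
  qed
  have b_lap: "b (u + 1) + b (u - 1) = (2 * cos \<theta>) * b u" for u
    using cos_second_difference[of m "\<theta> * (u - 1 / 2)" "\<theta>"] by (simp add: b_def algebra_simps)
  have bb: "\<bar>b u\<bar> \<le> 2" for u
    using m mult_mono[of m 2 "\<bar>cos (\<theta> * (u - 1 / 2))\<bar>" 1] by (simp add: b_def abs_mult)
  have step: "\<bar>b (u + 1) - b u\<bar> \<le> 4 * w / real n" for u
  proof -
    have "\<bar>b (u + 1) - b u\<bar> = m * \<bar>cos (\<theta> * (u + 1 - 1 / 2)) - cos (\<theta> * (u - 1 / 2))\<bar>"
      using m by (simp add: b_def right_diff_distrib[symmetric] abs_mult)
    also have "\<dots> \<le> 2 * \<bar>\<theta> * (u + 1 - 1 / 2) - \<theta> * (u - 1 / 2)\<bar>"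
      using m by (intro mult_mono abs_cos_diff_le) auto
    also have "\<theta> * (u + 1 - 1 / 2) - \<theta> * (u - 1 / 2) = \<theta>" by (simp add: algebra_simps)
    finally show ?thesis using th th0 by simp
  qed
  define l where "l = (real n)\<^sup>2 * (2 - 2 * cos \<theta>)"
  have l0: "0 \<le> l" unfolding l_def using cos_le_one[of \<theta>] by (intro mult_nonneg_nonneg) auto
  have l_le: "l \<le> 4 * w\<^sup>2"
  proof -
    have "l \<le> (real n)\<^sup>2 * \<theta>\<^sup>2" unfolding l_def by (intro mult_left_mono one_minus_cos_le) auto
    also have "\<dots> \<le> (real n)\<^sup>2 * (2 * w / real n)\<^sup>2" using th th0 by (intro mult_left_mono power_mono) auto
    also have "\<dots> = 4 * w\<^sup>2" using n0 by (simp add: field_simps power2_eq_square)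
    finally show ?thesis .
  qed
  \<comment> \<open>One bound for drift and noise: the noise is at most 16 w^2 / n + 16 S, the drift
    at most 8 w^2 / n + 4 S, and \<open>exchange_le\<close> turns 16 S into 16
    \<open>gen origin_mass\<close> plus 64 n g.\<close>
  let ?\<epsilon> = "16 * w\<^sup>2 / real n + 64 * (real n * g)"
  have "expectation (\<lambda>\<omega>. (empirical n a (X t \<omega>) - exp (- l * t) * c)\<^sup>2)
    \<le> expectation (\<lambda>\<omega>. (empirical n a (X 0 \<omega>) - c)\<^sup>2) + (5 + 2 * \<bar>c\<bar>) * (?\<epsilon> * t + 16 / real n)"
  proof (rule empirical_second_moment[OF _ l0 _ t])
    show "\<bar>a x\<bar> \<le> 2" for x unfolding ab by (rule bb)
    show "0 \<le> (16::real)" by simp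
    fix \<eta>
    define S where "S = real n * (inflow \<eta> + g * outflow \<eta>)"
    have S0: "0 \<le> S" unfolding S_def using flow_bounds[of \<eta>] g_nonneg by (intro mult_nonneg_nonneg add_nonneg_nonneg) auto
    have S_le: "S \<le> gen origin_mass \<eta> + 4 * (real n * g)" unfolding S_def by (rule exchange_le)
    have d0: "a (nxt 0) - a 0 = 0" using b01 unfolding ab nxt_simps by simp
    \<comment> \<open>Across the bond from n - 1 to 0 the bound on the jump of the observable does
      not shrink with n. The factor n in the drift is absorbed by \<open>S\<close> instead.\<close>
    have dn: "\<bar>a (nxt (n - 1)) - a (n - 1)\<bar> \<le> 4" unfolding ab using bb[of "real (nxt (n - 1))"] bb[of "real (n - 1)"] by linarith
    have act: "\<bar>flux (n - 1) \<eta>\<bar> \<le> activity (n - 1) \<eta>" "0 \<le> activity (n - 1) \<eta>"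
      unfolding flux_def activity_def using rate_bounds(1)[of "n - 1" "nxt (n - 1)" \<eta>] rate_bounds(1)[of "nxt (n - 1)" "n - 1" \<eta>] by linarith+
    have act_le: "real n * activity (n - 1) \<eta> \<le> S"
    proof -
      have "activity (n - 1) \<eta> \<le> inflow \<eta> + g * outflow \<eta>"
        using n_ge g_nonneg by (simp add: activity_def rate_def site_rate_def inflow_def outflow_def nxt_simps of_bool_def)
      then show ?thesis unfolding S_def by (intro mult_left_mono) auto
    qed
    have act_S: "activity (n - 1) \<eta> \<le> S"
      using act_le mult_right_mono[of 1 "real n" "activity (n - 1) \<eta>"] act(2) n_ge by simp
    have flux_bulk: "flux i \<eta> = occ \<eta> i - occ \<eta> (i + 1)" "activity i \<eta> \<le> 1" "0 \<le> activity i \<eta>" "a (nxt i) - a i = b (real i + 1) - b (real i)"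
      if "i \<in> {1..<n - 1}" for i
    proof -
      have nx: "nxt i = i + 1" using that by (intro nxt_simps(2)) simp
      show "flux i \<eta> = occ \<eta> i - occ \<eta> (i + 1)" "activity i \<eta> \<le> 1" "0 \<le> activity i \<eta>" "a (nxt i) - a i = b (real i + 1) - b (real i)"
        unfolding flux_def activity_def nx rate_def site_rate_def ab
        using that by (auto simp: of_bool_def add.commute)
    qed
    have "gen (empirical n a) \<eta> = real n * ((\<Sum>i\<in>{1..<n - 1}. (a (nxt i) - a i) * flux i \<eta>) + (a (nxt (n - 1)) - a (n - 1)) * flux (n - 1) \<eta>)"
      unfolding gen_empirical using d0 by (subst sum_sites) simp
    also have "(\<Sum>i\<in>{1..<n - 1}. (a (nxt i) - a i) * flux i \<eta>) = (\<Sum>i\<in>{1..<n - 1}. (b (real i + 1) - b (real i)) * (occ \<eta> i - occ \<eta> (i + 1)))"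
      by (intro sum.cong HOL.refl) (simp only: flux_bulk)
    also have "\<dots> = (2 * cos \<theta> - 2) * (\<Sum>i\<in>{1..<n}. b (real i) * occ \<eta> i)"
      by (rule neumann_laplacian[OF b01 bn b_lap])
    \<comment> \<open>The origin lies outside the segment; completing the sum to all sites costs at
      most l |b 0| / n \<le> 8 w^2 / n.\<close>
    also have "(\<Sum>i\<in>{1..<n}. b (real i) * occ \<eta> i) = real n * empirical n a \<eta> - b 0 * occ \<eta> 0"
    proof -
      have "{..<n} = insert 0 {1..<n}" using n_ge by auto
      then show ?thesis using n0 by (simp add: empirical_def ab)
    qed
    finally have G0: "gen (empirical n a) \<eta> = real n * ((2 * cos \<theta> - 2) * (real n * empirical n a \<eta> - b 0 * occ \<eta> 0)
        + (a (nxt (n - 1)) - a (n - 1)) * flux (n - 1) \<eta>)" .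
    have G: "gen (empirical n a) \<eta> + l * empirical n a \<eta>
        = l / real n * (b 0 * occ \<eta> 0) + (a (nxt (n - 1)) - a (n - 1)) * (real n * flux (n - 1) \<eta>)"
    proof -
      have nz: "real n \<noteq> 0" using n0 by simp
      have key: "N * ((2 * c - 2) * (N * Y - B) + d * f) + (N\<^sup>2 * (2 - 2 * c)) * Y = N\<^sup>2 * (2 - 2 * c) / N * B + d * (N * f)"
        if "N \<noteq> 0" for N c Y B d f :: real
        using that by (simp add: field_simps power2_eq_square)
      show ?thesis unfolding G0 l_def by (rule key[OF nz])
    qed
    have "\<bar>l / real n * (b 0 * occ \<eta> 0)\<bar> \<le> 4 * w\<^sup>2 / real n * 2"
      unfolding abs_mult using l0 l_le n0 bb[of 0] by (intro mult_mono divide_right_mono) (auto simp: of_bool_def abs_divide intro!: divide_right_mono)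
    moreover have "\<bar>(a (nxt (n - 1)) - a (n - 1)) * (real n * flux (n - 1) \<eta>)\<bar> \<le> 4 * S"
    proof -
      have "real n * \<bar>flux (n - 1) \<eta>\<bar> \<le> S" using act act_le mult_left_mono[OF act(1), of "real n"] by linarith
      then show ?thesis unfolding abs_mult using dn S0 by (intro mult_mono) auto
    qed
    ultimately have "\<bar>gen (empirical n a) \<eta> + l * empirical n a \<eta>\<bar> \<le> 8 * w\<^sup>2 / real n + 4 * S"
      unfolding G using abs_triangle_ineq[of "l / real n * (b 0 * occ \<eta> 0)" "(a (nxt (n - 1)) - a (n - 1)) * (real n * flux (n - 1) \<eta>)"]
      by linarith
    also have "\<dots> \<le> 16 * w\<^sup>2 / real n + 16 * S"
      using S0 n0 by (intro add_mono divide_right_mono) auto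
    finally show "\<bar>gen (empirical n a) \<eta> + l * empirical n a \<eta>\<bar> \<le> ?\<epsilon> + 16 * gen origin_mass \<eta>"
      using S_le by linarith
    have "(\<Sum>i<n. (a (nxt i) - a i)\<^sup>2 * activity i \<eta>)
       = (\<Sum>i\<in>{1..<n - 1}. (a (nxt i) - a i)\<^sup>2 * activity i \<eta>) + (a (nxt (n - 1)) - a (n - 1))\<^sup>2 * activity (n - 1) \<eta>"
      using d0 by (subst sum_sites) simp
    also have "(\<Sum>i\<in>{1..<n - 1}. (a (nxt i) - a i)\<^sup>2 * activity i \<eta>) \<le> (\<Sum>i\<in>{1..<n - 1}. (4 * w / real n)\<^sup>2 * 1)"
    proof (rule sum_mono)
      fix i assume i: "i \<in> {1..<n - 1}"
      have "(a (nxt i) - a i)\<^sup>2 \<le> (4 * w / real n)\<^sup>2"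
        unfolding flux_bulk(4)[OF i] using step[of "real i"] w0 n0 by (simp add: abs_le_square_iff[symmetric])
      then show "(a (nxt i) - a i)\<^sup>2 * activity i \<eta> \<le> (4 * w / real n)\<^sup>2 * 1"
        using flux_bulk(2,3)[OF i] by (intro mult_mono) auto
    qed
    also have "\<dots> \<le> real n * (4 * w / real n)\<^sup>2"
      by simp (intro mult_right_mono, auto)
    also have "\<dots> = 16 * w\<^sup>2 / real n" using n0 by (simp add: field_simps power2_eq_square)
    also have "(a (nxt (n - 1)) - a (n - 1))\<^sup>2 * activity (n - 1) \<eta> \<le> 16 * S"
    proof -
      have "(a (nxt (n - 1)) - a (n - 1))\<^sup>2 \<le> 4\<^sup>2" using dn by (intro abs_le_square_iff[THEN iffD1]) simp
      then show ?thesis using act_S act(2) by (intro mult_mono) auto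
    qed
    finally show "(\<Sum>i<n. (a (nxt i) - a i)\<^sup>2 * activity i \<eta>) \<le> ?\<epsilon> + 16 * gen origin_mass \<eta>"
      using S_le by simp
  qed
  then show ?thesis by (simp add: l_def)
qed

end

section \<open>Initial distribution and hydrodynamic limit\<close>

text \<open>The sums are integrals of step functions that converge wherever \<open>F\<close> is
  continuous; dominated convergence ignores the end points, so a jump of the profile at the origin
  does no harm.\<close>

lemma riemann_sum_tendsto:
  fixes F :: "real \<Rightarrow> real"
  assumes bd: "\<And>u. \<bar>F u\<bar> \<le> B" and cont: "\<And>u. 0 < u \<Longrightarrow> u < 1 \<Longrightarrow> isCont F u" and m: "F \<in> borel_measurable borel"
  shows "(\<lambda>n. 1 / real n * (\<Sum>x<n. F (real x / real n))) \<longlonglongrightarrow> (\<integral>u. F u \<partial>unit_measure)"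
proof -
  let ?I = "\<lambda>n x. {real x / real n..<(real x + 1) / real n}"
  define s where "s n u = (\<Sum>x<n. F (real x / real n) * indicator (?I n x) u)" for n u
  have s_eq: "s n u = F (real (nat \<lfloor>real n * u\<rfloor>) / real n)" if n: "1 \<le> n" and u: "0 \<le> u" "u < 1" for n u
  proof -
    have k: "nat \<lfloor>real n * u\<rfloor> < n"
    proof -
      have "real n * u < real n" using n u by simp
      then have "\<lfloor>real n * u\<rfloor> < int n" by (simp add: floor_less_iff)
      then show ?thesis using n by (simp add: nat_less_iff)
    qed
    have "indicator (?I n x) u = (if x = nat \<lfloor>real n * u\<rfloor> then 1 else 0 :: real)" for x
    proof -
      have "u \<in> ?I n x \<longleftrightarrow> real x \<le> real n * u \<and> real n * u < real x + 1"
        using n by (simp add: field_simps)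
      also have "\<dots> \<longleftrightarrow> \<lfloor>real n * u\<rfloor> = int x" by (simp add: floor_eq_iff)
      also have "\<dots> \<longleftrightarrow> x = nat \<lfloor>real n * u\<rfloor>" using u by auto
      finally show ?thesis by (simp add: indicator_def)
    qed
    then have "s n u = (\<Sum>x<n. if x = nat \<lfloor>real n * u\<rfloor> then F (real x / real n) else 0)"
      unfolding s_def by (intro sum.cong) auto
    then show ?thesis using k by simp
  qed
  have fm: "finite_measure unit_measure" by (rule finite_measure_lebesgue_on) auto
  have int_ind: "integrable unit_measure (indicator (?I n x) :: real \<Rightarrow> real)" for n x
  proof (rule finite_measure.integrable_const_bound[OF fm, of _ 1])
    show "AE u in unit_measure. norm (indicator (?I n x) u :: real) \<le> 1" by (intro AE_I2) (simp add: indicator_def)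
    show "(indicator (?I n x) :: real \<Rightarrow> real) \<in> borel_measurable unit_measure"
      by (intro measurable_restrict_space1 measurable_completion) simp
  qed
  have s_int: "(\<integral>u. s n u \<partial>unit_measure) = 1 / real n * (\<Sum>x<n. F (real x / real n))" if n: "1 \<le> n" for n
  proof -
    have "(\<integral>u. s n u \<partial>unit_measure) = (\<Sum>x<n. F (real x / real n) * measure unit_measure ({0..1} \<inter> ?I n x))"
      unfolding s_def using int_ind by (subst Bochner_Integration.integral_sum) (auto simp: Int_commute)
    also have "\<dots> = (\<Sum>x<n. F (real x / real n) * (1 / real n))"
    proof (rule sum.cong[OF refl])
      fix x assume x: "x \<in> {..<n}"
      have sub: "?I n x \<subseteq> {0..1}"
      proof
        fix v assume v: "v \<in> ?I n x"
        have "(real x + 1) / real n \<le> 1" using x n by simp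
        then show "v \<in> {0..1}" using v by (auto intro: order_trans[of _ "real x / real n"])
      qed
      then have "measure unit_measure ({0..1} \<inter> ?I n x) = measure lebesgue (?I n x)"
        by (subst measure_restrict_space) (auto simp: Int_absorb1)
      also have "\<dots> = 1 / real n"
      proof -
        have "real x / real n \<le> (real x + 1) / real n" by (simp add: divide_right_mono)
        from measure_lborel_Ico[OF this] show ?thesis by (simp add: diff_divide_distrib[symmetric])
      qed
      finally show "F (real x / real n) * measure unit_measure ({0..1} \<inter> ?I n x) = F (real x / real n) * (1 / real n)" by simp
    qed
    finally show ?thesis by (simp add: sum_divide_distrib)
  qed
  have "(\<lambda>n. \<integral>u. s n u \<partial>unit_measure) \<longlonglongrightarrow> (\<integral>u. F u \<partial>unit_measure)"
  \<comment> \<open>The index is shifted because the formula \<open>s_eq\<close> for the step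
    function needs n \<ge> 1.\<close>
  proof (rule LIMSEQ_offset[where k = 1], rule integral_dominated_convergence[where w = "\<lambda>_. B"])
    show "F \<in> borel_measurable unit_measure"
      using m by (intro measurable_restrict_space1 measurable_completion) simp
    show "s (n + 1) \<in> borel_measurable unit_measure" for n
    proof -
      have "s (n + 1) \<in> borel_measurable borel"
        unfolding s_def[abs_def]
        by (intro borel_measurable_sum borel_measurable_times borel_measurable_const borel_measurable_indicator) simp
      then show ?thesis by (intro measurable_restrict_space1 measurable_completion) simp
    qed
    show "integrable unit_measure (\<lambda>_. B)" by (rule finite_measure.integrable_const[OF fm])
    show "AE u in unit_measure. norm (s (n + 1) u) \<le> B" for n
      using AE_unit_open by eventually_elim (simp add: s_eq bd)
    show "AE u in unit_measure. (\<lambda>n. s (n + 1) u) \<longlonglongrightarrow> F u"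
      using AE_unit_open
    proof eventually_elim
      case (elim u)
      have lim0: "(\<lambda>n. real (nat \<lfloor>real n * u\<rfloor>) / real n) \<longlonglongrightarrow> u"
      proof (rule tendsto_sandwich[of "\<lambda>n. u - 1 / real n" _ _ "\<lambda>n. u"])
        show "\<forall>\<^sub>F n in sequentially. u - 1 / real n \<le> real (nat \<lfloor>real n * u\<rfloor>) / real n"
          using eventually_gt_at_top[of 0]
        proof eventually_elim
          case (elim n)
          have "real n * u - 1 \<le> real (nat \<lfloor>real n * u\<rfloor>)" by linarith
          then have "(real n * u - 1) / real n \<le> real (nat \<lfloor>real n * u\<rfloor>) / real n"
            by (intro divide_right_mono) auto
          then show ?case using elim by (simp add: diff_divide_distrib)
        qed
        show "\<forall>\<^sub>F n in sequentially. real (nat \<lfloor>real n * u\<rfloor>) / real n \<le> u"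
          using eventually_gt_at_top[of 0]
        proof eventually_elim
          case (elim n)
          have "real (nat \<lfloor>real n * u\<rfloor>) \<le> real n * u" using \<open>0 < u \<and> u < 1\<close> by simp
          then show ?case using elim by (simp add: field_simps)
        qed
        show "(\<lambda>n. u - 1 / real n) \<longlonglongrightarrow> u" by real_asymp
      qed simp
      have "isCont F u" using elim by (intro cont) auto
      from isCont_tendsto_compose[OF this lim0]
      have lim: "(\<lambda>n. F (real (nat \<lfloor>real n * u\<rfloor>) / real n)) \<longlonglongrightarrow> F u"
        .
      have "(\<lambda>n. F (real (nat \<lfloor>real (n + 1) * u\<rfloor>) / real (n + 1))) \<longlonglongrightarrow> F u"
        by (rule LIMSEQ_ignore_initial_segment[OF lim, of 1])
      moreover have "s (n + 1) u = F (real (nat \<lfloor>real (n + 1) * u\<rfloor>) / real (n + 1))" for n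
        by (rule s_eq) (use elim in auto)
      ultimately show ?case by (simp only:)
    qed
  qed
  moreover have "\<forall>\<^sub>F n in sequentially. (\<integral>u. s n u \<partial>unit_measure) = 1 / real n * (\<Sum>x<n. F (real x / real n))"
    using eventually_ge_at_top[of 1] by eventually_elim (rule s_int)
  ultimately show ?thesis by (rule Lim_transform_eventually)
qed

lemma bernoulli_product_moment:
  assumes g: "\<And>x. \<gamma> x \<in> {0..1}" and A: "A \<subseteq> {..<n}"
  shows "measure_pmf.expectation (bernoulli_product \<gamma> n) (\<lambda>\<eta>. \<Prod>x\<in>A. occ \<eta> x) = (\<Prod>x\<in>A. \<gamma> (real x / real n))"
proof -
  let ?f = "\<lambda>x v. if x \<in> A then of_bool v else 1 :: real"
  have ext: "(\<Prod>x<n. if x \<in> A then h x else 1) = (\<Prod>x\<in>A. h x)" for h :: "nat \<Rightarrow> real"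
    using A by (intro prod.mono_neutral_cong_right) auto
  have "measure_pmf.expectation (bernoulli_product \<gamma> n) (\<lambda>\<eta>. \<Prod>x<n. ?f x (\<eta> x))
     = (\<Prod>x<n. measure_pmf.expectation (bernoulli_pmf (\<gamma> (real x / real n))) (?f x))"
    unfolding bernoulli_product_def
    by (intro expectation_prod_Pi_pmf) (auto intro!: integrable_measure_pmf_finite)
  also have "\<dots> = (\<Prod>x<n. if x \<in> A then \<gamma> (real x / real n) else 1)"
    using g by (intro prod.cong) auto
  finally show ?thesis unfolding ext .
qed

lemma pmf_integrable_bounded: "(\<And>x. \<bar>f x :: real\<bar> \<le> B) \<Longrightarrow> integrable (measure_pmf p) f"
  by (rule measure_pmf.integrable_const_bound[of _ B]) auto

lemma pmf_expectation_combination: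
  fixes f g h :: "'a \<Rightarrow> real"
  assumes "integrable (measure_pmf p) f" "integrable (measure_pmf p) g" "integrable (measure_pmf p) h"
  shows "measure_pmf.expectation p (\<lambda>x. f x - b * g x - a * h x + d)
    = measure_pmf.expectation p f - b * measure_pmf.expectation p g - a * measure_pmf.expectation p h + d"
  using assms by simp

text \<open>Variance plus squared bias. Independence leaves the diagonal of the covariance, n terms
  of at most 4, before division by n^2.\<close>

lemma bernoulli_product_second_moment:
  assumes g: "\<And>x. \<gamma> x \<in> {0..1}" and a: "\<And>x. x < n \<Longrightarrow> \<bar>a x\<bar> \<le> 2" and n: "0 < n"
  shows "measure_pmf.expectation (bernoulli_product \<gamma> n) (\<lambda>\<eta>. (empirical n a \<eta> - c)\<^sup>2)
    \<le> 4 / real n + (1 / real n * (\<Sum>x<n. a x * \<gamma> (real x / real n)) - c)\<^sup>2"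
proof -
  let ?p = "bernoulli_product \<gamma> n"
  let ?E = "measure_pmf.expectation ?p"
  define q where "q x = \<gamma> (real x / real n)" for x
  define e where "e = 1 / real n * (\<Sum>x<n. a x * q x)"
  have q: "0 \<le> q x" "q x \<le> 1" for x using g by (auto simp: q_def)
  have i0: "integrable (measure_pmf ?p) (\<lambda>\<eta>. occ \<eta> x)" "integrable (measure_pmf ?p) (\<lambda>\<eta>. occ \<eta> x * occ \<eta> y)" for x y
    by (rule pmf_integrable_bounded[of _ 1], simp)+
  have m1: "?E (\<lambda>\<eta>. occ \<eta> x) = q x" if "x < n" for x
    using bernoulli_product_moment[OF g, of "{x}" n] that by (simp add: q_def)
  have m2: "?E (\<lambda>\<eta>. occ \<eta> x * occ \<eta> y) = (if x = y then q x else q x * q y)" if "x < n" "y < n" for x y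
    using bernoulli_product_moment[OF g, of "{x, y}" n] m1[of x] that by (auto simp: q_def simp flip: of_bool_conj)
  have cov: "?E (\<lambda>\<eta>. (occ \<eta> x - q x) * (occ \<eta> y - q y)) = (if x = y then q x * (1 - q x) else 0)" if "x < n" "y < n" for x y
  proof -
    have "?E (\<lambda>\<eta>. (occ \<eta> x - q x) * (occ \<eta> y - q y)) = ?E (\<lambda>\<eta>. ((occ \<eta> x * occ \<eta> y - q y * occ \<eta> x) - q x * occ \<eta> y) + q x * q y)"
      by (intro Bochner_Integration.integral_cong) (auto simp: algebra_simps)
    also have "\<dots> = ?E (\<lambda>\<eta>. occ \<eta> x * occ \<eta> y) - q y * ?E (\<lambda>\<eta>. occ \<eta> x) - q x * ?E (\<lambda>\<eta>. occ \<eta> y) + q x * q y"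
      by (rule pmf_expectation_combination[OF i0(2) i0(1) i0(1)])
    finally show ?thesis unfolding m1[OF that(1)] m1[OF that(2)] m2[OF that] by (auto simp: algebra_simps)
  qed
  define Z where "Z \<eta> = (\<Sum>x<n. a x * (occ \<eta> x - q x))" for \<eta>
  have emp: "empirical n a \<eta> - e = 1 / real n * Z \<eta>" for \<eta>
    by (simp add: empirical_def e_def Z_def right_diff_distrib sum_subtractf)
  have occq: "\<bar>occ \<eta> x - q x\<bar> \<le> 1" for \<eta> x using q[of x] by (auto simp: of_bool_def)
  have Zb: "\<bar>Z \<eta>\<bar> \<le> (\<Sum>x<n. 2)" for \<eta>
    unfolding Z_def
  proof (rule order_trans[OF sum_abs sum_mono])
    fix x assume "x \<in> {..<n}"
    then show "\<bar>a x * (occ \<eta> x - q x)\<bar> \<le> 2"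
      using mult_mono[OF a[of x] occq[of \<eta> x]] by (simp add: abs_mult)
  qed
  have iZ: "integrable (measure_pmf ?p) Z" by (rule pmf_integrable_bounded[OF Zb])
  have iZ2: "integrable (measure_pmf ?p) (\<lambda>\<eta>. (Z \<eta>)\<^sup>2)"
  proof (rule pmf_integrable_bounded[of _ "(\<Sum>x<n. 2)\<^sup>2"])
    show "\<bar>(Z \<eta>)\<^sup>2\<bar> \<le> (\<Sum>x<n. 2)\<^sup>2" for \<eta>
      using power_mono[OF Zb[of \<eta>] abs_ge_zero, of 2] by (simp only: power2_abs abs_power2)
  qed
  have EZ: "?E Z = 0"
  proof -
    have "?E Z = (\<Sum>x<n. ?E (\<lambda>\<eta>. a x * (occ \<eta> x - q x)))"
      unfolding Z_def using i0 by (intro Bochner_Integration.integral_sum) auto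
    also have "\<dots> = (\<Sum>x<n. 0)" using i0 m1 by (intro sum.cong) auto
    finally show ?thesis by simp
  qed
  have ic: "integrable (measure_pmf ?p) (\<lambda>\<eta>. (occ \<eta> x - q x) * (occ \<eta> y - q y))" for x y
    by (rule pmf_integrable_bounded[of _ "1 * 1"]) (unfold abs_mult, intro mult_mono occq, auto)
  have "?E (\<lambda>\<eta>. (Z \<eta>)\<^sup>2) = ?E (\<lambda>\<eta>. \<Sum>x<n. \<Sum>y<n. (a x * a y) * ((occ \<eta> x - q x) * (occ \<eta> y - q y)))"
    unfolding Z_def power2_eq_square sum_product by (simp add: mult_ac)
  also have "\<dots> = (\<Sum>x<n. \<Sum>y<n. (a x * a y) * ?E (\<lambda>\<eta>. (occ \<eta> x - q x) * (occ \<eta> y - q y)))"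
    using ic by (subst Bochner_Integration.integral_sum) (auto intro!: sum.cong integrable_sum)
  also have "\<dots> = (\<Sum>x<n. \<Sum>y<n. if y = x then (a x * a x) * (q x * (1 - q x)) else 0)"
    using cov by (intro sum.cong) auto
  also have "\<dots> = (\<Sum>x<n. (a x * a x) * (q x * (1 - q x)))" by simp
  also have "\<dots> \<le> (\<Sum>x<n. 4)"
  proof (rule sum_mono)
    fix x assume "x \<in> {..<n}"
    then have "\<bar>a x\<bar> * \<bar>a x\<bar> \<le> 2 * 2" using a[of x] by (intro mult_mono) auto
    moreover have "q x * (1 - q x) \<le> 1 * 1" using q[of x] by (intro mult_mono) auto
    ultimately have "(a x * a x) * (q x * (1 - q x)) \<le> 4 * 1" using q[of x] by (intro mult_mono) auto
    then show "(a x * a x) * (q x * (1 - q x)) \<le> 4" by simp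
  qed
  finally have EZ2: "?E (\<lambda>\<eta>. (Z \<eta>)\<^sup>2) \<le> 4 * real n" by simp
  define d where "d = e - c"
  have "?E (\<lambda>\<eta>. (empirical n a \<eta> - c)\<^sup>2) = ?E (\<lambda>\<eta>. ((1 / real n)\<^sup>2 * (Z \<eta>)\<^sup>2 + (2 * d * (1 / real n)) * Z \<eta>) + d\<^sup>2)"
  proof (intro Bochner_Integration.integral_cong refl)
    fix \<eta>
    have E: "empirical n a \<eta> - c = 1 / real n * Z \<eta> + d" using emp[of \<eta>] by (simp add: d_def)
    have "(r * z + d)\<^sup>2 = (r\<^sup>2 * z\<^sup>2 + (2 * d * r) * z) + d\<^sup>2" for r z
      by (simp add: power2_eq_square algebra_simps)
    then show "(empirical n a \<eta> - c)\<^sup>2 = ((1 / real n)\<^sup>2 * (Z \<eta>)\<^sup>2 + (2 * d * (1 / real n)) * Z \<eta>) + d\<^sup>2"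
      unfolding E .
  qed
  also have "\<dots> = (1 / real n)\<^sup>2 * ?E (\<lambda>\<eta>. (Z \<eta>)\<^sup>2) + d\<^sup>2"
    using iZ iZ2 EZ by simp
  also have "\<dots> \<le> (1 / real n)\<^sup>2 * (4 * real n) + d\<^sup>2"
    by (intro add_right_mono mult_left_mono EZ2) auto
  also have "(1 / real n)\<^sup>2 * (4 * real n) = 4 / real n" using n by (simp add: power2_eq_square)
  finally show ?thesis by (simp add: d_def e_def q_def)
qed

context slow_ssep
begin

lemma initial_expectation: "expectation (\<lambda>\<omega>. f (X 0 \<omega>)) = measure_pmf.expectation \<mu> (f :: _ \<Rightarrow> real)"
proof -
  have "X 0 \<in> M \<rightarrow>\<^sub>M count_space UNIV"
    by (rule measurable_compose[OF X_measurable[of 0]]) auto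
  then have "expectation (\<lambda>\<omega>. f (X 0 \<omega>)) = integral\<^sup>L (distr M (count_space UNIV) (X 0)) f"
    by (subst integral_distr) auto
  then show ?thesis using ssep by (simp add: slow_site_ssep_def)
qed

end

section \<open>From convergence of modes to the hydrodynamic limit\<close>

lemma empirical_diff_le:
  assumes "\<And>x. x < n \<Longrightarrow> \<bar>a x - b x\<bar> \<le> e" "0 < n"
  shows "\<bar>empirical n a \<eta> - empirical n b \<eta>\<bar> \<le> e"
proof -
  have "empirical n a \<eta> - empirical n b \<eta> = empirical n (\<lambda>x. a x - b x) \<eta>"
    by (simp add: empirical_def left_diff_distrib sum_subtractf right_diff_distrib)
  then show ?thesis using empirical_bound[of n "\<lambda>x. a x - b x" e \<eta>] assms by simp
qed

lemma empirical_sum: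
  "empirical n (\<lambda>x. \<Sum>k<N. h k * a k x) \<eta> = (\<Sum>k<N. h k * empirical n (a k) \<eta>)"
proof -
  have "(\<Sum>x<n. (\<Sum>k<N. h k * a k x) * occ \<eta> x) = (\<Sum>k<N. h k * (\<Sum>x<n. a k x * occ \<eta> x))"
    unfolding sum_distrib_right sum_distrib_left by (subst sum.swap) (simp add: mult.assoc)
  then show ?thesis by (simp add: empirical_def sum_distrib_left mult.left_commute)
qed

context heat_flow
begin

text \<open>Approximating \<open>H\<close> uniformly by finitely many modes costs a deterministic
  error, because the empirical measure has mass at most 1 and the flow is integrable. Cauchy-Schwarz
  gathers the random rest into the single variable \<open>W\<close>, to which Markov's inequality
  applies.\<close>

lemma hydrodynamic_limit_if_modes_converge:
  fixes M :: "nat \<Rightarrow> 'w measure" and X :: "nat \<Rightarrow> real \<Rightarrow> 'w \<Rightarrow> nat \<Rightarrow> bool"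
  assumes prob: "\<And>n. 3 \<le> n \<Longrightarrow> prob_space (M n)"
    and int: "\<And>n t f. 3 \<le> n \<Longrightarrow> 0 \<le> t \<Longrightarrow> integrable (M n) (\<lambda>\<omega>. f (X n t \<omega>) :: real)"
    and close: "\<And>k. \<exists>K. \<forall>n\<ge>3. \<forall>x<n. \<bar>a k n x - \<phi> k (real x / real n)\<bar> \<le> K / real n"
    and modes: "\<And>k t. 0 < t \<Longrightarrow>
      (\<lambda>n. \<integral>\<omega>. (empirical n (a k n) (X n t \<omega>) - exp (- ev k * t) * c k)\<^sup>2 \<partial>M n) \<longlonglongrightarrow> 0"
  shows "hydrodynamic_limit T M X flow"
  unfolding hydrodynamic_limit_def
proof (intro ballI allI impI)
  fix t \<delta> H assume t: "t \<in> {0<..T}" and \<delta>: "0 < (\<delta>::real)" and H: "continuous_on_torus H"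
  have t0: "0 < t" using t by simp
  define I where "I = L2_inner (flow t) H"
  have I_eq: "(LINT u:{0..1}|lebesgue. H u * flow t u) = I"
    unfolding I_def L2_inner_def by (simp add: mult.commute)
  have Hc: "continuous_on {0..1} H"
    using H unfolding continuous_on_torus_def by (auto intro: continuous_on_subset)
  have H01: "H 0 = H 1"
  proof -
    interpret per: periodic_fun_simple' H using H by (simp add: continuous_on_torus_def)
    show ?thesis using per.plus_1[of 0] by simp
  qed
  define R where "R = (\<integral>u. \<bar>flow t u\<bar> \<partial>unit_measure)"
  have R: "0 \<le> R" unfolding R_def by simp
  \<comment> \<open>Error budget: \<delta>/4 for replacing \<open>H\<close> in the empirical measure
    and in the limit together, \<delta>/4 for discretised modes, \<delta>/2 for
    fluctuations.\<close>
  define \<epsilon> where "\<epsilon> = \<delta> / (4 * (1 + R))"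
  have \<epsilon>: "0 < \<epsilon>" "\<epsilon> * (1 + R) = \<delta> / 4" using \<delta> R by (auto simp: \<epsilon>_def field_simps)
  obtain N h where Nh: "\<And>u. u \<in> {0..1} \<Longrightarrow> \<bar>H u - (\<Sum>k<N. h k * \<phi> k u)\<bar> \<le> \<epsilon>"
    using dense[OF Hc H01] \<epsilon>(1) unfolding approximable_def by blast
  obtain K where K: "\<And>k n x. 3 \<le> n \<Longrightarrow> x < n \<Longrightarrow> \<bar>a k n x - \<phi> k (real x / real n)\<bar> \<le> K k / real n"
    using close by metis
  define Z where "Z k n \<omega> = empirical n (a k n) (X n t \<omega>) - exp (- ev k * t) * c k" for k n \<omega>
  define W where "W n \<omega> = (\<Sum>k<N. (Z k n \<omega>)\<^sup>2)" for n \<omega>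
  define S where "S = (\<Sum>k<N. \<bar>h k\<bar> * K k)"
  \<comment> \<open>The summand 1 keeps the threshold \<theta> well defined when all coefficients
    vanish.\<close>
  define B where "B = (\<Sum>k<N. (h k)\<^sup>2) + 1"
  have B: "0 < B" unfolding B_def by (intro add_nonneg_pos sum_nonneg) auto
  define \<theta> where "\<theta> = (\<delta> / 2)\<^sup>2 / B"
  have \<theta>: "0 < \<theta>" using B \<delta> by (simp add: \<theta>_def)
  let ?P = "\<lambda>n. measure (M n) {\<omega> \<in> space (M n). \<delta> < \<bar>1 / real n * (\<Sum>x<n. H (real x / real n) * occ (X n t \<omega>) x) - I\<bar>}"
  have iZ: "integrable (M n) (\<lambda>\<omega>. (Z k n \<omega>)\<^sup>2)" if "3 \<le> n" for k n
    unfolding Z_def using int[OF that less_imp_le[OF t0], of "\<lambda>\<eta>. (empirical n (a k n) \<eta> - exp (- ev k * t) * c k)\<^sup>2"] .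
  have iW: "integrable (M n) (W n)" if "3 \<le> n" for n
    unfolding W_def[abs_def] using iZ[OF that] by simp
  have EW: "(\<lambda>n. \<integral>\<omega>. W n \<omega> \<partial>M n) \<longlonglongrightarrow> 0"
  proof -
    have "(\<lambda>n. \<Sum>k<N. \<integral>\<omega>. (Z k n \<omega>)\<^sup>2 \<partial>M n) \<longlonglongrightarrow> (\<Sum>k<N. 0)"
      unfolding Z_def by (intro tendsto_sum modes[OF t0])
    moreover have "\<forall>\<^sub>F n in sequentially. (\<Sum>k<N. \<integral>\<omega>. (Z k n \<omega>)\<^sup>2 \<partial>M n) = (\<integral>\<omega>. W n \<omega> \<partial>M n)"
      using eventually_ge_at_top[of 3]
    proof eventually_elim
      case (elim n)
      show ?case unfolding W_def using iZ[OF elim] by (subst Bochner_Integration.integral_sum) auto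
    qed
    ultimately show ?thesis using Lim_transform_eventually by fastforce
  qed
  have I_close: "\<bar>I - (\<Sum>k<N. h k * (exp (- ev k * t) * c k))\<bar> \<le> \<epsilon> * R"
  proof -
    have "(\<Sum>k<N. h k * (exp (- ev k * t) * c k)) = L2_inner (flow t) (\<lambda>u. \<Sum>k<N. h k * \<phi> k u)"
      using flow_coefficient[of t] t0 by (subst L2_inner_sum_right[OF flow_L1 phi_cont]) simp
    then have "I - (\<Sum>k<N. h k * (exp (- ev k * t) * c k)) = L2_inner (flow t) (\<lambda>u. H u - (\<Sum>k<N. h k * \<phi> k u))"
      unfolding I_def by (subst L2_inner_diff_right) (auto intro!: flow_L1 Hc continuous_intros phi_cont)
    also have "\<bar>\<dots>\<bar> \<le> \<epsilon> * R"
      unfolding R_def by (intro L2_inner_bound flow_L1 Nh continuous_intros Hc phi_cont)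
    finally show ?thesis .
  qed
  have bound: "\<bar>1 / real n * (\<Sum>x<n. H (real x / real n) * occ (X n t \<omega>) x) - I\<bar> \<le> \<delta> / 4 + S / real n + \<bar>\<Sum>k<N. h k * Z k n \<omega>\<bar>"
    if n: "3 \<le> n" for n \<omega>
  proof -
    let ?A = "empirical n (\<lambda>x. H (real x / real n)) (X n t \<omega>)"
    have "\<bar>?A - empirical n (\<lambda>x. \<Sum>k<N. h k * a k n x) (X n t \<omega>)\<bar> \<le> \<epsilon> + S / real n"
    proof (rule empirical_diff_le)
      fix x assume x: "x < n"
      have "\<bar>(\<Sum>k<N. h k * \<phi> k (real x / real n)) - (\<Sum>k<N. h k * a k n x)\<bar> \<le> (\<Sum>k<N. \<bar>h k\<bar> * (K k / real n))"
        unfolding sum_subtractf[symmetric] right_diff_distrib[symmetric]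
      proof (rule order_trans[OF sum_abs sum_mono])
        fix k
        have "\<bar>\<phi> k (real x / real n) - a k n x\<bar> \<le> K k / real n" using K[OF n x, of k] by (simp add: abs_minus_commute)
        then show "\<bar>h k * (\<phi> k (real x / real n) - a k n x)\<bar> \<le> \<bar>h k\<bar> * (K k / real n)"
          unfolding abs_mult by (intro mult_left_mono) auto
      qed
      also have "\<dots> = S / real n" by (simp add: S_def sum_divide_distrib)
      finally have "\<bar>(\<Sum>k<N. h k * \<phi> k (real x / real n)) - (\<Sum>k<N. h k * a k n x)\<bar> \<le> S / real n" .
      moreover have "\<bar>H (real x / real n) - (\<Sum>k<N. h k * \<phi> k (real x / real n))\<bar> \<le> \<epsilon>"
        using x by (intro Nh) auto
      ultimately show "\<bar>H (real x / real n) - (\<Sum>k<N. h k * a k n x)\<bar> \<le> \<epsilon> + S / real n" by linarith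
    qed (use n in simp)
    moreover have "empirical n (\<lambda>x. \<Sum>k<N. h k * a k n x) (X n t \<omega>) - (\<Sum>k<N. h k * (exp (- ev k * t) * c k)) = (\<Sum>k<N. h k * Z k n \<omega>)"
      unfolding empirical_sum Z_def by (simp add: right_diff_distrib sum_subtractf)
    moreover have "\<epsilon> + \<epsilon> * R = \<delta> / 4" using \<epsilon>(2) by (simp add: distrib_left)
    moreover have "?A = 1 / real n * (\<Sum>x<n. H (real x / real n) * occ (X n t \<omega>) x)" by (simp add: empirical_def)
    ultimately show ?thesis using I_close by linarith
  qed
  have cs: "\<bar>\<Sum>k<N. h k * Z k n \<omega>\<bar>\<^sup>2 \<le> B * W n \<omega>" for n \<omega>
  proof -
    have "(\<Sum>k<N. h k * Z k n \<omega>)\<^sup>2 \<le> (\<Sum>k<N. (h k)\<^sup>2) * W n \<omega>"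
      unfolding W_def by (rule Cauchy_Schwarz_ineq_sum)
    also have "\<dots> \<le> B * W n \<omega>" unfolding B_def W_def by (intro mult_right_mono sum_nonneg) auto
    finally show ?thesis by simp
  qed
  have "(\<lambda>n. S / real n) \<longlonglongrightarrow> 0" by real_asymp
  then have "\<forall>\<^sub>F n in sequentially. S / real n < \<delta> / 4"
    using \<delta> by (intro order_tendstoD(2)) auto
  then have le: "\<forall>\<^sub>F n in sequentially. ?P n \<le> (\<integral>\<omega>. W n \<omega> \<partial>M n) / \<theta>"
    using eventually_ge_at_top[of 3]
  proof eventually_elim
    case (elim n)
    interpret prob_space "M n" by (rule prob[OF elim(2)])
    have "?P n \<le> measure (M n) {\<omega> \<in> space (M n). W n \<omega> \<ge> \<theta>}"
    proof (rule finite_measure_mono)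
      show "{\<omega> \<in> space (M n). \<theta> \<le> W n \<omega>} \<in> sets (M n)"
        using borel_measurable_integrable[OF iW[OF elim(2)]] by measurable
      show "{\<omega> \<in> space (M n). \<delta> < \<bar>1 / real n * (\<Sum>x<n. H (real x / real n) * occ (X n t \<omega>) x) - I\<bar>} \<subseteq> {\<omega> \<in> space (M n). \<theta> \<le> W n \<omega>}"
      proof safe
        fix \<omega> assume "\<delta> < \<bar>1 / real n * (\<Sum>x<n. H (real x / real n) * occ (X n t \<omega>) x) - I\<bar>"
        then have "\<delta> / 2 \<le> \<bar>\<Sum>k<N. h k * Z k n \<omega>\<bar>" using bound[OF elim(2), of \<omega>] elim(1) by linarith
        then have "(\<delta> / 2)\<^sup>2 \<le> \<bar>\<Sum>k<N. h k * Z k n \<omega>\<bar>\<^sup>2" using \<delta> by (intro power_mono) auto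
        also have "\<dots> \<le> B * W n \<omega>" by (rule cs)
        finally show "\<theta> \<le> W n \<omega>" unfolding \<theta>_def using B by (simp add: pos_divide_le_eq mult.commute)
      qed
    qed
    also have "\<dots> \<le> (\<integral>\<omega>. W n \<omega> \<partial>M n) / \<theta>"
    proof -
      have "AE \<omega> in M n. 0 \<le> W n \<omega>" by (intro AE_I2) (simp add: W_def sum_nonneg)
      then show ?thesis
        using integral_Markov_inequality_measure[OF iW[OF elim(2)], of "{}" \<theta>] \<theta> by simp
    qed
    finally show ?case .
  qed
  have "?P \<longlonglongrightarrow> 0"
  proof (rule tendsto_sandwich[of "\<lambda>_. 0" _ _ "\<lambda>n. (\<integral>\<omega>. W n \<omega> \<partial>M n) / \<theta>"])
    show "(\<lambda>n. (\<integral>\<omega>. W n \<omega> \<partial>M n) / \<theta>) \<longlonglongrightarrow> 0" using tendsto_divide[OF EW tendsto_const, of \<theta>] \<theta> by simp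
  qed (use le in auto)
  then show "(\<lambda>n. measure (M n) {\<omega> \<in> space (M n).
     \<bar>1 / real n * (\<Sum>x<n. H (real x / real n) * occ (X n t \<omega>) x)
        - (LINT u:{0..1}|lebesgue. H u * flow t u)\<bar> > \<delta>}) \<longlonglongrightarrow> 0"
    unfolding I_eq .
qed

end

text \<open>For every outcome the empirical average of a nonnegative \<open>H\<close> lies between 0
  and the Riemann sum of \<open>H\<close>. A limit outside these bounds would make the deviation
  event the whole space for large n, with probability 1 instead of tending to 0.\<close>

lemma hydrodynamic_limit_density_bounds:
  fixes M :: "nat \<Rightarrow> 'w measure" and X :: "nat \<Rightarrow> real \<Rightarrow> 'w \<Rightarrow> nat \<Rightarrow> bool"
  assumes hyd: "hydrodynamic_limit T M X \<rho>" and t: "t \<in> {0<..T}"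
    and prob: "\<And>n. 3 \<le> n \<Longrightarrow> prob_space (M n)"
    and H: "continuous_on_torus H" "\<And>u. 0 \<le> H u"
  shows "0 \<le> L2_inner (\<rho> t) H" "L2_inner (\<rho> t) H \<le> (\<integral>u. H u \<partial>unit_measure)"
proof -
  define I where "I = L2_inner (\<rho> t) H"
  have I_eq: "(LINT u:{0..1}|lebesgue. H u * \<rho> t u) = I"
    unfolding I_def L2_inner_def by (simp add: mult.commute)
  define A where "A n \<omega> = 1 / real n * (\<Sum>x<n. H (real x / real n) * occ (X n t \<omega>) x)" for n \<omega>
  have lim: "(\<lambda>n. measure (M n) {\<omega> \<in> space (M n). \<bar>A n \<omega> - I\<bar> > \<delta>}) \<longlonglongrightarrow> 0" if "0 < \<delta>" for \<delta>
    using hyd[unfolded hydrodynamic_limit_def, rule_format, OF t that H(1)] by (simp only: I_eq A_def)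
  have contra: False if \<delta>: "0 < \<delta>" and ev: "\<forall>\<^sub>F n in sequentially. \<forall>\<omega>. \<bar>A n \<omega> - I\<bar> > \<delta>" for \<delta>
  proof -
    have "\<forall>\<^sub>F n in sequentially. measure (M n) {\<omega> \<in> space (M n). \<bar>A n \<omega> - I\<bar> > \<delta>} = 1"
      using ev eventually_ge_at_top[of 3]
    proof eventually_elim
      case (elim n)
      then show ?case using prob_space.prob_space[OF prob[OF elim(2)]] by simp
    qed
    then have "(\<lambda>n. measure (M n) {\<omega> \<in> space (M n). \<bar>A n \<omega> - I\<bar> > \<delta>}) \<longlonglongrightarrow> 1"
      by (rule tendsto_eventually)
    then show False using LIMSEQ_unique[OF lim[OF \<delta>]] by fastforce
  qed
  have A0: "0 \<le> A n \<omega>" for n \<omega>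
    unfolding A_def using H(2) by (intro mult_nonneg_nonneg sum_nonneg) auto
  have A1: "A n \<omega> \<le> 1 / real n * (\<Sum>x<n. H (real x / real n))" for n \<omega>
    unfolding A_def using H(2) by (intro mult_left_mono sum_mono) (auto simp: of_bool_def)
  have "0 \<le> I"
  proof (rule ccontr)
    assume "\<not> 0 \<le> I"
    then have "\<bar>A n \<omega> - I\<bar> > - I / 2" for n \<omega> using A0[of n \<omega>] by linarith
    then show False using contra[of "- I / 2"] \<open>\<not> 0 \<le> I\<close> by simp
  qed
  then show "0 \<le> L2_inner (\<rho> t) H" by (simp add: I_def)
  let ?J = "\<integral>u. H u \<partial>unit_measure"
  interpret per: periodic_fun_simple' H using H(1) by (simp add: continuous_on_torus_def)
  have Hcont: "continuous_on UNIV H" using H(1) by (simp add: continuous_on_torus_def)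
  have "compact (H ` {0..1})" by (intro compact_continuous_image continuous_on_subset[OF Hcont]) auto
  then obtain B where B: "\<And>u. u \<in> {0..1} \<Longrightarrow> \<bar>H u\<bar> \<le> B"
    using compact_imp_bounded bounded_iff by (metis imageI real_norm_def)
  have "\<bar>H u\<bar> \<le> B" for u
  proof -
    have "H (frac u) = H u" using per.minus_of_int[of u "\<lfloor>u\<rfloor>"] by (simp add: frac_def)
    then show ?thesis using B[of "frac u"] frac_lt_1[of u] by auto
  qed
  then have riem: "(\<lambda>n. 1 / real n * (\<Sum>x<n. H (real x / real n))) \<longlonglongrightarrow> ?J"
    using Hcont by (intro riemann_sum_tendsto borel_measurable_continuous_onI) (auto simp: continuous_on_eq_continuous_at)
  have "I \<le> ?J"
  proof (rule ccontr)
    assume "\<not> I \<le> ?J"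
    define \<delta> where "\<delta> = (I - ?J) / 3"
    have \<delta>: "0 < \<delta>" "I = ?J + 3 * \<delta>" using \<open>\<not> I \<le> ?J\<close> by (auto simp: \<delta>_def field_simps)
    have "\<forall>\<^sub>F n in sequentially. 1 / real n * (\<Sum>x<n. H (real x / real n)) < ?J + \<delta>"
      using \<delta> by (intro order_tendstoD(2)[OF riem]) simp
    then have "\<forall>\<^sub>F n in sequentially. \<forall>\<omega>. \<bar>A n \<omega> - I\<bar> > \<delta>"
    proof eventually_elim
      case (elim n)
      then show ?case using A1[of n] \<delta> by (smt (verit))
    qed
    then show False using contra[OF \<delta>(1)] by blast
  qed
  then show "L2_inner (\<rho> t) H \<le> ?J" by (simp add: I_def)
qed

lemma continuous_nonneg_square_integral_zero:
  assumes h: "continuous_on {0..1} h" and z: "L2_inner h h \<le> 0" and u: "u \<in> {0..1}"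
  shows "h u = 0"
proof -
  have c: "continuous_on {0..1} (\<lambda>u. h u * h u)" by (intro continuous_intros h)
  have "integrable unit_measure (\<lambda>u. h u * h u)" using continuous_L1_01[OF c] by (simp add: L1_01_eq)
  then have "L2_inner h h = integral {0..1} (\<lambda>u. h u * h u)"
    by (simp add: L2_inner_eq lebesgue_integral_eq_integral)
  moreover have "0 \<le> L2_inner h h" by (simp add: L2_inner_eq)
  ultimately have "integral {0..1} (\<lambda>u. h u * h u) = 0" using z by simp
  then show ?thesis using integral_eq_0_iff[OF c] u by simp
qed

context periodic_flow
begin

text \<open>The maximum principle, obtained from the particles: the density bounds are tested with
  the negative part of the flow and with the positive part of the flow minus 1. Both are continuous
  on the torus, and their squared norms come out nonpositive.\<close>

lemma flow_range_if_hydrodynamic_limit: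
  fixes M :: "nat \<Rightarrow> 'w measure" and X :: "nat \<Rightarrow> real \<Rightarrow> 'w \<Rightarrow> nat \<Rightarrow> bool"
  assumes hyd: "hydrodynamic_limit T M X flow" and t: "0 < t" "t \<le> T" and u: "u \<in> {0..<1}"
    and prob: "\<And>n. 3 \<le> n \<Longrightarrow> prob_space (M n)"
  shows "flow t u \<in> {0..1}"
proof -
  have tT: "t \<in> {0<..T}" using t by simp
  have fc: "continuous_on S (flow t)" for S by (rule flow_continuous[OF t(1)])
  have per: "flow t (u + 1) = flow t u" for u
  proof -
    have "periodic_mode k (u + 1) = periodic_mode k u" for k
    proof -
      have "periodic_freq k * (u + 1) + periodic_phase k = periodic_freq k + (periodic_freq k * u + periodic_phase k)"
        by (simp add: distrib_left)
      then show ?thesis unfolding periodic_mode_def by (simp only: periodic_freq_shift)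
    qed
    then show ?thesis using t(1) by (simp add: flow_def)
  qed
  let ?f = "flow t"
  let ?n = "\<lambda>u. max 0 (- ?f u)" and ?p = "\<lambda>u. max 0 (?f u - 1)"
  have tn: "continuous_on_torus ?n" and tp: "continuous_on_torus ?p"
    unfolding continuous_on_torus_def
    by (auto intro!: continuous_intros fc periodic_fun_simple'.intro simp: per)
  have nc: "continuous_on {0..1} ?n" and pc: "continuous_on {0..1} ?p" by (intro continuous_intros fc)+
  have "L2_inner ?n ?n = - L2_inner ?f ?n"
    unfolding L2_inner_eq Bochner_Integration.integral_minus[symmetric]
    by (intro Bochner_Integration.integral_cong) (auto simp: max_def)
  then have n0: "?n u = 0"
    using hydrodynamic_limit_density_bounds(1)[OF hyd tT prob tn] u
    by (intro continuous_nonneg_square_integral_zero[OF nc]) auto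
  have "L2_inner ?p ?p = (\<integral>u. ?f u * ?p u - ?p u \<partial>unit_measure)"
    unfolding L2_inner_eq by (intro Bochner_Integration.integral_cong) (auto simp: max_def algebra_simps)
  also have "\<dots> = L2_inner ?f ?p - (\<integral>u. ?p u \<partial>unit_measure)"
    unfolding L2_inner_eq
    using integrable_mult_continuous[OF flow_L1[of t] pc] continuous_L1_01[OF pc]
    by (intro Bochner_Integration.integral_diff) (auto simp: L1_01_eq)
  also have "\<dots> \<le> 0"
    using hydrodynamic_limit_density_bounds(2)[OF hyd tT prob tp] by simp
  finally have "?p u = 0"
    using u by (intro continuous_nonneg_square_integral_zero[OF pc]) auto
  then show ?thesis using n0 by (auto simp: max_def split: if_splits)
qed

end

section \<open>Convergence of single modes and the two regimes\<close>

lemma discrete_eigenvalue_tendsto: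
  "(\<lambda>n. (real n)\<^sup>2 * (2 - 2 * cos (w / real n))) \<longlonglongrightarrow> w\<^sup>2"
  "(\<lambda>n. (real n)\<^sup>2 * (2 - 2 * cos (w / (real n - 1)))) \<longlonglongrightarrow> w\<^sup>2"
  by (real_asymp simp: power2_eq_square)+

context heat_flow
begin

lemma initial_mode_tendsto:
  assumes cont: "\<And>u. 0 < u \<Longrightarrow> u < 1 \<Longrightarrow> isCont \<gamma> u"
    and close: "\<And>n x. 3 \<le> n \<Longrightarrow> x < n \<Longrightarrow> \<bar>a n x - \<phi> k (real x / real n)\<bar> \<le> K / real n"
  shows "(\<lambda>n. 1 / real n * (\<Sum>x<n. a n x * \<gamma> (real x / real n))) \<longlonglongrightarrow> c k"
proof -
  let ?F = "\<lambda>u. \<gamma> u * \<phi> k u"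
  let ?r = "\<lambda>n. 1 / real n * (\<Sum>x<n. ?F (real x / real n))"
  let ?e = "\<lambda>n. 1 / real n * (\<Sum>x<n. a n x * \<gamma> (real x / real n))"
  have "?r \<longlonglongrightarrow> (\<integral>u. ?F u \<partial>unit_measure)"
  proof (rule riemann_sum_tendsto)
    show "\<bar>?F u\<bar> \<le> 1 * 2" for u
      unfolding abs_mult using gamma_range[of u] by (intro mult_mono phi_bound) auto
    show "isCont ?F u" if "0 < u" "u < 1" for u
      using cont[OF that] phi_continuous[of k] by (intro continuous_intros) (auto simp: continuous_on_eq_continuous_at)
    show "?F \<in> borel_measurable borel" by measurable
  qed
  then have r: "?r \<longlonglongrightarrow> c k" by (simp add: c_def L2_inner_eq)
  have d: "\<bar>?e n - ?r n\<bar> \<le> K / real n" if n: "3 \<le> n" for n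
  proof -
    have "\<bar>(\<Sum>x<n. a n x * \<gamma> (real x / real n)) - (\<Sum>x<n. ?F (real x / real n))\<bar> \<le> (\<Sum>x<n. K / real n)"
      unfolding sum_subtractf[symmetric]
    proof (rule order_trans[OF sum_abs sum_mono])
      fix x assume x: "x \<in> {..<n}"
      have "\<bar>a n x * \<gamma> (real x / real n) - ?F (real x / real n)\<bar> = \<bar>a n x - \<phi> k (real x / real n)\<bar> * \<bar>\<gamma> (real x / real n)\<bar>"
        unfolding abs_mult[symmetric] by (simp add: algebra_simps)
      also have "\<dots> \<le> (K / real n) * 1"
        using close[OF n, of x] x gamma_range[of "real x / real n"] by (intro mult_mono) auto
      finally show "\<bar>a n x * \<gamma> (real x / real n) - ?F (real x / real n)\<bar> \<le> K / real n" by simp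
    qed
    then have "1 / real n * \<bar>(\<Sum>x<n. a n x * \<gamma> (real x / real n)) - (\<Sum>x<n. ?F (real x / real n))\<bar> \<le> 1 / real n * (\<Sum>x<n. K / real n)"
      by (intro mult_left_mono) auto
    then show ?thesis using n unfolding right_diff_distrib[symmetric] abs_mult by simp
  qed
  have "(\<lambda>n. ?e n - ?r n) \<longlonglongrightarrow> 0"
  proof (rule Lim_null_comparison[where g = "\<lambda>n. K / real n"])
    show "\<forall>\<^sub>F n in sequentially. norm (?e n - ?r n) \<le> K / real n"
      using eventually_ge_at_top[of 3] by eventually_elim (use d in auto)
    show "(\<lambda>n. K / real n) \<longlonglongrightarrow> 0" by real_asymp
  qed
  from tendsto_add[OF this r] show ?thesis by simp
qed

text \<open>The moment bound is centred at the decay with the discrete rate \<open>l n\<close>;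
  recentring at the limiting rate costs the deterministic term \<open>D\<close> and a factor 2. The
  remaining terms are the law of large numbers at time 0 and \<open>err\<close>.\<close>

lemma mode_converges:
  fixes M :: "nat \<Rightarrow> 'w measure" and X :: "nat \<Rightarrow> real \<Rightarrow> 'w \<Rightarrow> nat \<Rightarrow> bool"
  assumes ssep: "\<And>n. 3 \<le> n \<Longrightarrow> slow_ssep n (g n) (bernoulli_product \<gamma> n) (M n) (X n)"
    and cont: "\<And>u. 0 < u \<Longrightarrow> u < 1 \<Longrightarrow> isCont \<gamma> u"
    and bound: "\<And>n x. x < n \<Longrightarrow> \<bar>a n x\<bar> \<le> 2"
    and close: "\<And>n x. 3 \<le> n \<Longrightarrow> x < n \<Longrightarrow> \<bar>a n x - \<phi> k (real x / real n)\<bar> \<le> K / real n"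
    and t: "0 < t"
    and l: "l \<longlonglongrightarrow> ev k" and err: "err \<longlonglongrightarrow> 0"
    and moment: "\<And>n. 3 \<le> n \<Longrightarrow> (\<integral>\<omega>. (empirical n (a n) (X n t \<omega>) - exp (- l n * t) * c k)\<^sup>2 \<partial>M n)
        \<le> (\<integral>\<omega>. (empirical n (a n) (X n 0 \<omega>) - c k)\<^sup>2 \<partial>M n) + err n"
  shows "(\<lambda>n. \<integral>\<omega>. (empirical n (a n) (X n t \<omega>) - exp (- ev k * t) * c k)\<^sup>2 \<partial>M n) \<longlonglongrightarrow> 0"
proof -
  let ?e = "\<lambda>n. 1 / real n * (\<Sum>x<n. a n x * \<gamma> (real x / real n))"
  define D where "D n = (exp (- l n * t) - exp (- ev k * t)) * c k" for n
  have le: "(\<integral>\<omega>. (empirical n (a n) (X n t \<omega>) - exp (- ev k * t) * c k)\<^sup>2 \<partial>M n)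
      \<le> 2 * (4 / real n + (?e n - c k)\<^sup>2 + err n) + 2 * (D n)\<^sup>2" if n: "3 \<le> n" for n
  proof -
    interpret S: slow_ssep n "g n" "bernoulli_product \<gamma> n" "M n" "X n" by (rule ssep[OF n])
    have sq: "(x + y)\<^sup>2 \<le> 2 * x\<^sup>2 + 2 * y\<^sup>2" for x y :: real
      using zero_le_power2[of "x - y"] by (simp add: power2_eq_square algebra_simps)
    have i: "integrable (M n) (\<lambda>\<omega>. (empirical n (a n) (X n t \<omega>) - r)\<^sup>2)" for r
      using S.f_X_integrable[of t "\<lambda>\<eta>. (empirical n (a n) \<eta> - r)\<^sup>2"] t by simp
    have "(\<integral>\<omega>. (empirical n (a n) (X n t \<omega>) - exp (- ev k * t) * c k)\<^sup>2 \<partial>M n)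
       \<le> (\<integral>\<omega>. 2 * (empirical n (a n) (X n t \<omega>) - exp (- l n * t) * c k)\<^sup>2 + 2 * (D n)\<^sup>2 \<partial>M n)"
    proof (rule integral_mono[OF i])
      show "integrable (M n) (\<lambda>\<omega>. 2 * (empirical n (a n) (X n t \<omega>) - exp (- l n * t) * c k)\<^sup>2 + 2 * (D n)\<^sup>2)"
        using i by simp
      fix \<omega>
      have "empirical n (a n) (X n t \<omega>) - exp (- ev k * t) * c k = (empirical n (a n) (X n t \<omega>) - exp (- l n * t) * c k) + D n"
        by (simp add: D_def algebra_simps)
      then show "(empirical n (a n) (X n t \<omega>) - exp (- ev k * t) * c k)\<^sup>2
          \<le> 2 * (empirical n (a n) (X n t \<omega>) - exp (- l n * t) * c k)\<^sup>2 + 2 * (D n)\<^sup>2"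
        by (simp only: sq)
    qed
    also have "\<dots> = 2 * (\<integral>\<omega>. (empirical n (a n) (X n t \<omega>) - exp (- l n * t) * c k)\<^sup>2 \<partial>M n) + 2 * (D n)\<^sup>2"
      using i by (simp add: S.prob_space)
    also have "\<dots> \<le> 2 * ((\<integral>\<omega>. (empirical n (a n) (X n 0 \<omega>) - c k)\<^sup>2 \<partial>M n) + err n) + 2 * (D n)\<^sup>2"
      using moment[OF n] by simp
    also have "(\<integral>\<omega>. (empirical n (a n) (X n 0 \<omega>) - c k)\<^sup>2 \<partial>M n) \<le> 4 / real n + (?e n - c k)\<^sup>2"
      using bernoulli_product_second_moment[where n = n and a = "a n" and c = "c k", OF gamma_range bound] n
        S.initial_expectation[of "\<lambda>\<eta>. (empirical n (a n) \<eta> - c k)\<^sup>2"] by simp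
    finally show ?thesis by simp
  qed
  have D0: "D \<longlonglongrightarrow> 0"
  proof -
    have "(\<lambda>n. (exp (- l n * t) - exp (- ev k * t)) * c k) \<longlonglongrightarrow> (exp (- ev k * t) - exp (- ev k * t)) * c k"
      by (intro tendsto_intros l)
    then show ?thesis by (simp add: D_def[abs_def])
  qed
  have e0: "(\<lambda>n. (?e n - c k)\<^sup>2) \<longlonglongrightarrow> (c k - c k)\<^sup>2"
    by (intro tendsto_intros initial_mode_tendsto[OF cont close])
  have n0: "(\<lambda>n. 4 / real n) \<longlonglongrightarrow> 0" by real_asymp
  have "(\<lambda>n. 2 * (4 / real n + (?e n - c k)\<^sup>2 + err n) + 2 * (D n)\<^sup>2) \<longlonglongrightarrow> 2 * (0 + (c k - c k)\<^sup>2 + 0) + 2 * 0\<^sup>2"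
    by (intro tendsto_add tendsto_mult tendsto_power tendsto_const n0 e0 err D0)
  then have lim: "(\<lambda>n. 2 * (4 / real n + (?e n - c k)\<^sup>2 + err n) + 2 * (D n)\<^sup>2) \<longlonglongrightarrow> 0" by simp
  show ?thesis
  proof (rule tendsto_sandwich[OF _ _ tendsto_const lim])
    show "\<forall>\<^sub>F n in sequentially. (\<integral>\<omega>. (empirical n (a n) (X n t \<omega>) - exp (- ev k * t) * c k)\<^sup>2 \<partial>M n)
      \<le> 2 * (4 / real n + (?e n - c k)\<^sup>2 + err n) + 2 * (D n)\<^sup>2"
      using eventually_ge_at_top[of 3] by eventually_elim (rule le)
  qed (auto intro!: always_eventually)
qed

end

lemma (in periodic_flow) periodic_hydrodynamic_limit:
  fixes M :: "nat \<Rightarrow> 'w measure" and X :: "nat \<Rightarrow> real \<Rightarrow> 'w \<Rightarrow> nat \<Rightarrow> bool"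
  assumes ssep: "\<And>n. 3 \<le> n \<Longrightarrow> slow_ssep n (g n) (bernoulli_product \<gamma> n) (M n) (X n)"
    and cont: "\<And>u. 0 < u \<Longrightarrow> u < 1 \<Longrightarrow> isCont \<gamma> u"
    and g: "g \<longlonglongrightarrow> 1"
  shows "hydrodynamic_limit T M X flow"
proof (rule hydrodynamic_limit_if_modes_converge[where a = "\<lambda>k n x. periodic_mode k (real x / real n)"])
  fix n :: nat assume n: "3 \<le> n"
  interpret S: slow_ssep n "g n" "bernoulli_product \<gamma> n" "M n" "X n" by (rule ssep[OF n])
  show "prob_space (M n)" by (rule S.prob_space_axioms)
  show "integrable (M n) (\<lambda>\<omega>. f (X n t \<omega>) :: real)" if "0 \<le> t" for t f
    by (rule S.f_X_integrable[OF that])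
next
  fix k
  show "\<exists>K. \<forall>n\<ge>3. \<forall>x<n. \<bar>periodic_mode k (real x / real n) - periodic_mode k (real x / real n)\<bar> \<le> K / real n"
    by (intro exI[of _ 0]) simp
  fix t :: real assume t: "0 < t"
  let ?w = "periodic_freq k"
  let ?err = "\<lambda>n. (5 + 2 * \<bar>c k\<bar>) * ((4 * \<bar>?w\<bar> * \<bar>g n - 1\<bar> + 8 * ?w\<^sup>2 * ((1 + g n) * (1 / real n))) * t)"
  have n0: "(\<lambda>n. 1 / real n) \<longlonglongrightarrow> 0" by real_asymp
  have "?err \<longlonglongrightarrow> (5 + 2 * \<bar>c k\<bar>) * ((4 * \<bar>?w\<bar> * \<bar>1 - 1\<bar> + 8 * ?w\<^sup>2 * ((1 + 1) * 0)) * t)"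
    by (intro tendsto_intros g n0)
  then have err: "?err \<longlonglongrightarrow> 0" by simp
  show "(\<lambda>n. \<integral>\<omega>. (empirical n (\<lambda>x. periodic_mode k (real x / real n)) (X n t \<omega>) - exp (- ?w\<^sup>2 * t) * c k)\<^sup>2 \<partial>M n) \<longlonglongrightarrow> 0"
  proof (rule mode_converges[OF ssep cont _ _ t discrete_eigenvalue_tendsto(1) err, where K = 0])
    fix n :: nat assume n: "3 \<le> n"
    interpret S: slow_ssep n "g n" "bernoulli_product \<gamma> n" "M n" "X n" by (rule ssep[OF n])
    show "(\<integral>\<omega>. (empirical n (\<lambda>x. periodic_mode k (real x / real n)) (X n t \<omega>) - exp (- ((real n)\<^sup>2 * (2 - 2 * cos (?w / real n))) * t) * c k)\<^sup>2 \<partial>M n)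
        \<le> (\<integral>\<omega>. (empirical n (\<lambda>x. periodic_mode k (real x / real n)) (X n 0 \<omega>) - c k)\<^sup>2 \<partial>M n) + ?err n"
      using S.periodic_second_moment[of ?w "mode_norm k" t "periodic_phase k" "c k"] mode_norm_bounds[of k] t
      by (simp add: periodic_mode_def periodic_freq_shift)
  qed (auto simp: phi_bound)
qed

text \<open>The hypothesis on n * g is exactly what the error 64 n g t of
  \<open>neumann_second_moment\<close> calls for.\<close>

lemma (in neumann_flow) neumann_hydrodynamic_limit:
  fixes M :: "nat \<Rightarrow> 'w measure" and X :: "nat \<Rightarrow> real \<Rightarrow> 'w \<Rightarrow> nat \<Rightarrow> bool"
  assumes ssep: "\<And>n. 3 \<le> n \<Longrightarrow> slow_ssep n (g n) (bernoulli_product \<gamma> n) (M n) (X n)"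
    and cont: "\<And>u. 0 < u \<Longrightarrow> u < 1 \<Longrightarrow> isCont \<gamma> u"
    and g: "(\<lambda>n. real n * g n) \<longlonglongrightarrow> 0"
  shows "hydrodynamic_limit T M X flow"
proof -
  define a where "a k n x = mode_norm k * cos (pi * real k / (real n - 1) * (real x - 1 / 2))" for k n x :: nat
  have a2: "\<bar>a k n x\<bar> \<le> 2" for k n x unfolding a_def by (rule abs_mode_le)
  have close: "\<bar>a k n x - neumann_mode k (real x / real n)\<bar> \<le> (2 * pi * real k) / real n" if n: "3 \<le> n" "x < n" for k n x
  proof -
    have m: "0 < real n * (real n - 1)" "0 < real n" using n by auto
    have "\<bar>a k n x - neumann_mode k (real x / real n)\<bar>
       = mode_norm k * \<bar>cos (pi * real k / (real n - 1) * (real x - 1 / 2)) - cos (pi * real k * (real x / real n))\<bar>"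
      using mode_norm_bounds[of k]
      by (simp add: a_def neumann_mode_def neumann_freq_def right_diff_distrib[symmetric] abs_mult)
    also have "\<dots> \<le> 2 * \<bar>pi * real k / (real n - 1) * (real x - 1 / 2) - pi * real k * (real x / real n)\<bar>"
      using mode_norm_bounds[of k] by (intro mult_mono abs_cos_diff_le) auto
    \<comment> \<open>The shifted grid (x - 1/2) / (n - 1) and the grid x / n are within 1/n of each
      other, the difference being antisymmetric about x = n/2.\<close>
    also have "pi * real k / (real n - 1) * (real x - 1 / 2) - pi * real k * (real x / real n)
        = pi * real k * ((real x - real n / 2) / (real n * (real n - 1)))"
      using n by (simp add: field_simps)
    also have "2 * \<bar>pi * real k * ((real x - real n / 2) / (real n * (real n - 1)))\<bar>
        = 2 * pi * real k * (\<bar>real x - real n / 2\<bar> / (real n * (real n - 1)))"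
      using m by (simp add: abs_mult abs_divide)
    also have "\<dots> \<le> 2 * pi * real k * (1 / real n)"
    proof (intro mult_left_mono)
      have "\<bar>real x - real n / 2\<bar> \<le> real n / 2" using n by linarith
      also have "\<dots> \<le> real n - 1" using n by linarith
      finally show "\<bar>real x - real n / 2\<bar> / (real n * (real n - 1)) \<le> 1 / real n"
        using n m by (simp add: divide_simps)
    qed auto
    finally show ?thesis by simp
  qed
  show ?thesis
  proof (rule hydrodynamic_limit_if_modes_converge[where a = a])
    fix n :: nat assume n: "3 \<le> n"
    interpret S: slow_ssep n "g n" "bernoulli_product \<gamma> n" "M n" "X n" by (rule ssep[OF n])
    show "prob_space (M n)" by (rule S.prob_space_axioms)
    show "integrable (M n) (\<lambda>\<omega>. f (X n t \<omega>) :: real)" if "0 \<le> t" for t f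
      by (rule S.f_X_integrable[OF that])
  next
    fix k
    show "\<exists>K. \<forall>n\<ge>3. \<forall>x<n. \<bar>a k n x - neumann_mode k (real x / real n)\<bar> \<le> K / real n"
      using close by blast
    fix t :: real assume t: "0 < t"
    let ?w = "neumann_freq k"
    let ?err = "\<lambda>n. (5 + 2 * \<bar>c k\<bar>) * ((16 * ?w\<^sup>2 / real n + 64 * (real n * g n)) * t + 16 / real n)"
    have n0: "(\<lambda>n. r / real n) \<longlonglongrightarrow> 0" for r :: real by real_asymp
    have "?err \<longlonglongrightarrow> (5 + 2 * \<bar>c k\<bar>) * ((0 + 64 * 0) * t + 0)"
      by (intro tendsto_add tendsto_mult tendsto_const g n0)
    then have err: "?err \<longlonglongrightarrow> 0" by simp
    show "(\<lambda>n. \<integral>\<omega>. (empirical n (a k n) (X n t \<omega>) - exp (- ?w\<^sup>2 * t) * c k)\<^sup>2 \<partial>M n) \<longlonglongrightarrow> 0"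
    proof (rule mode_converges[OF ssep cont a2 close t discrete_eigenvalue_tendsto(2) err])
      fix n :: nat assume n: "3 \<le> n"
      interpret S: slow_ssep n "g n" "bernoulli_product \<gamma> n" "M n" "X n" by (rule ssep[OF n])
      show "(\<integral>\<omega>. (empirical n (a k n) (X n t \<omega>) - exp (- ((real n)\<^sup>2 * (2 - 2 * cos (?w / (real n - 1)))) * t) * c k)\<^sup>2 \<partial>M n)
        \<le> (\<integral>\<omega>. (empirical n (a k n) (X n 0 \<omega>) - c k)\<^sup>2 \<partial>M n) + ?err n"
        using S.neumann_second_moment[of "mode_norm k" t k "c k"] mode_norm_bounds[of k] t
        unfolding a_def[abs_def] neumann_freq_def by simp
    qed
  qed
qed

theorem theorem2p2:
  fixes \<gamma> :: "real \<Rightarrow> real" and g :: "nat \<Rightarrow> real" and T :: real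
    and M :: "nat \<Rightarrow> 'w measure" and X :: "nat \<Rightarrow> real \<Rightarrow> 'w \<Rightarrow> nat \<Rightarrow> bool"
  assumes "periodic_fun_simple' \<gamma>"
    and "\<forall>x. \<gamma> x \<in> {0..1}"
    and "\<forall>x. x \<notin> \<int> \<longrightarrow> isCont \<gamma> x"
    and "(INF x. \<gamma> x) > 0"
    and "\<forall>n\<ge>1. g n > 0"
    and "\<forall>n\<ge>1. slow_site_ssep n (g n) (bernoulli_product \<gamma> n) (M n) (X n)"
    and "T > 0"
  shows "((\<lambda>n. g n - 1) \<in> o(\<lambda>_. 1) \<longrightarrow>
           (\<exists>\<rho>. is_the_solution T (weak_solution_periodic T \<gamma>) \<rho> \<and> hydrodynamic_limit T M X \<rho>)) \<and>
         (\<forall>\<alpha> \<beta>. \<alpha> > 0 \<and> \<beta> > 1 \<and> (\<forall>n\<ge>1. g n = \<alpha> * real n powr (- \<beta>)) \<longrightarrow>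
           (\<exists>\<rho>. is_the_solution T (weak_solution_neumann T \<gamma>) \<rho> \<and> hydrodynamic_limit T M X \<rho>))"
proof -
  \<comment> \<open>The possible discontinuities are the integers, a countable set, which gives
    Borel measurability.\<close>
  have "continuous_on (- \<int>) \<gamma>"
    using assms(3) by (auto intro!: continuous_at_imp_continuous_on)
  then have borel: "\<gamma> \<in> borel_measurable borel"
    by (intro borel_measurable_continuous_countable_exceptions[of "\<int>"] countable_int)
  have ax: "heat_flow_axioms \<gamma>" using borel assms(2) by unfold_locales auto
  interpret P: periodic_flow \<gamma>
    by (intro periodic_flow.intro heat_flow.intro periodic_basis ax)
  interpret N: neumann_flow \<gamma>
    by (intro neumann_flow.intro heat_flow.intro neumann_basis ax)
  have ssep: "slow_ssep n (g n) (bernoulli_product \<gamma> n) (M n) (X n)" if "3 \<le> n" for n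
    using that assms(5,6) by unfold_locales (auto intro: less_imp_le)
  have cont: "isCont \<gamma> u" if "0 < u" "u < 1" for u
  proof -
    have "u \<notin> \<int>" using that by (auto elim!: Ints_cases)
    then show ?thesis using assms(3) by blast
  qed
  have prob: "prob_space (M n)" if "3 \<le> n" for n
    using assms(6) that by (simp add: slow_site_ssep_def markov_process_with_generator_def)
  show ?thesis
  proof (intro conjI impI allI)
    assume "(\<lambda>n. g n - 1) \<in> o(\<lambda>_. 1)"
    then have "(\<lambda>n. g n - 1) \<longlonglongrightarrow> 0" using smalloD_tendsto by fastforce
    from tendsto_add[OF this tendsto_const[of 1]] have g: "g \<longlonglongrightarrow> 1" by simp
    \<comment> \<open>The limit comes before the solution property, since it provides the bound that
      a periodic weak solution must satisfy.\<close>
    have hyd: "hydrodynamic_limit T M X P.flow"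
      by (rule P.periodic_hydrodynamic_limit[OF ssep cont g])
    have "is_the_solution T (weak_solution_periodic T \<gamma>) P.flow"
      unfolding is_the_solution_def
      using P.flow_solves_periodic[OF P.flow_range_if_hydrodynamic_limit[OF hyd _ _ _ prob]]
        P.periodic_solution_unique[of T] assms(7) by auto
    with hyd show "\<exists>\<rho>. is_the_solution T (weak_solution_periodic T \<gamma>) \<rho> \<and> hydrodynamic_limit T M X \<rho>" by blast
  next
    fix \<alpha> \<beta> :: real
    assume H: "\<alpha> > 0 \<and> \<beta> > 1 \<and> (\<forall>n\<ge>1. g n = \<alpha> * real n powr (- \<beta>))"
    have "(\<lambda>n. real n * (\<alpha> * real n powr (- \<beta>))) \<longlonglongrightarrow> 0"
      using H by real_asymp
    moreover have "\<forall>\<^sub>F n in sequentially. real n * (\<alpha> * real n powr (- \<beta>)) = real n * g n"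
      using eventually_ge_at_top[of 1] by eventually_elim (use H in simp)
    ultimately have g: "(\<lambda>n. real n * g n) \<longlonglongrightarrow> 0" by (rule Lim_transform_eventually)
    have "hydrodynamic_limit T M X N.flow"
      by (rule N.neumann_hydrodynamic_limit[OF ssep cont g])
    moreover have "is_the_solution T (weak_solution_neumann T \<gamma>) N.flow"
      using N.flow_is_the_neumann_solution[of T] assms(7) by simp
    ultimately show "\<exists>\<rho>. is_the_solution T (weak_solution_neumann T \<gamma>) \<rho> \<and> hydrodynamic_limit T M X \<rho>" by blast
  qed
qed

end
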